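(* Let $D$ be an integrally closed integral domain that is not a field. The following conditions are equivalent: (i) $D$ is Clifford $w$-regular; (ii) $D[X]$ is Clifford $w$-regular; (iii) $\mathrm{Na}(D,v)$ is Clifford regular. Likewise, the following conditions are equivalent: (i') $D$ is $w$-stable; (ii') $D[X]$ is $w$-stable; (iii') $\mathrm{Na}(D,v)$ is stable.
   Context: For an integral domain $D$ with field of fractions $K$, "ideal" means fractional ideal, an integral ideal is an ideal contained in $D$, and $\mathcal{F}(D)$ is the set of nonzero ideals. For ideals $I,J$, $(J:I)=\{x\in K: xI\subseteq J\}$. For $I\in\mathcal F(D)$: $I^v=(D:(D:I))$; $I^t=\bigcup\{J^v: J\in\mathcal F(D)\text{ finitely generated}, J\subseteq I\}$; $I$ is a $t$-ideal if $I=I^t$; a $t$-maximal ideal is an ideal maximal among the proper integral $t$-ideals (it is prime), and $t\text{-Max}(D)$ is the set of these; $I^w=\bigcap_{M\in t\text{-Max}(D)}ID_M$, equivalently $I^w=\bigcup\{(I:J): J\text{ finitely generated},(D:J)=D\}$. These operations are defined for every domain (e.g. $D[X]$, with its own $t$- and $w$-operation). Stability: for $I\in\mathcal F(D)$ put $E(I)=(I:I)$, an overring of $D$. $I$ is stable if it is invertible as an ideal of $E(I)$, i.e. $I(E(I):I)=E(I)$; $D$ is stable if every nonzero ideal is stable. $I$ is $w$-stable if, with $E=E(I^w)$, $(I^w(E:I^w))^w=E$ (here $w$ is the $w$-operation of $D$); $D$ is $w$-stable if every nonzero ideal is $w$-stable. Clifford regularity: $I\in\mathcal F(D)$ is vN-regular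 if $I=I^2J$ for some nonzero ideal $J$; $D$ is Clifford regular if every nonzero ideal is vN-regular. $I$ is $w$-regular if $I^w=(I^2J)^w$ for some nonzero ideal $J$; $D$ is Clifford $w$-regular if every nonzero ideal is $w$-regular (equivalently, the semigroup of $w$-ideals under $w$-multiplication modulo nonzero principal ideals is a Clifford semigroup). $X$ is an indeterminate over $D$. $\mathrm{Na}(D,v)=D[X]_{N(v)}$, where $N(v)=\{h\in D[X]: h\neq0,\ c(h)^v=D\}$ and $c(h)$ is the ideal of $D$ generated by the coefficients of $h$. *)

theory Defs
  imports "HOL-Computational_Algebra.Computational_Algebra"
begin

(* Every domain is represented as a subring R of a field type 'k, and UNIV :: 'k set plays the
   role of its field of fractions.  The definitions are meant for subrings R such that every
   element of 'k is a quotient of elements of R; this holds for the three domains they are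
   applied to: base_dom and poly_dom are the canonical copies of a domain in its type of
   fractions, and nagata_v lies between poly_dom and its field of fractions. *)

definition is_submodule :: "'k::field set \<Rightarrow> 'k set \<Rightarrow> bool" where
  "is_submodule R I \<longleftrightarrow>
     0 \<in> I \<and> (\<forall>x\<in>I. \<forall>y\<in>I. x + y \<in> I) \<and> (\<forall>r\<in>R. \<forall>x\<in>I. r * x \<in> I)"

definition frac_ideals :: "'k::field set \<Rightarrow> 'k set set" where
  "frac_ideals R =
     {I. is_submodule R I \<and> I \<noteq> {0} \<and> (\<exists>d\<in>R. d \<noteq> 0 \<and> (\<forall>x\<in>I. d * x \<in> R))}"

definition fin_gen :: "'k::field set \<Rightarrow> 'k set \<Rightarrow> bool" where
  "fin_gen R I \<longleftrightarrow> (\<exists>S. finite S \<and> I = is_submodule R hull S)"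

definition colon :: "'k::field set \<Rightarrow> 'k set \<Rightarrow> 'k set" where
  "colon J I = {x. \<forall>y\<in>I. x * y \<in> J}"

definition ideal_mult :: "'k::field set \<Rightarrow> 'k set \<Rightarrow> 'k set" where
  "ideal_mult I J =
     {(\<Sum>i<n. a i * b i) | (n::nat) a b. \<forall>i<n. a i \<in> I \<and> b i \<in> J}"

definition localization :: "'k::field set \<Rightarrow> 'k set \<Rightarrow> 'k set" where
  "localization R S = {a / s | a s. a \<in> R \<and> s \<in> S}"

definition v_cl :: "'k::field set \<Rightarrow> 'k set \<Rightarrow> 'k set" where
  "v_cl R I = colon R (colon R I)"

definition t_cl :: "'k::field set \<Rightarrow> 'k set \<Rightarrow> 'k set" where
  "t_cl R I = \<Union> {v_cl R J | J. J \<in> frac_ideals R \<and> fin_gen R J \<and> J \<subseteq> I}"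

definition proper_t_ideals :: "'k::field set \<Rightarrow> 'k set set" where
  "proper_t_ideals R = {I \<in> frac_ideals R. I \<subset> R \<and> t_cl R I = I}"

definition t_Max :: "'k::field set \<Rightarrow> 'k set set" where
  "t_Max R = {M \<in> proper_t_ideals R. \<forall>N \<in> proper_t_ideals R. M \<subseteq> N \<longrightarrow> N = M}"

definition w_cl :: "'k::field set \<Rightarrow> 'k set \<Rightarrow> 'k set" where
  "w_cl R I = (\<Inter>M \<in> t_Max R. ideal_mult I (localization R (R - M)))"

definition stable_ideal :: "'k::field set \<Rightarrow> bool" where
  "stable_ideal I \<longleftrightarrow> (let E = colon I I in ideal_mult I (colon E I) = E)"

definition stable_dom :: "'k::field set \<Rightarrow> bool" where
  "stable_dom R \<longleftrightarrow> (\<forall>I \<in> frac_ideals R. stable_ideal I)"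

(* The w-operation is that of R throughout, also when applied to a module over E. *)
definition w_stable_ideal :: "'k::field set \<Rightarrow> 'k set \<Rightarrow> bool" where
  "w_stable_ideal R I \<longleftrightarrow>
     (let W = w_cl R I; E = colon W W in w_cl R (ideal_mult W (colon E W)) = E)"

definition w_stable_dom :: "'k::field set \<Rightarrow> bool" where
  "w_stable_dom R \<longleftrightarrow> (\<forall>I \<in> frac_ideals R. w_stable_ideal R I)"

definition vN_regular_ideal :: "'k::field set \<Rightarrow> 'k set \<Rightarrow> bool" where
  "vN_regular_ideal R I \<longleftrightarrow>
     (\<exists>J \<in> frac_ideals R. I = ideal_mult (ideal_mult I I) J)"

definition Clifford_regular :: "'k::field set \<Rightarrow> bool" where
  "Clifford_regular R \<longleftrightarrow> (\<forall>I \<in> frac_ideals R. vN_regular_ideal R I)"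

definition w_regular_ideal :: "'k::field set \<Rightarrow> 'k set \<Rightarrow> bool" where
  "w_regular_ideal R I \<longleftrightarrow>
     (\<exists>J \<in> frac_ideals R. w_cl R I = w_cl R (ideal_mult (ideal_mult I I) J))"

definition Clifford_w_regular :: "'k::field set \<Rightarrow> bool" where
  "Clifford_w_regular R \<longleftrightarrow> (\<forall>I \<in> frac_ideals R. w_regular_ideal R I)"

definition integral_over :: "'k::field set \<Rightarrow> 'k \<Rightarrow> bool" where
  "integral_over R x \<longleftrightarrow>
     (\<exists>p. lead_coeff p = 1 \<and> (\<forall>i. coeff p i \<in> R) \<and> poly p x = 0)"

definition integrally_closed :: "'k::field set \<Rightarrow> bool" where
  "integrally_closed R \<longleftrightarrow> (\<forall>x. integral_over R x \<longrightarrow> x \<in> R)"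

definition base_dom :: "'a::idom fract set" where
  "base_dom = range to_fract"

definition poly_dom :: "'a::idom poly fract set" where
  "poly_dom = range to_fract"

lemma base_dom_quotient: "\<exists>a\<in>base_dom. \<exists>b\<in>base_dom. b \<noteq> 0 \<and> x = a / b"
proof (cases x)
  case (Fract a b)
  then have "x = to_fract a / to_fract b" "to_fract b \<noteq> 0"
    by (simp_all add: Fract_conv_to_fract)
  then show ?thesis unfolding base_dom_def by blast
qed

lemma poly_dom_quotient: "\<exists>a\<in>poly_dom. \<exists>b\<in>poly_dom. b \<noteq> 0 \<and> x = a / b"
  using base_dom_quotient unfolding base_dom_def poly_dom_def by blast

(* The ideal generated by the coefficients; unlike the constant "content" of the library,
   it does not refer to greatest common divisors. *)
definition content_ideal :: "'a::idom poly \<Rightarrow> 'a fract set" where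
  "content_ideal h = is_submodule base_dom hull (range (\<lambda>i. to_fract (coeff h i)))"

definition N_v :: "'a::idom poly set" where
  "N_v = {h. h \<noteq> 0 \<and> v_cl base_dom (content_ideal h) = base_dom}"

definition nagata_v :: "'a::idom poly fract set" where
  "nagata_v = localization poly_dom (to_fract ` N_v)"

end

theory Submission
  imports Defs
begin

text \<open>
  Write \<open>T\<close> for the Nagata ring and call a finite set \<open>S \<subseteq> D\<close> with \<open>(D : S) = D\<close> a GV set.
  Then \<open>I\<^sup>w\<close> consists of the \<open>x\<close> with \<open>S x \<subseteq> I\<close> for some GV set \<open>S\<close>, the polynomials in \<open>N(v)\<close>
  are those whose coefficients form a GV set, and the span of a GV set of \<open>D\<close> or of \<open>D[X]\<close>
  meets \<open>N(v)\<close>. Hence \<open>I\<^sup>w T = I T\<close> for ideals of either ring, while \<open>I T \<inter> K = I\<^sup>w\<close> for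
  ideals of \<open>D\<close>.

  Applied to \<open>I = (1, x)\<close>, each of the conditions on \<open>D\<close> and on \<open>T\<close> makes all localizations of
  the integrally closed domain \<open>D\<close> at \<open>t\<close>-maximal ideals valuation domains. Every polynomial
  \<open>f\<close> over \<open>D\<close> then generates in \<open>T\<close> the same ideal as its coefficients, so every ideal of \<open>T\<close>
  is extended from \<open>D\<close>, and products and colons of \<open>w\<close>-ideals of \<open>D\<close> correspond to those of
  ideals of \<open>T\<close>.

  Ideals of \<open>T\<close> are always extended from \<open>D[X]\<close>, which gives the passage from \<open>D[X]\<close> to \<open>T\<close>.
  Conversely \<open>A\<^sup>w \<supseteq> A T \<inter> A K[X]\<close> for an ideal \<open>A\<close> of \<open>D[X]\<close>; since \<open>K[X]\<close> is a principal ideal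
  domain, \<open>A\<close> may be scaled so that \<open>A K[X] = K[X]\<close>, and only the behaviour of \<open>A T\<close> matters.
\<close>

section \<open>Products of ideals\<close>

text \<open>The ring \<open>T\<close> does not see all of \<open>D[X]\<close>: since
  \<open>X\<close> lies in \<open>N(v)\<close>, the w-ideal \<open>X D[X]\<close> becomes the unit
  ideal of \<open>T\<close>. So the analogue of \<open>I T \<inter> K = I^w\<close> fails for
  \<open>D[X]\<close>, and \<open>K[X]\<close> is the second ring, recording what \<open>T\<close>
  forgets. A multiplier for an ideal \<open>A\<close> of \<open>D[X]\<close> has to be right in both
  rings. It is built as \<open>(1 / g) J D[X]\<close>, with \<open>g\<close> a generator of
  \<open>A K[X]\<close> and \<open>J\<close> an ideal of \<open>D\<close>: under the valuation
  property every ideal of \<open>T\<close> can be reached through such a \<open>J\<close>, while in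
  \<open>K[X]\<close> a nonzero \<open>J\<close> becomes the unit ideal and leaves exactly the
  inverse of \<open>g\<close>.

  Integral closedness acts on \<open>I = (1, x)\<close>. It forces \<open>(I : I)\<close> to be the
  base ring, locally as well as in \<open>T\<close>; hence von Neumann regularity of
  \<open>I\<close> turns into invertibility, and this for every \<open>x\<close> gives the valuation
  property. That \<open>D\<close> is not a field guarantees t-maximal ideals; without them the
  intersection defining the w-operation would run over the empty family.\<close>

lemma ideal_multI: "x \<in> I \<Longrightarrow> y \<in> J \<Longrightarrow> x * y \<in> ideal_mult I J"
  unfolding ideal_mult_def
  by (rule CollectI, rule exI[of _ 1], rule exI[of _ "\<lambda>_. x"], rule exI[of _ "\<lambda>_. y"]) simp

lemma ideal_mult_zero: "0 \<in> ideal_mult I J"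
  unfolding ideal_mult_def by (rule CollectI, rule exI[of _ 0]) simp

lemma ideal_mult_add:
  assumes "x \<in> ideal_mult I J" "y \<in> ideal_mult I J"
  shows "x + y \<in> ideal_mult I J"
proof -
  from assms(1) obtain n :: nat and a b
    where x: "x = (\<Sum>i<n. a i * b i)" "\<forall>i<n. a i \<in> I \<and> b i \<in> J"
    unfolding ideal_mult_def by blast
  from assms(2) obtain m :: nat and c d
    where y: "y = (\<Sum>i<m. c i * d i)" "\<forall>i<m. c i \<in> I \<and> d i \<in> J"
    unfolding ideal_mult_def by blast
  \<comment> \<open>The two sums are concatenated, the index of the second being shifted by
    \<open>n\<close>.\<close>
  let ?a = "\<lambda>i. if i < n then a i else c (i - n)"
  let ?b = "\<lambda>i. if i < n then b i else d (i - n)"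
  have "(\<Sum>i<n + m. ?a i * ?b i) = x + y"
    by (simp add: sum.nat_group[symmetric] x y lessThan_atLeast0
        sum.atLeastLessThan_concat[of 0 n "n + m", symmetric])
       (simp add: sum.shift_bounds_nat_ivl[of _ 0 n m, simplified add_0 add.commute[of m n]])
  moreover have "\<forall>i<n + m. ?a i \<in> I \<and> ?b i \<in> J"
    using x(2) y(2) by auto
  ultimately show ?thesis
    unfolding ideal_mult_def by (intro CollectI exI[of _ "n + m"] exI[of _ ?a] exI[of _ ?b]) simp
qed

text \<open>The predicate is arbitrary instead of membership in a module, because several
  applications prove the existence of a denominator, which changes from summand to summand.\<close>

lemma ideal_mult_induct [consumes 1, case_names zero add mult]:
  assumes "z \<in> ideal_mult I J"
    and "P 0" and "\<And>x y. P x \<Longrightarrow> P y \<Longrightarrow> P (x + y)"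
    and "\<And>x y. x \<in> I \<Longrightarrow> y \<in> J \<Longrightarrow> P (x * y)"
  shows "P z"
proof -
  from assms(1) obtain n :: nat and a b
    where z: "z = (\<Sum>i<n. a i * b i)" "\<forall>i<n. a i \<in> I \<and> b i \<in> J"
    unfolding ideal_mult_def by blast
  have "P (\<Sum>i<k. a i * b i)" if "k \<le> n" for k
    using that by (induction k) (use assms z in auto)
  then show ?thesis using z(1) by blast
qed

lemma ideal_mult_mono: "I \<subseteq> I' \<Longrightarrow> J \<subseteq> J' \<Longrightarrow> ideal_mult I J \<subseteq> ideal_mult I' J'"
  unfolding ideal_mult_def by blast

lemma ideal_mult_commute: "ideal_mult I J = ideal_mult J I"
proof -
  have "ideal_mult I J \<subseteq> ideal_mult J I" for I J :: "'k::field set"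
  proof
    fix z assume "z \<in> ideal_mult I J"
    then show "z \<in> ideal_mult J I"
      by (induction rule: ideal_mult_induct)
         (auto intro: ideal_mult_zero ideal_mult_add, metis ideal_multI mult.commute)
  qed
  then show ?thesis by blast
qed

lemma ideal_mult_assoc:
  "ideal_mult (ideal_mult I J) L = ideal_mult I (ideal_mult J L)"
proof -
  have half: "ideal_mult (ideal_mult I J) L \<subseteq> ideal_mult I (ideal_mult J L)"
    for I J L :: "'k::field set"
  proof
    fix z assume "z \<in> ideal_mult (ideal_mult I J) L"
    then show "z \<in> ideal_mult I (ideal_mult J L)"
    proof (induction rule: ideal_mult_induct)
      case (mult x y)
      from this(1) show ?case
      proof (induction rule: ideal_mult_induct)
        case (mult a b)
        then show ?case
          using \<open>y \<in> L\<close> by (simp add: mult.assoc ideal_multI)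
      qed (simp_all add: ideal_mult_zero ideal_mult_add distrib_right)
    qed (simp_all add: ideal_mult_zero ideal_mult_add)
  qed
  have "ideal_mult I (ideal_mult J L) = ideal_mult (ideal_mult L J) I"
    by (metis ideal_mult_commute)
  also have "\<dots> \<subseteq> ideal_mult L (ideal_mult J I)"
    by (rule half)
  also have "\<dots> = ideal_mult (ideal_mult I J) L"
    by (metis ideal_mult_commute)
  finally show ?thesis using half by blast
qed

lemma ideal_mult_left_commute:
  "ideal_mult I (ideal_mult J L) = ideal_mult J (ideal_mult I L)"
  by (metis ideal_mult_assoc ideal_mult_commute)

lemmas ideal_mult_ac = ideal_mult_assoc ideal_mult_commute ideal_mult_left_commute

lemma is_submoduleD:
  assumes "is_submodule R I"
  shows "0 \<in> I" "\<And>x y. x \<in> I \<Longrightarrow> y \<in> I \<Longrightarrow> x + y \<in> I" "\<And>r x. r \<in> R \<Longrightarrow> x \<in> I \<Longrightarrow> r * x \<in> I"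
  using assms unfolding is_submodule_def by auto

lemma is_submodule_sum:
  assumes "is_submodule R I" "\<And>i. i \<in> A \<Longrightarrow> f i \<in> I"
  shows "sum f A \<in> I"
  using assms(2) by (induction A rule: infinite_finite_induct)
    (auto simp: is_submoduleD[OF assms(1)])

lemma ideal_mult_subset:
  assumes "is_submodule R C" "\<And>x y. x \<in> I \<Longrightarrow> y \<in> J \<Longrightarrow> x * y \<in> C"
  shows "ideal_mult I J \<subseteq> C"
proof
  fix z assume "z \<in> ideal_mult I J"
  then show "z \<in> C"
    by (induction rule: ideal_mult_induct) (auto simp: is_submoduleD[OF assms(1)] assms(2))
qed

lemma is_submodule_ideal_mult:
  assumes "is_submodule R I"
  shows "is_submodule R (ideal_mult I J)"
proof -
  have "r * z \<in> ideal_mult I J" if "r \<in> R" "z \<in> ideal_mult I J" for r z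
    using that(2)
    by (induction rule: ideal_mult_induct)
       (simp_all add: ideal_mult_zero ideal_mult_add distrib_left ideal_multI
          mult.assoc[symmetric] is_submoduleD[OF assms] that(1))
  then show ?thesis
    unfolding is_submodule_def by (blast intro: ideal_mult_zero ideal_mult_add)
qed

lemma is_submodule_ideal_mult2:
  "is_submodule R J \<Longrightarrow> is_submodule R (ideal_mult I J)"
  by (metis is_submodule_ideal_mult ideal_mult_commute)

lemma is_submodule_colon:
  assumes "is_submodule R W"
  shows "is_submodule R (colon W I)"
  using assms unfolding is_submodule_def colon_def by (auto simp: distrib_right mult.assoc)

lemma is_submodule_scale:
  assumes "is_submodule R I"
  shows "is_submodule R ((*) c ` I)"
  unfolding is_submodule_def
proof (intro conjI ballI)
  show "0 \<in> (*) c ` I"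
    using is_submoduleD(1)[OF assms] by force
  show "x + y \<in> (*) c ` I" if "x \<in> (*) c ` I" "y \<in> (*) c ` I" for x y
    using that is_submoduleD(2)[OF assms] by (auto simp: distrib_left[symmetric])
  show "r * x \<in> (*) c ` I" if "r \<in> R" "x \<in> (*) c ` I" for r x
    using that is_submoduleD(3)[OF assms] by (auto simp: mult.left_commute)
qed

text \<open>Reduces statements about products to generators: \<open>y\<close> multiplies a whole
  generated module into \<open>I\<close> as soon as this preimage contains the generators.\<close>

lemma is_submodule_mult_vimage:
  "is_submodule R I \<Longrightarrow> is_submodule R {x. x * y \<in> I}"
  unfolding is_submodule_def by (auto simp: distrib_right mult.assoc)

lemma colon_mult: "x \<in> colon J I \<Longrightarrow> y \<in> I \<Longrightarrow> x * y \<in> J"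
  unfolding colon_def by blast

lemma frac_idealsD:
  assumes "I \<in> frac_ideals R"
  shows "is_submodule R I" "\<exists>x\<in>I. x \<noteq> 0" "\<exists>d\<in>R. d \<noteq> 0 \<and> (\<forall>x\<in>I. d * x \<in> R)"
proof -
  show sub: "is_submodule R I" and "\<exists>d\<in>R. d \<noteq> 0 \<and> (\<forall>x\<in>I. d * x \<in> R)"
    using assms unfolding frac_ideals_def by auto
  have "I \<noteq> {0}" "0 \<in> I"
    using assms is_submoduleD(1)[OF sub] unfolding frac_ideals_def by auto
  then show "\<exists>x\<in>I. x \<noteq> 0" by blast
qed

lemma frac_idealsI:
  assumes "is_submodule R I" "x \<in> I" "x \<noteq> 0" "d \<in> R" "d \<noteq> 0" "\<And>x. x \<in> I \<Longrightarrow> d * x \<in> R"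
  shows "I \<in> frac_ideals R"
  using assms unfolding frac_ideals_def by blast

section \<open>Subrings of a field and their fractional ideals\<close>

locale field_subring =
  fixes R :: "'k::field set"
  assumes zero_mem: "0 \<in> R" and one_mem: "1 \<in> R"
    and add_mem: "x \<in> R \<Longrightarrow> y \<in> R \<Longrightarrow> x + y \<in> R"
    and uminus_mem: "x \<in> R \<Longrightarrow> - x \<in> R"
    and mult_mem: "x \<in> R \<Longrightarrow> y \<in> R \<Longrightarrow> x * y \<in> R"
begin

lemma is_submodule_self: "is_submodule R R"
  unfolding is_submodule_def by (auto intro: zero_mem add_mem mult_mem)

lemma submodule_uminus: "is_submodule R I \<Longrightarrow> x \<in> I \<Longrightarrow> - x \<in> I"
  using is_submoduleD(3)[of R I "- 1" x] uminus_mem[OF one_mem] by simp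

lemma diff_mem: "x \<in> R \<Longrightarrow> y \<in> R \<Longrightarrow> x - y \<in> R"
  using add_mem[of x "- y"] uminus_mem by simp

lemma ideal_mult_self: "is_submodule R I \<Longrightarrow> ideal_mult I R = I"
proof
  assume I: "is_submodule R I"
  show "ideal_mult I R \<subseteq> I"
    by (rule ideal_mult_subset[OF I]) (metis mult.commute is_submoduleD(3)[OF I])
  show "I \<subseteq> ideal_mult I R"
    using ideal_multI[OF _ one_mem] by force
qed

lemma frac_ideals_colon:
  assumes W: "W \<in> frac_ideals R" and B: "B \<in> frac_ideals R"
  shows "colon W B \<in> frac_ideals R"
proof -
  from frac_idealsD[OF W] obtain x d
    where x: "x \<in> W" "x \<noteq> 0" and d: "d \<in> R" "d \<noteq> 0" "\<And>x. x \<in> W \<Longrightarrow> d * x \<in> R" by blast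
  from frac_idealsD[OF B] obtain y e
    where y: "y \<in> B" "y \<noteq> 0" and e: "e \<in> R" "e \<noteq> 0" "\<And>x. x \<in> B \<Longrightarrow> e * x \<in> R" by blast
  note Wsub = frac_idealsD(1)[OF W]
  \<comment> \<open>\<open>e\<close> clears the denominators of \<open>B\<close>, so
    \<open>e x\<close> multiplies \<open>B\<close> into \<open>W\<close>. For the common
    denominator, \<open>z y \<in> W\<close> for every \<open>z\<close> in the colon, so
    \<open>d\<close> clears \<open>z y\<close>; the factor \<open>e\<close> puts \<open>e y\<close>
    into \<open>R\<close>.\<close>
  have "e * x \<in> colon W B"
    unfolding colon_def
    using is_submoduleD(3)[OF Wsub e(3) x(1)] by (auto simp: ac_simps)
  moreover have "d * (e * y) * z \<in> R" if "z \<in> colon W B" for z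
    using mult_mem[OF e(1) d(3)[OF colon_mult[OF that y(1)]]] by (simp add: ac_simps)
  moreover have "d * (e * y) \<in> R"
    by (intro mult_mem d e y)
  ultimately show ?thesis
    using x y d e
    by (intro frac_idealsI[of _ _ "e * x" "d * (e * y)"]) (auto intro: is_submodule_colon Wsub)
qed

lemma frac_ideals_scale:
  assumes I: "I \<in> frac_ideals R" and c: "c \<noteq> 0" "d \<in> R" "d \<noteq> 0" "d * c \<in> R"
  shows "(*) c ` I \<in> frac_ideals R"
proof -
  from frac_idealsD[OF I] obtain x e
    where x: "x \<in> I" "x \<noteq> 0" and e: "e \<in> R" "e \<noteq> 0" "\<And>x. x \<in> I \<Longrightarrow> e * x \<in> R" by blast
  have "(d * e) * (c * y) \<in> R" if "y \<in> I" for y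
    using mult_mem[OF c(4) e(3)[OF that]] by (simp add: ac_simps)
  then show ?thesis
    using x e c frac_idealsD(1)[OF I]
    by (intro frac_idealsI[of _ _ "c * x" "d * e"]) (auto intro: is_submodule_scale mult_mem)
qed

text \<open>Multiplying \<open>I (E : I) = E\<close> by \<open>I\<close> gives
  \<open>I^2 (E : I) = I E = I\<close>, so \<open>(E : I)\<close> serves as the multiplier.\<close>

lemma stable_imp_Clifford_regular:
  assumes "stable_dom R"
  shows "Clifford_regular R"
  unfolding Clifford_regular_def
proof
  fix I assume I: "I \<in> frac_ideals R"
  define E where "E = colon I I"
  have E: "E \<in> frac_ideals R" and EI: "colon E I \<in> frac_ideals R"
    unfolding E_def by (intro frac_ideals_colon I)+
  have "ideal_mult I (colon E I) = E"
    using assms I unfolding stable_dom_def stable_ideal_def E_def Let_def by blast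
  moreover have "ideal_mult I E = I"
  proof
    show "ideal_mult I E \<subseteq> I"
      by (rule ideal_mult_subset[OF frac_idealsD(1)[OF I]])
         (metis colon_mult mult.commute E_def)
    have "1 \<in> E" unfolding E_def colon_def by simp
    then show "I \<subseteq> ideal_mult I E"
      using ideal_multI[of _ I 1 E] by force
  qed
  ultimately have "I = ideal_mult (ideal_mult I I) (colon E I)"
    by (simp add: ideal_mult_assoc)
  then show "vN_regular_ideal R I"
    unfolding vN_regular_ideal_def using EI by blast
qed

end

section \<open>Maximal t-ideals and the w-operation\<close>

text \<open>Finite sets with trivial inverse; they generate the ideals usually named after Glaz and
  Vasconcelos.\<close>

definition GV_set :: "'k::field set \<Rightarrow> 'k set \<Rightarrow> bool" where
  "GV_set R S \<longleftrightarrow> finite S \<and> S \<subseteq> R \<and> (\<forall>y. (\<forall>s\<in>S. y * s \<in> R) \<longrightarrow> y \<in> R)"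

lemma GV_setD:
  assumes "GV_set R S"
  shows "finite S" "S \<subseteq> R" "\<And>y. (\<And>s. s \<in> S \<Longrightarrow> y * s \<in> R) \<Longrightarrow> y \<in> R"
  using assms unfolding GV_set_def by auto

lemma GV_set_mono:
  assumes "GV_set R S" "S \<subseteq> S'" "finite S'" "S' \<subseteq> R"
  shows "GV_set R S'"
  using assms unfolding GV_set_def by blast

lemma is_submodule_hull: "is_submodule R (is_submodule R hull S)"
  by (rule hull_in) (auto simp: is_submodule_def)

lemma v_cl_mono: "I \<subseteq> J \<Longrightarrow> v_cl R I \<subseteq> v_cl R J"
  unfolding v_cl_def colon_def by auto

lemma v_cl_increasing: "I \<subseteq> v_cl R I"
  unfolding v_cl_def colon_def by (auto simp: mult.commute)

section \<open>Divisorial closure and t-closure through finite generating sets\<close>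

context field_subring
begin

lemma colon_hull: "colon R (is_submodule R hull S) = colon R S"
proof
  show "colon R (is_submodule R hull S) \<subseteq> colon R S"
    unfolding colon_def by (auto intro: hull_inc)
  show "colon R S \<subseteq> colon R (is_submodule R hull S)"
  proof
    fix x assume "x \<in> colon R S"
    then have "S \<subseteq> {y. y * x \<in> R}"
      unfolding colon_def by (auto simp: mult.commute)
    then have "is_submodule R hull S \<subseteq> {y. y * x \<in> R}"
      by (intro hull_minimal is_submodule_mult_vimage is_submodule_self)
    then show "x \<in> colon R (is_submodule R hull S)"
      unfolding colon_def by (auto simp: mult.commute)
  qed
qed

lemma v_cl_hull: "v_cl R (is_submodule R hull S) = v_cl R S"
  unfolding v_cl_def colon_hull ..

lemma t_cl_iff:
  assumes I: "I \<in> frac_ideals R"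
  shows "x \<in> t_cl R I \<longleftrightarrow> (\<exists>S. finite S \<and> S \<subseteq> I \<and> x \<in> v_cl R S)"
proof
  assume "x \<in> t_cl R I"
  then obtain J where J: "fin_gen R J" "J \<subseteq> I" "x \<in> v_cl R J"
    unfolding t_cl_def by blast
  then obtain S where S: "finite S" "J = is_submodule R hull S"
    unfolding fin_gen_def by blast
  have "S \<subseteq> J" unfolding S(2) by (rule hull_subset)
  then show "\<exists>S. finite S \<and> S \<subseteq> I \<and> x \<in> v_cl R S"
    using S J v_cl_hull by blast
next
  assume "\<exists>S. finite S \<and> S \<subseteq> I \<and> x \<in> v_cl R S"
  then obtain S where S: "finite S" "S \<subseteq> I" "x \<in> v_cl R S" by blast
  note D = frac_idealsD[OF I]
  obtain y d where y: "y \<in> I" "y \<noteq> 0" and d: "d \<in> R" "d \<noteq> 0" "\<forall>x\<in>I. d * x \<in> R"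
    using D(2,3) by blast
  \<comment> \<open>A nonzero \<open>y\<close> is adjoined because \<open>S\<close> may span only
    zero, which \<open>frac_ideals\<close> excludes; enlarging \<open>S\<close> can only enlarge its
    v-closure.\<close>
  let ?J = "is_submodule R hull (insert y S)"
  have J: "?J \<subseteq> I"
    using S(2) y(1) by (intro hull_minimal D(1)) auto
  have "?J \<in> frac_ideals R"
    using J d y by (intro frac_idealsI[of _ _ y d] is_submodule_hull) (auto intro: hull_inc)
  moreover have "fin_gen R ?J"
    unfolding fin_gen_def using S(1) by blast
  moreover have "x \<in> v_cl R ?J"
    unfolding v_cl_hull using v_cl_mono[of S "insert y S" R] S(3) by blast
  ultimately show "x \<in> t_cl R I"
    unfolding t_cl_def using J by blast
qed

end

text \<open>\<open>quotient\<close> makes the ambient field the field of fractions;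
  \<open>nonunit\<close> says that \<open>R\<close> is not a field and so supplies a t-maximal
  ideal.\<close>

locale frac_subring = field_subring R for R :: "'k::field set" +
  assumes quotient: "\<exists>a\<in>R. \<exists>b\<in>R. b \<noteq> 0 \<and> x = a / b"
    and nonunit: "\<exists>d\<in>R. d \<noteq> 0 \<and> inverse d \<notin> R"
begin

text \<open>Zorn's lemma is applied to this class instead of the proper t-ideals: the condition
  concerns finite sets, hence passes to unions of chains, and any nonzero integral ideal without a
  GV set can be the starting point. Maximal members are then shown to be t-maximal.\<close>

definition GV_free :: "'k set set" where
  "GV_free = {I. is_submodule R I \<and> I \<noteq> {0} \<and> I \<subseteq> R \<and> (\<forall>S. GV_set R S \<longrightarrow> \<not> S \<subseteq> I)}"

lemma integral_ideal_frac:
  assumes "is_submodule R I" "I \<noteq> {0}" "I \<subseteq> R"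
  shows "I \<in> frac_ideals R"
proof -
  obtain x where "x \<in> I" "x \<noteq> 0"
    using assms(2) is_submoduleD(1)[OF assms(1)] by blast
  then show ?thesis
    using assms(1,3) by (intro frac_idealsI[of R I x 1]) (auto simp: one_mem)
qed

lemma GV_free_frac: "I \<in> GV_free \<Longrightarrow> I \<in> frac_ideals R"
  unfolding GV_free_def by (blast intro: integral_ideal_frac)

text \<open>A GV set \<open>S\<close> has \<open>1 \<in> v_cl R S\<close>, so a t-ideal containing
  \<open>S\<close> contains \<open>1\<close>.\<close>

lemma proper_t_ideals_GV_free: "proper_t_ideals R \<subseteq> GV_free"
proof
  fix I assume "I \<in> proper_t_ideals R"
  then have I: "I \<in> frac_ideals R" "I \<subset> R" "t_cl R I = I"
    unfolding proper_t_ideals_def by auto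
  note sub = frac_idealsD(1)[OF I(1)]
  have "\<not> S \<subseteq> I" if S: "GV_set R S" for S
  proof
    assume "S \<subseteq> I"
    moreover have "1 \<in> v_cl R S"
      using S unfolding GV_set_def v_cl_def colon_def by auto
    ultimately have "1 \<in> I"
      using t_cl_iff[OF I(1), of 1] S I(3) unfolding GV_set_def by blast
    then have "R \<subseteq> I"
      using is_submoduleD(3)[OF sub, of _ 1] by auto
    then show False using I(2) by blast
  qed
  then show "I \<in> GV_free"
    using I sub unfolding GV_free_def frac_ideals_def by auto
qed

text \<open>The point is properness: if \<open>1\<close> is in the t-closure, it comes from a finite
  \<open>S \<subseteq> I\<close> with \<open>1 \<in> v_cl R S\<close>, and such an \<open>S\<close>
  is a GV set.\<close>

lemma t_cl_GV_free:
  assumes I: "I \<in> GV_free"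
  shows "t_cl R I \<in> proper_t_ideals R" "I \<subseteq> t_cl R I"
proof -
  have sub: "is_submodule R I" and IR: "I \<subseteq> R" and I0: "I \<noteq> {0}"
    and free: "\<And>S. GV_set R S \<Longrightarrow> \<not> S \<subseteq> I"
    using I unfolding GV_free_def by auto
  note mem = t_cl_iff[OF GV_free_frac[OF I]]
  show inc: "I \<subseteq> t_cl R I"
  proof
    fix x assume "x \<in> I"
    then show "x \<in> t_cl R I"
      unfolding mem using v_cl_increasing[of "{x}" R] by (intro exI[of _ "{x}"]) auto
  qed
  have v_sub: "is_submodule R (v_cl R S)" for S
    unfolding v_cl_def by (rule is_submodule_colon[OF is_submodule_self])
  \<comment> \<open>The v-closure is monotone, so finitely many elements of the t-closure come from
    one finite subset of \<open>I\<close>. Both additivity and idempotence rest on this.\<close>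
  have collect: "\<exists>S'. finite S' \<and> S' \<subseteq> I \<and> S \<subseteq> v_cl R S'" if "finite S" "S \<subseteq> t_cl R I" for S
    using that
  proof (induction S)
    case (insert x S)
    from insert.prems have S: "S \<subseteq> t_cl R I" and x: "x \<in> t_cl R I" by simp_all
    from insert.IH[OF S] obtain S1 where S1: "finite S1" "S1 \<subseteq> I" "S \<subseteq> v_cl R S1"
      by blast
    obtain S2 where S2: "finite S2" "S2 \<subseteq> I" "x \<in> v_cl R S2"
      using x unfolding mem by blast
    have "insert x S \<subseteq> v_cl R (S1 \<union> S2)"
      using S1(3) S2(3) v_cl_mono[of S1 "S1 \<union> S2" R] v_cl_mono[of S2 "S1 \<union> S2" R] by blast
    then show ?case
      using S1 S2 by (intro exI[of _ "S1 \<union> S2"]) auto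
  qed auto
  have subt: "is_submodule R (t_cl R I)"
    unfolding is_submodule_def
  proof (intro conjI ballI)
    show "0 \<in> t_cl R I" using inc is_submoduleD(1)[OF sub] by blast
    show "x + y \<in> t_cl R I" if "x \<in> t_cl R I" "y \<in> t_cl R I" for x y
    proof -
      have "\<exists>S. finite S \<and> S \<subseteq> I \<and> {x, y} \<subseteq> v_cl R S"
        using that by (intro collect) simp_all
      then obtain S where "finite S" "S \<subseteq> I" "x \<in> v_cl R S" "y \<in> v_cl R S"
        by blast
      then show ?thesis
        unfolding mem using is_submoduleD(2)[OF v_sub[of S], of x y] by blast
    qed
    show "r * x \<in> t_cl R I" if r: "r \<in> R" and x: "x \<in> t_cl R I" for r x
    proof -
      obtain S where "finite S" "S \<subseteq> I" "x \<in> v_cl R S"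
        using x unfolding mem by blast
      then show ?thesis
        unfolding mem using is_submoduleD(3)[OF v_sub[of S] r] by blast
    qed
  qed
  have tR: "t_cl R I \<subseteq> R"
  proof
    fix x assume "x \<in> t_cl R I"
    then obtain S where "S \<subseteq> I" "x \<in> v_cl R S" unfolding mem by blast
    moreover from this IR have "1 \<in> colon R S" unfolding colon_def by auto
    ultimately have "x * 1 \<in> R" unfolding v_cl_def by (intro colon_mult)
    then show "x \<in> R" by simp
  qed
  have idem: "v_cl R S \<subseteq> t_cl R I" if "finite S" "S \<subseteq> t_cl R I" for S
  proof
    fix x assume x: "x \<in> v_cl R S"
    obtain S' where S': "finite S'" "S' \<subseteq> I" "S \<subseteq> v_cl R S'"
      using collect[OF \<open>finite S\<close> \<open>S \<subseteq> t_cl R I\<close>] by blast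
    have "x \<in> v_cl R S'"
      unfolding v_cl_def colon_def
    proof (intro CollectI ballI)
      fix y assume "y \<in> {x. \<forall>y\<in>S'. x * y \<in> R}"
      then have y: "y \<in> colon R S'" unfolding colon_def .
      have "s * y \<in> R" if "s \<in> S" for s
      proof (rule colon_mult)
        show "s \<in> colon R (colon R S')" using S'(3) that unfolding v_cl_def by blast
      qed (rule y)
      then have "y \<in> colon R S"
        unfolding colon_def by (simp add: mult.commute)
      then show "x * y \<in> R"
        using x unfolding v_cl_def by (intro colon_mult)
    qed
    then show "x \<in> t_cl R I"
      unfolding mem using S' by blast
  qed
  have "t_cl R I \<noteq> {0}"
    using inc I0 is_submoduleD(1)[OF sub] by auto
  then have frac: "t_cl R I \<in> frac_ideals R"
    using subt tR by (intro integral_ideal_frac)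
  have "t_cl R (t_cl R I) = t_cl R I"
  proof
    show "t_cl R (t_cl R I) \<subseteq> t_cl R I"
    proof
      fix x assume "x \<in> t_cl R (t_cl R I)"
      then obtain S where S: "finite S" "S \<subseteq> t_cl R I" "x \<in> v_cl R S"
        unfolding t_cl_iff[OF frac] by blast
      show "x \<in> t_cl R I" using idem[OF S(1,2)] S(3) by (rule subsetD)
    qed
    show "t_cl R I \<subseteq> t_cl R (t_cl R I)"
    proof
      fix x assume "x \<in> t_cl R I"
      then show "x \<in> t_cl R (t_cl R I)"
        unfolding t_cl_iff[OF frac] using v_cl_increasing[of "{x}" R]
        by (intro exI[of _ "{x}"]) auto
    qed
  qed
  moreover have "t_cl R I \<noteq> R"
  proof
    assume "t_cl R I = R"
    then have "1 \<in> t_cl R I" using one_mem by simp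
    then obtain S where S: "finite S" "S \<subseteq> I" "1 \<in> v_cl R S"
      unfolding mem by blast
    then have "GV_set R S"
      unfolding GV_set_def v_cl_def colon_def using IR by auto
    then show False using free S(2) by blast
  qed
  ultimately show "t_cl R I \<in> proper_t_ideals R"
    unfolding proper_t_ideals_def using frac tR by blast
qed

lemma maximal_GV_free_in_t_Max:
  assumes M: "M \<in> GV_free" and max: "\<And>N. N \<in> GV_free \<Longrightarrow> M \<subseteq> N \<Longrightarrow> N = M"
  shows "M \<in> t_Max R"
proof -
  have "t_cl R M \<in> GV_free"
    using t_cl_GV_free(1)[OF M] proper_t_ideals_GV_free by (rule rev_subsetD)
  then have "t_cl R M = M"
    using t_cl_GV_free(2)[OF M] by (rule max)
  then have "M \<in> proper_t_ideals R"
    using t_cl_GV_free(1)[OF M] by simp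
  moreover have "N = M" if "N \<in> proper_t_ideals R" "M \<subseteq> N" for N
    using subsetD[OF proper_t_ideals_GV_free that(1)] that(2) by (rule max)
  ultimately show ?thesis
    unfolding t_Max_def by simp
qed

text \<open>A GV set inside the union of a chain is finite, hence already lies in one member of the
  chain; this is what Zorn's lemma needs.\<close>

lemma GV_free_subset_t_Max:
  assumes I: "I \<in> GV_free"
  shows "\<exists>M\<in>t_Max R. I \<subseteq> M"
proof -
  let ?A = "{N \<in> GV_free. I \<subseteq> N}"
  have "\<exists>M\<in>?A. \<forall>N\<in>?A. M \<subseteq> N \<longrightarrow> N = M"
  proof (rule subset_Zorn_nonempty)
    show "?A \<noteq> {}" using I by blast
    fix C assume C: "C \<noteq> {}" "subset.chain ?A C"
    then have CA: "C \<subseteq> ?A" unfolding subset.chain_def by blast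
    have sub: "is_submodule R N" "N \<subseteq> R" "I \<subseteq> N" if "N \<in> C" for N
      using CA that unfolding GV_free_def by auto
    have "is_submodule R (\<Union>C)"
      unfolding is_submodule_def
    proof (intro conjI ballI)
      show "0 \<in> \<Union>C"
        using C(1) sub(1) is_submoduleD(1) by blast
      fix x y assume "x \<in> \<Union>C" "y \<in> \<Union>C"
      then obtain N where "N \<in> C" "x \<in> N" "y \<in> N"
        using subset.chain_total[OF C(2)] by blast
      then show "x + y \<in> \<Union>C"
        using is_submoduleD(2)[OF sub(1)] by blast
    next
      fix r x assume "r \<in> R" "x \<in> \<Union>C"
      then show "r * x \<in> \<Union>C"
        using is_submoduleD(3)[OF sub(1)] by blast
    qed
    moreover have "\<not> S \<subseteq> \<Union>C" if S: "GV_set R S" for S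
    proof
      assume "S \<subseteq> \<Union>C"
      then obtain N where "N \<in> C" "S \<subseteq> N"
        using finite_subset_Union_chain[OF GV_setD(1)[OF S] _ C] by blast
      then show False using CA S unfolding GV_free_def by blast
    qed
    moreover have "I \<subseteq> \<Union>C" using C(1) sub(3) by blast
    moreover have "\<Union>C \<noteq> {0}"
      using \<open>I \<subseteq> \<Union>C\<close> I is_submoduleD(1)[of R I] unfolding GV_free_def by auto
    moreover have "\<Union>C \<subseteq> R" using sub(2) by blast
    ultimately show "\<Union>C \<in> ?A" unfolding GV_free_def by blast
  qed
  then obtain M where M: "M \<in> GV_free" "I \<subseteq> M"
    and max: "\<forall>N\<in>{N \<in> GV_free. I \<subseteq> N}. M \<subseteq> N \<longrightarrow> N = M"
    by (metis (no_types, lifting) mem_Collect_eq)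
  have "M \<in> t_Max R"
  proof (rule maximal_GV_free_in_t_Max[OF M(1)])
    fix N assume N: "N \<in> GV_free" "M \<subseteq> N"
    then have "N \<in> {N \<in> GV_free. I \<subseteq> N}" using M(2) by simp
    then show "N = M" using max N(2) by simp
  qed
  then show ?thesis using M(2) by (rule bexI[rotated])
qed

text \<open>A nonunit \<open>d\<close> spans an ideal without GV sets:
  \<open>S \<subseteq> d R\<close> would give \<open>(1 / d) S \<subseteq> R\<close>, hence
  \<open>1 / d \<in> R\<close>.\<close>

lemma t_Max_nonempty: "t_Max R \<noteq> {}"
proof -
  obtain d where d: "d \<in> R" "d \<noteq> 0" "inverse d \<notin> R"
    using nonunit by blast
  have "(*) d ` R \<in> GV_free"
    unfolding GV_free_def
  proof (intro CollectI conjI allI impI notI)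
    show "is_submodule R ((*) d ` R)"
      by (rule is_submodule_scale[OF is_submodule_self])
    show False if "(*) d ` R = {0}"
    proof -
      have "d * 1 \<in> (*) d ` R" using one_mem by (rule imageI)
      then have "d * 1 \<in> {0}" unfolding that .
      then show False using d(2) by simp
    qed
    show "(*) d ` R \<subseteq> R" by (auto intro: mult_mem d(1))
    fix S assume S: "GV_set R S" "S \<subseteq> (*) d ` R"
    have "inverse d * s \<in> R" if s: "s \<in> S" for s
    proof -
      have "s \<in> (*) d ` R" using S(2) s by (rule subsetD)
      then obtain r where "r \<in> R" "s = d * r" by (rule imageE)
      then show ?thesis using d(2) by (simp add: mult.assoc[symmetric])
    qed
    then have "inverse d \<in> R" by (rule GV_setD(3)[OF S(1)])
    then show False using d(3) by contradiction
  qed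
  from GV_free_subset_t_Max[OF this] show ?thesis by blast
qed

lemma t_MaxD:
  assumes "M \<in> t_Max R"
  shows "is_submodule R M" "M \<subseteq> R" "1 \<notin> M" "\<And>S. GV_set R S \<Longrightarrow> \<not> S \<subseteq> M"
proof -
  have "M \<in> GV_free"
    using assms proper_t_ideals_GV_free unfolding t_Max_def by blast
  then show "is_submodule R M" "M \<subseteq> R" and GV: "\<And>S. GV_set R S \<Longrightarrow> \<not> S \<subseteq> M"
    unfolding GV_free_def by auto
  show "1 \<notin> M"
    using GV[of "{1}"] one_mem unfolding GV_set_def by auto
qed

text \<open>The passage from a condition at every t-maximal ideal to one finite set; it is used for
  conductors, for spans and for ideals of coefficients.\<close>

lemma ex_GV_set_subset:
  assumes Q: "is_submodule R Q" "Q \<subseteq> R" and not_sub: "\<And>M. M \<in> t_Max R \<Longrightarrow> \<not> Q \<subseteq> M"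
  shows "\<exists>S. GV_set R S \<and> S \<subseteq> Q"
proof (rule ccontr)
  assume "\<not> ?thesis"
  moreover have "Q \<noteq> {0}"
    using t_Max_nonempty not_sub t_MaxD(1) is_submoduleD(1) by blast
  ultimately have "Q \<in> GV_free"
    unfolding GV_free_def using Q by blast
  then show False using GV_free_subset_t_Max not_sub by blast
qed

text \<open>If \<open>S\<close> lies in no t-maximal ideal, its span contains a GV set
  \<open>S'\<close>, and \<open>y S \<subseteq> R\<close> implies \<open>y S' \<subseteq> R\<close>.
  In this local form the property can be multiplied, because t-maximal ideals are prime.\<close>

lemma GV_set_iff:
  assumes "finite S" "S \<subseteq> R"
  shows "GV_set R S \<longleftrightarrow> (\<forall>M\<in>t_Max R. \<not> S \<subseteq> M)"
proof
  assume "GV_set R S"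
  then show "\<forall>M\<in>t_Max R. \<not> S \<subseteq> M" using t_MaxD(4) by blast
next
  assume *: "\<forall>M\<in>t_Max R. \<not> S \<subseteq> M"
  let ?Q = "is_submodule R hull S"
  have "\<exists>S'. GV_set R S' \<and> S' \<subseteq> ?Q"
  proof (rule ex_GV_set_subset)
    show "?Q \<subseteq> R" using assms(2) by (intro hull_minimal is_submodule_self)
    show "\<not> ?Q \<subseteq> M" if "M \<in> t_Max R" for M
      using * that hull_subset[of S "is_submodule R"] by blast
  qed (rule is_submodule_hull)
  then obtain S' where S': "GV_set R S'" "S' \<subseteq> ?Q" by blast
  show "GV_set R S"
    unfolding GV_set_def
  proof (intro conjI assms allI impI)
    fix y assume "\<forall>s\<in>S. y * s \<in> R"
    then have "y \<in> colon R ?Q" unfolding colon_hull by (simp add: colon_def)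
    then have "y * s \<in> R" if "s \<in> S'" for s
      using subsetD[OF S'(2) that] by (rule colon_mult)
    then show "y \<in> R" by (rule GV_setD(3)[OF S'(1)])
  qed
qed

text \<open>By maximality \<open>M + a R\<close> lies in no t-maximal ideal, so it contains a GV set
  \<open>S\<close>. Then \<open>b S \<subseteq> M\<close>, and \<open>b\<close> belongs to the
  v-closure of \<open>b S\<close>, hence to the t-ideal \<open>M\<close>.\<close>

lemma t_Max_prime:
  assumes M: "M \<in> t_Max R" and a: "a \<in> R" "a \<notin> M" and b: "b \<in> R" "a * b \<in> M"
  shows "b \<in> M"
proof -
  note sub = t_MaxD(1)[OF M]
  let ?N = "{m + r * a | m r. m \<in> M \<and> r \<in> R}"
  have MN: "M \<subseteq> ?N"
  proof
    fix m assume "m \<in> M"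
    moreover have "m = m + 0 * a" by simp
    ultimately show "m \<in> ?N" using zero_mem by blast
  qed
  have "a = 0 + 1 * a" by simp
  then have aN: "a \<in> ?N"
    using one_mem is_submoduleD(1)[OF sub] by blast
  have "\<exists>S. GV_set R S \<and> S \<subseteq> ?N"
  proof (rule ex_GV_set_subset)
    show "is_submodule R ?N"
      unfolding is_submodule_def
    proof (intro conjI ballI)
      show "0 \<in> ?N" using MN is_submoduleD(1)[OF sub] by blast
    next
      fix x y assume "x \<in> ?N" "y \<in> ?N"
      then obtain m r n s where "m \<in> M" "r \<in> R" "n \<in> M" "s \<in> R" "x = m + r * a" "y = n + s * a"
        by blast
      then have "x + y = (m + n) + (r + s) * a" "m + n \<in> M" "r + s \<in> R"
        by (auto simp: algebra_simps add_mem is_submoduleD(2)[OF sub])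
      then show "x + y \<in> ?N" by blast
    next
      fix t x assume "t \<in> R" "x \<in> ?N"
      then obtain m r where "m \<in> M" "r \<in> R" "x = m + r * a" by blast
      then have "t * x = t * m + (t * r) * a" "t * m \<in> M" "t * r \<in> R"
        using \<open>t \<in> R\<close> by (simp_all add: distrib_left mult.assoc mult_mem is_submoduleD(3)[OF sub])
      then show "t * x \<in> ?N" by blast
    qed
    show "?N \<subseteq> R"
      using t_MaxD(2)[OF M] a(1) by (auto intro!: add_mem mult_mem)
    fix M' assume M': "M' \<in> t_Max R"
    show "\<not> ?N \<subseteq> M'"
    proof
      assume "?N \<subseteq> M'"
      then have "M \<subseteq> M'" "a \<in> M'" using MN aN by blast+
      then have "M' = M" using M M' unfolding t_Max_def by simp
      then show False using \<open>a \<in> M'\<close> a(2) by blast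
    qed
  qed
  then obtain S where S: "GV_set R S" "S \<subseteq> ?N" by blast
  have bS: "b * s \<in> M" if "s \<in> S" for s
  proof -
    from that S(2) obtain m r where "m \<in> M" "r \<in> R" "s = m + r * a" by blast
    then have "b * s = b * m + r * (a * b)" by (simp add: algebra_simps)
    also have "\<dots> \<in> M"
      using \<open>m \<in> M\<close> \<open>r \<in> R\<close> b is_submoduleD(2,3)[OF sub] by blast
    finally show ?thesis .
  qed
  have "M \<in> proper_t_ideals R" using M unfolding t_Max_def by blast
  then have "M \<in> frac_ideals R" "t_cl R M = M" unfolding proper_t_ideals_def by auto
  moreover have "b \<in> v_cl R ((*) b ` S)"
    unfolding v_cl_def colon_def
  proof (intro CollectI ballI)
    fix y assume y: "y \<in> {x. \<forall>y\<in>(*) b ` S. x * y \<in> R}"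
    have "b * y * s \<in> R" if s: "s \<in> S" for s
    proof -
      have "y * (b * s) \<in> R" using y s by simp
      then show ?thesis by (simp add: ac_simps)
    qed
    then show "b * y \<in> R" by (rule GV_setD(3)[OF S(1)])
  qed
  ultimately show ?thesis
    using t_cl_iff[of M b] bS GV_setD(1)[OF S(1)] by (auto intro!: exI[of _ "(*) b ` S"])
qed

lemma mem_localization:
  assumes M: "M \<in> t_Max R" and I: "is_submodule R I"
  shows "x \<in> ideal_mult I (localization R (R - M)) \<longleftrightarrow> (\<exists>s\<in>R - M. s * x \<in> I)"
proof
  assume "x \<in> ideal_mult I (localization R (R - M))"
  then show "\<exists>s\<in>R - M. s * x \<in> I"
  proof (induction rule: ideal_mult_induct)
    case zero
    then show ?case using one_mem t_MaxD(3)[OF M] is_submoduleD(1)[OF I] by auto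
  next
    case (add x y)
    then obtain s t where s: "s \<in> R - M" "s * x \<in> I" and t: "t \<in> R - M" "t * y \<in> I" by blast
    have "s * t \<in> R - M" using s t t_Max_prime[OF M] mult_mem by blast
    moreover have "(s * t) * (x + y) = t * (s * x) + s * (t * y)"
      by (simp add: algebra_simps)
    then have "(s * t) * (x + y) \<in> I"
      using s t is_submoduleD(2,3)[OF I] by simp
    ultimately show ?case by blast
  next
    case (mult x y)
    then obtain a s where a: "a \<in> R" "s \<in> R" "s \<notin> M" "y = a / s"
      unfolding localization_def by blast
    moreover have "s \<noteq> 0" using a(3) is_submoduleD(1)[OF t_MaxD(1)[OF M]] by auto
    ultimately have "s * (x * y) = a * x" by simp
    then show ?case
      using a mult(1) is_submoduleD(3)[OF I] by (intro bexI[of _ s]) auto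
  qed
next
  assume "\<exists>s\<in>R - M. s * x \<in> I"
  then obtain s where s: "s \<in> R - M" "s * x \<in> I" by blast
  then have "s \<noteq> 0" using is_submoduleD(1)[OF t_MaxD(1)[OF M]] by auto
  then have "x = (s * x) * (1 / s)" by simp
  moreover have "1 / s \<in> localization R (R - M)"
    unfolding localization_def using s(1) one_mem by blast
  ultimately show "x \<in> ideal_mult I (localization R (R - M))"
    using s(2) ideal_multI by metis
qed

lemma mem_w_cl_localization:
  assumes I: "is_submodule R I"
  shows "x \<in> w_cl R I \<longleftrightarrow> (\<forall>M\<in>t_Max R. \<exists>s\<in>R - M. s * x \<in> I)"
  unfolding w_cl_def using mem_localization[OF _ I] by auto

text \<open>The conductor of \<open>x\<close> into \<open>I\<close> lies in no t-maximal ideal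
  exactly when it contains a GV set; this is the description of the w-operation used from here
  on.\<close>

lemma mem_w_cl:
  assumes I: "is_submodule R I"
  shows "x \<in> w_cl R I \<longleftrightarrow> (\<exists>S. GV_set R S \<and> (\<forall>s\<in>S. s * x \<in> I))"
proof
  assume x: "x \<in> w_cl R I"
  let ?Q = "{r. r * x \<in> I} \<inter> R"
  have "is_submodule R ?Q"
    using is_submodule_mult_vimage[OF I, of x] is_submodule_self
    unfolding is_submodule_def by auto
  moreover have "\<not> ?Q \<subseteq> M" if "M \<in> t_Max R" for M
    using x that unfolding mem_w_cl_localization[OF I] by blast
  ultimately show "\<exists>S. GV_set R S \<and> (\<forall>s\<in>S. s * x \<in> I)"
    using ex_GV_set_subset[of ?Q] by blast
next
  assume "\<exists>S. GV_set R S \<and> (\<forall>s\<in>S. s * x \<in> I)"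
  then show "x \<in> w_cl R I"
    unfolding mem_w_cl_localization[OF I] using GV_setD(2) t_MaxD(4) by blast
qed

end

context field_subring
begin

lemma GV_set_one: "GV_set R {1}"
  unfolding GV_set_def using one_mem by simp

end

lemma colon_self_mult: "x \<in> colon W W \<Longrightarrow> y \<in> colon W W \<Longrightarrow> x * y \<in> colon W W"
  unfolding colon_def by (simp add: mult.assoc)

text \<open>\<open>E\<close> is a ring, so \<open>(E : W)\<close> is an \<open>E\<close>-module and
  its product with \<open>W\<close> is an ideal of \<open>E\<close>.\<close>

lemma ideal_mult_colon_absorb:
  assumes E: "E = colon W W" and e: "e \<in> E" and z: "z \<in> ideal_mult W (colon E W)"
  shows "e * z \<in> ideal_mult W (colon E W)"
  using z
proof (induction rule: ideal_mult_induct)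
  case (mult x y)
  have "y * e \<in> colon E W"
    unfolding colon_def
  proof (intro CollectI ballI)
    fix w assume "w \<in> W"
    then have "e * (y * w) \<in> E"
      using e colon_mult[OF mult(2)] unfolding E by (metis colon_self_mult)
    then show "y * e * w \<in> E" by (simp add: ac_simps)
  qed
  then have "x * (y * e) \<in> ideal_mult W (colon E W)" by (rule ideal_multI[OF mult(1)])
  then show ?case by (simp add: ac_simps)
qed (simp_all add: ideal_mult_zero ideal_mult_add distrib_left)

lemma ideal_mult_colon_subset:
  assumes "is_submodule R E"
  shows "ideal_mult W (colon E W) \<subseteq> E"
  by (rule ideal_mult_subset[OF assms]) (metis colon_mult mult.commute)

text \<open>The second factor may vary with \<open>s\<close>, because in the double w-closure of
  \<open>x\<close> each \<open>s x\<close> comes with a GV set of its own.\<close>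

lemma GV_set_dependent_mult:
  assumes R: "field_subring R" and S: "GV_set R S" and T: "\<And>s. s \<in> S \<Longrightarrow> GV_set R (T s)"
  shows "GV_set R (\<Union>s\<in>S. (*) s ` T s)"
  unfolding GV_set_def
proof (intro conjI allI impI)
  show "finite (\<Union>s\<in>S. (*) s ` T s)"
    by (intro finite_UN_I finite_imageI GV_setD(1)[OF S] GV_setD(1)[OF T])
  show "(\<Union>s\<in>S. (*) s ` T s) \<subseteq> R"
  proof (intro UN_least image_subsetI)
    fix s t assume "s \<in> S" "t \<in> T s"
    then show "s * t \<in> R"
      using GV_setD(2)[OF S] GV_setD(2)[OF T[of s]] by (auto intro!: field_subring.mult_mem[OF R])
  qed
  fix y assume y: "\<forall>z\<in>(\<Union>s\<in>S. (*) s ` T s). y * z \<in> R"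
  show "y \<in> R"
  proof (rule GV_setD(3)[OF S])
    fix s assume s: "s \<in> S"
    show "y * s \<in> R"
    proof (rule GV_setD(3)[OF T[OF s]])
      fix t assume "t \<in> T s"
      then have "y * (s * t) \<in> R" using y s by blast
      then show "y * s * t \<in> R" by (simp add: mult.assoc)
    qed
  qed
qed

section \<open>Closure properties of the w-operation\<close>

context frac_subring
begin

lemma w_clI:
  assumes "is_submodule R I" "GV_set R S" "\<And>s. s \<in> S \<Longrightarrow> s * x \<in> I"
  shows "x \<in> w_cl R I"
  unfolding mem_w_cl[OF assms(1)] using assms(2,3) by (intro exI[of _ S]) simp

lemma w_clE:
  assumes "is_submodule R I" "x \<in> w_cl R I"
  obtains S where "GV_set R S" "\<forall>s\<in>S. s * x \<in> I"
  using assms(2) unfolding mem_w_cl[OF assms(1)] by blast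

lemma w_cl_increasing: "is_submodule R I \<Longrightarrow> I \<subseteq> w_cl R I"
proof
  fix x assume I: "is_submodule R I" and x: "x \<in> I"
  show "x \<in> w_cl R I" by (rule w_clI[OF I GV_set_one]) (simp add: x)
qed

lemma w_cl_mono: "I \<subseteq> J \<Longrightarrow> w_cl R I \<subseteq> w_cl R J"
  unfolding w_cl_def by (intro INF_mono' ideal_mult_mono subset_refl)

lemma is_submodule_w_cl:
  assumes I: "is_submodule R I"
  shows "is_submodule R (w_cl R I)"
  unfolding is_submodule_def
proof (intro conjI ballI)
  show "0 \<in> w_cl R I"
    using w_cl_increasing[OF I] is_submoduleD(1)[OF I] by blast
next
  fix x y assume "x \<in> w_cl R I" "y \<in> w_cl R I"
  obtain S where S: "GV_set R S" "\<forall>s\<in>S. s * x \<in> I"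
    by (rule w_clE[OF I \<open>x \<in> w_cl R I\<close>])
  obtain T where T: "GV_set R T" "\<forall>s\<in>T. s * y \<in> I"
    by (rule w_clE[OF I \<open>y \<in> w_cl R I\<close>])
  have "GV_set R (\<Union>s\<in>S. (*) s ` T)"
    by (rule GV_set_dependent_mult[OF field_subring_axioms S(1) T(1)])
  then show "x + y \<in> w_cl R I"
  proof (rule w_clI[OF I])
    fix z assume "z \<in> (\<Union>s\<in>S. (*) s ` T)"
    then obtain s t where st: "s \<in> S" "t \<in> T" "z = s * t" by blast
    then have "z * (x + y) = t * (s * x) + s * (t * y)"
      by (simp add: algebra_simps)
    moreover have "t * (s * x) \<in> I" "s * (t * y) \<in> I"
      using st S T GV_setD(2)[OF S(1)] GV_setD(2)[OF T(1)] is_submoduleD(3)[OF I] by blast+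
    ultimately show "z * (x + y) \<in> I"
      using is_submoduleD(2)[OF I] by simp
  qed
next
  fix r x assume r: "r \<in> R" and x: "x \<in> w_cl R I"
  obtain S where S: "GV_set R S" "\<forall>s\<in>S. s * x \<in> I"
    by (rule w_clE[OF I x])
  from S(1) show "r * x \<in> w_cl R I"
  proof (rule w_clI[OF I])
    fix s assume "s \<in> S"
    then show "s * (r * x) \<in> I"
      using is_submoduleD(3)[OF I r bspec[OF S(2)], of s] by (simp add: mult.left_commute)
  qed
qed

lemma w_cl_idem:
  assumes I: "is_submodule R I"
  shows "w_cl R (w_cl R I) = w_cl R I"
proof
  show "w_cl R I \<subseteq> w_cl R (w_cl R I)"
    by (rule w_cl_increasing[OF is_submodule_w_cl[OF I]])
  show "w_cl R (w_cl R I) \<subseteq> w_cl R I"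
  proof
    fix x assume "x \<in> w_cl R (w_cl R I)"
    then obtain S where S: "GV_set R S" "\<forall>s\<in>S. s * x \<in> w_cl R I"
      by (rule w_clE[OF is_submodule_w_cl[OF I]])
    have "\<exists>T. GV_set R T \<and> (\<forall>t\<in>T. t * (s * x) \<in> I)" if "s \<in> S" for s
      using bspec[OF S(2) that] unfolding mem_w_cl[OF I] .
    then obtain T where T: "\<And>s. s \<in> S \<Longrightarrow> GV_set R (T s)"
      "\<And>s t. s \<in> S \<Longrightarrow> t \<in> T s \<Longrightarrow> t * (s * x) \<in> I"
      by metis
    have "GV_set R (\<Union>s\<in>S. (*) s ` T s)"
      by (rule GV_set_dependent_mult[OF field_subring_axioms S(1) T(1)])
    then show "x \<in> w_cl R I"
    proof (rule w_clI[OF I])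
      fix z assume "z \<in> (\<Union>s\<in>S. (*) s ` T s)"
      then obtain s t where st: "s \<in> S" "t \<in> T s" "z = s * t" by blast
      then show "z * x \<in> I"
        using T(2)[OF st(1,2)] by (simp add: ac_simps)
    qed
  qed
qed

lemma w_cl_minimal:
  assumes "is_submodule R J" "I \<subseteq> w_cl R J"
  shows "w_cl R I \<subseteq> w_cl R J"
  using w_cl_mono[OF assms(2)] w_cl_idem[OF assms(1)] by simp

lemma w_cl_self: "w_cl R R = R"
proof
  show "w_cl R R \<subseteq> R"
  proof
    fix x assume "x \<in> w_cl R R"
    then obtain S where "GV_set R S" "\<forall>s\<in>S. s * x \<in> R"
      by (rule w_clE[OF is_submodule_self])
    then show "x \<in> R" using GV_setD(3)[of R S x] by (simp add: mult.commute)
  qed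
  show "R \<subseteq> w_cl R R" by (rule w_cl_increasing[OF is_submodule_self])
qed

lemma frac_ideals_w_cl:
  assumes I: "I \<in> frac_ideals R"
  shows "w_cl R I \<in> frac_ideals R"
proof -
  note sub = frac_idealsD(1)[OF I]
  obtain x d where x: "x \<in> I" "x \<noteq> 0" and d: "d \<in> R" "d \<noteq> 0" "\<And>x. x \<in> I \<Longrightarrow> d * x \<in> R"
    using frac_idealsD(2,3)[OF I] by blast
  show ?thesis
  proof (rule frac_idealsI[OF is_submodule_w_cl[OF sub] _ x(2) d(1,2)])
    show "x \<in> w_cl R I" using w_cl_increasing[OF sub] x(1) by blast
    fix y assume "y \<in> w_cl R I"
    then obtain S where S: "GV_set R S" "\<forall>s\<in>S. s * y \<in> I"
      by (rule w_clE[OF sub])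
    show "d * y \<in> R"
    proof (rule GV_setD(3)[OF S(1)])
      fix s assume "s \<in> S"
      then show "d * y * s \<in> R"
        using d(3)[OF bspec[OF S(2)], of s] by (simp add: ac_simps)
    qed
  qed
qed

text \<open>If \<open>S x \<subseteq> (J : I)\<close> for a GV set \<open>S\<close>, then
  \<open>S (x y) \<subseteq> J\<close> for each \<open>y \<in> I\<close>, and \<open>J\<close> is
  closed.\<close>

lemma w_cl_colon:
  assumes J: "is_submodule R J" and closed: "w_cl R J = J"
  shows "w_cl R (colon J I) = colon J I"
proof
  note sub = is_submodule_colon[OF J, of I]
  show "colon J I \<subseteq> w_cl R (colon J I)" by (rule w_cl_increasing[OF sub])
  show "w_cl R (colon J I) \<subseteq> colon J I"
  proof
    fix x assume "x \<in> w_cl R (colon J I)"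
    then obtain S where S: "GV_set R S" "\<forall>s\<in>S. s * x \<in> colon J I"
      by (rule w_clE[OF sub])
    have "x * y \<in> J" if y: "y \<in> I" for y
    proof -
      have "x * y \<in> w_cl R J"
        using S(1)
      proof (rule w_clI[OF J])
        fix s assume "s \<in> S"
        then show "s * (x * y) \<in> J"
          using colon_mult[OF bspec[OF S(2)] y, of s] by (simp add: mult.assoc)
      qed
      then show ?thesis using closed by simp
    qed
    then show "x \<in> colon J I" unfolding colon_def by blast
  qed
qed

text \<open>Since \<open>W (E : W)\<close> is an ideal of the ring \<open>E = (W : W)\<close>, a single element decides
  whether its closure is all of \<open>E\<close>.\<close>

lemma w_stable_criterion:
  assumes W: "is_submodule R W" "w_cl R W = W"
    and E: "E = colon W W" and C: "C = ideal_mult W (colon E W)"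
    and one: "1 \<in> w_cl R C"
  shows "w_cl R C = E"
proof
  have subE: "is_submodule R E" unfolding E by (rule is_submodule_colon[OF W(1)])
  have subC: "is_submodule R C" unfolding C by (rule is_submodule_ideal_mult[OF W(1)])
  have "C \<subseteq> E" unfolding C by (rule ideal_mult_colon_subset[OF subE])
  then have "w_cl R C \<subseteq> w_cl R E" by (rule w_cl_mono)
  also have "\<dots> = E" unfolding E by (rule w_cl_colon[OF W])
  finally show "w_cl R C \<subseteq> E" .
  obtain S where S: "GV_set R S" "\<forall>s\<in>S. s * 1 \<in> C"
    using one by (rule w_clE[OF subC])
  show "E \<subseteq> w_cl R C"
  proof
    fix e assume "e \<in> E"
    from S(1) show "e \<in> w_cl R C"
    proof (rule w_clI[OF subC])
      fix s assume "s \<in> S"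
      then have "s \<in> C" using S(2) by simp
      then have "e * s \<in> C" unfolding C by (rule ideal_mult_colon_absorb[OF E \<open>e \<in> E\<close>])
      then show "s * e \<in> C" by (simp add: mult.commute)
    qed
  qed
qed

lemma w_stable_idealI:
  assumes "I \<in> frac_ideals R"
    and "1 \<in> w_cl R (ideal_mult (w_cl R I) (colon (colon (w_cl R I) (w_cl R I)) (w_cl R I)))"
  shows "w_stable_ideal R I"
proof -
  note sub = frac_idealsD(1)[OF assms(1)]
  show ?thesis
    unfolding w_stable_ideal_def Let_def
    by (rule w_stable_criterion[OF is_submodule_w_cl[OF sub] w_cl_idem[OF sub] refl refl assms(2)])
qed

text \<open>As for stable ideals the multiplier is \<open>J = (E : W)\<close>. Since the product to
  be formed is \<open>I I J\<close> and not \<open>W W J\<close>, elements of \<open>W\<close> must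
  be brought back into \<open>I\<close> by GV sets.\<close>

lemma w_stable_imp_Clifford_w_regular:
  assumes "w_stable_dom R"
  shows "Clifford_w_regular R"
  unfolding Clifford_w_regular_def
proof
  fix I assume I: "I \<in> frac_ideals R"
  note sub = frac_idealsD(1)[OF I]
  define W where "W = w_cl R I"
  define E where "E = colon W W"
  define J where "J = colon E W"
  let ?P = "ideal_mult (ideal_mult I I) J"
  have W: "W \<in> frac_ideals R" unfolding W_def by (rule frac_ideals_w_cl[OF I])
  note subW = frac_idealsD(1)[OF W]
  have IW: "I \<subseteq> W" unfolding W_def by (rule w_cl_increasing[OF sub])
  have J: "J \<in> frac_ideals R"
    unfolding J_def E_def by (intro frac_ideals_colon W)
  have P: "is_submodule R ?P"
    by (intro is_submodule_ideal_mult sub)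
  have wE: "w_cl R (ideal_mult W J) = E"
    using assms I unfolding w_stable_dom_def w_stable_ideal_def Let_def J_def E_def W_def by blast
  have "w_cl R ?P \<subseteq> w_cl R I"
  proof (rule w_cl_minimal[OF sub])
    have "ideal_mult I J \<subseteq> E"
      unfolding E_def J_def
      by (rule ideal_mult_subset[OF is_submodule_colon[OF subW]])
         (metis IW colon_mult mult.commute subsetD)
    then have "ideal_mult I (ideal_mult I J) \<subseteq> ideal_mult W E"
      by (intro ideal_mult_mono IW)
    also have "\<dots> \<subseteq> W"
      by (rule ideal_mult_subset[OF subW]) (metis E_def colon_mult mult.commute)
    finally show "?P \<subseteq> w_cl R I"
      by (simp add: ideal_mult_assoc W_def)
  qed
  moreover have "w_cl R I \<subseteq> w_cl R ?P"
  proof (rule w_cl_minimal[OF P], rule subsetI)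
    fix x assume x: "x \<in> I"
    \<comment> \<open>A GV set \<open>S\<close> with \<open>S w \<subseteq> I\<close> multiplies
      \<open>x w j\<close> into \<open>I I J\<close>.\<close>
    have *: "x * z \<in> w_cl R ?P" if "z \<in> ideal_mult W J" for z
      using that
    proof (induction rule: ideal_mult_induct)
      case (mult w j)
      obtain S where S: "GV_set R S" "\<forall>s\<in>S. s * w \<in> I"
        using mult(1) unfolding W_def by (rule w_clE[OF sub])
      from S(1) show ?case
      proof (rule w_clI[OF P])
        fix s assume "s \<in> S"
        then have "(x * (s * w)) * j \<in> ?P" by (intro ideal_multI x bspec[OF S(2)] mult(2))
        then show "s * (x * (w * j)) \<in> ?P" by (simp add: ac_simps)
      qed
    qed (simp_all add: distrib_left is_submoduleD[OF is_submodule_w_cl[OF P]])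
    have "1 \<in> w_cl R (ideal_mult W J)"
      unfolding wE E_def colon_def by simp
    then obtain S where S: "GV_set R S" "\<forall>s\<in>S. s * 1 \<in> ideal_mult W J"
      by (rule w_clE[OF is_submodule_ideal_mult[OF subW]])
    \<comment> \<open>Only the w-closure of \<open>W J\<close> contains \<open>1\<close>, so a
      second GV set enters; idempotence removes the resulting double closure.\<close>
    from S(1) have "x \<in> w_cl R (w_cl R ?P)"
    proof (rule w_clI[OF is_submodule_w_cl[OF P]])
      fix s assume "s \<in> S"
      then show "s * x \<in> w_cl R ?P" using *[of s] S(2) by (simp add: mult.commute)
    qed
    then show "x \<in> w_cl R ?P" by (simp add: w_cl_idem[OF P])
  qed
  ultimately show "w_regular_ideal R I"
    unfolding w_regular_ideal_def using J by blast
qed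

end

section \<open>The valuation property\<close>

text \<open>This is \<open>(1, x) J\<close>. The case \<open>J = R\<close> is the fractional ideal
  \<open>(1, x)\<close>; other \<open>J\<close> occur as its multiples in the determinant
  trick.\<close>

definition two_gen :: "'k::field set \<Rightarrow> 'k \<Rightarrow> 'k set" where
  "two_gen J x = {u + v * x | u v. u \<in> J \<and> v \<in> J}"

lemma two_genI: "u \<in> J \<Longrightarrow> v \<in> J \<Longrightarrow> u + v * x \<in> two_gen J x"
  unfolding two_gen_def by blast

lemma two_genE:
  assumes "z \<in> two_gen J x"
  obtains u v where "u \<in> J" "v \<in> J" "z = u + v * x"
  using assms unfolding two_gen_def by blast

lemma is_submodule_two_gen:
  assumes J: "is_submodule R J"
  shows "is_submodule R (two_gen J x)"
  unfolding is_submodule_def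
proof (intro conjI ballI)
  show "0 \<in> two_gen J x"
    using two_genI[of 0 J 0 x] is_submoduleD(1)[OF J] by simp
next
  fix y z assume "y \<in> two_gen J x" "z \<in> two_gen J x"
  then obtain u v u' v' where uv: "u \<in> J" "v \<in> J" "u' \<in> J" "v' \<in> J"
    and "y = u + v * x" "z = u' + v' * x"
    by (metis two_genE)
  then have "y + z = (u + u') + (v + v') * x" by (simp add: algebra_simps)
  also have "\<dots> \<in> two_gen J x"
    by (intro two_genI is_submoduleD(2)[OF J] uv)
  finally show "y + z \<in> two_gen J x" .
next
  fix r z assume "r \<in> R" "z \<in> two_gen J x"
  then obtain u v where uv: "u \<in> J" "v \<in> J" "z = u + v * x" by (metis two_genE)
  then have "r * z = r * u + (r * v) * x" by (simp add: algebra_simps)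
  then show "r * z \<in> two_gen J x"
    using two_genI[of "r * u" J "r * v" x] is_submoduleD(3)[OF J \<open>r \<in> R\<close>] uv by simp
qed

text \<open>Cayley-Hamilton in size two: multiplication by \<open>z\<close> acts on the generators
  \<open>1, x\<close> by the matrix with rows \<open>a, b\<close> and \<open>c, d\<close>, and
  \<open>?p\<close> is its characteristic polynomial.\<close>

lemma quadratic_integral:
  assumes "field_subring R" "integrally_closed R"
    and R: "a \<in> R" "b \<in> R" "c \<in> R" "d \<in> R"
    and z: "z = a + b * x" "z * x = c + d * x"
  shows "z \<in> R"
proof -
  interpret field_subring R by fact
  let ?p = "[:a * d - b * c, - (a + d), 1:]"
  have "(z - a) * (z - d) = b * (z * x - d * x)"
    using z(1) by (simp add: algebra_simps)
  also have "\<dots> = b * c" using z(2) by simp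
  finally have "poly ?p z = 0" by (simp add: algebra_simps)
  moreover have "coeff ?p i \<in> R" for i
    using R by (auto simp: coeff_pCons split: nat.split
        intro!: diff_mem mult_mem add_mem zero_mem one_mem uminus_mem)
  moreover have "lead_coeff ?p = 1" by simp
  ultimately have "integral_over R z" unfolding integral_over_def by blast
  then show ?thesis using assms(2) unfolding integrally_closed_def by blast
qed

context field_subring
begin

lemma two_gen_mem: "1 \<in> two_gen R x" "x \<in> two_gen R x"
  using two_genI[OF one_mem zero_mem, of x] two_genI[OF zero_mem one_mem, of x] by simp_all

lemma ideal_mult_two_gen:
  assumes J: "is_submodule R J"
  shows "ideal_mult (two_gen R x) J \<subseteq> two_gen J x"
proof (rule ideal_mult_subset[OF is_submodule_two_gen[OF J]])
  fix y z assume y: "y \<in> two_gen R x" and z: "z \<in> J"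
  obtain a b where ab: "a \<in> R" "b \<in> R" "y = a + b * x" using y by (rule two_genE)
  then have "y * z = a * z + (b * z) * x" by (simp add: algebra_simps)
  then show "y * z \<in> two_gen J x"
    using two_genI[of "a * z" J "b * z" x] is_submoduleD(3)[OF J _ z] ab by simp
qed

lemma frac_ideals_two_gen:
  assumes "d \<in> R" "d \<noteq> 0" "d * x \<in> R"
  shows "two_gen R x \<in> frac_ideals R"
proof (rule frac_idealsI[OF is_submodule_two_gen[OF is_submodule_self] two_gen_mem(1) _ assms(1,2)])
  fix y assume "y \<in> two_gen R x"
  then obtain a b where "a \<in> R" "b \<in> R" "y = a + b * x" by (rule two_genE)
  moreover from this have "d * y = d * a + b * (d * x)" by (simp add: algebra_simps)
  ultimately show "d * y \<in> R" using assms by (simp add: add_mem mult_mem)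
qed simp

text \<open>A von Neumann regular ideal \<open>I = (1, x)\<close> with \<open>(I : I) = R\<close> is invertible: \<open>A = I J\<close> lies
  in \<open>R\<close> and \<open>I = I A\<close>, so that the determinant trick gives \<open>1 \<in> A\<close>.\<close>

lemma regular_two_gen_invertible:
  assumes J: "is_submodule R J"
    and reg: "two_gen R x = ideal_mult (ideal_mult (two_gen R x) (two_gen R x)) J"
    and closed: "\<And>z. z \<in> two_gen R x \<Longrightarrow> z * x \<in> two_gen R x \<Longrightarrow> z \<in> R"
  obtains u v where "u \<in> R" "u * x \<in> R" "v \<in> R" "v * x \<in> R" "u + v * x = 1"
proof -
  define I where "I = two_gen R x"
  define A where "A = ideal_mult I J"
  have I: "is_submodule R I" unfolding I_def by (rule is_submodule_two_gen[OF is_submodule_self])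
  have A: "is_submodule R A" unfolding A_def by (rule is_submodule_ideal_mult[OF I])
  have IA: "I = ideal_mult I A"
    using reg unfolding I_def A_def by (simp add: ideal_mult_assoc)
  have AR: "z \<in> R" if z: "z \<in> A" for z
  proof (rule closed)
    have "y * z \<in> I" if "y \<in> I" for y
      by (subst IA) (intro ideal_multI that z)
    from this[of 1] this[of x] show "z \<in> two_gen R x" "z * x \<in> two_gen R x"
      unfolding I_def by (simp_all add: two_gen_mem mult.commute[of z x])
  qed
  have sub: "I \<subseteq> two_gen A x"
    using ideal_mult_two_gen[OF A, of x] unfolding I_def[symmetric] IA[symmetric] .
  obtain a b where ab: "a \<in> A" "b \<in> A" "1 = a + b * x"
    using subsetD[OF sub two_gen_mem(1)[of x, folded I_def]] by (rule two_genE)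
  obtain c d where cd: "c \<in> A" "d \<in> A" "x = c + d * x"
    using subsetD[OF sub two_gen_mem(2)[of x, folded I_def]] by (rule two_genE)
  have "(1 - a) * (1 - d) = b * c"
    using ab(3) cd(3) by algebra
  then have "1 = a + d + (b * c + (- a) * d)" by (simp add: algebra_simps)
  also have "\<dots> \<in> A"
    using ab cd by (intro is_submoduleD(2,3)[OF A] uminus_mem AR)
  finally have "1 \<in> A" .
  then have "1 \<in> two_gen J x"
    using ideal_mult_two_gen[OF J, of x] unfolding A_def I_def by (rule rev_subsetD)
  then obtain u v where uv: "u \<in> J" "v \<in> J" "1 = u + v * x" by (rule two_genE)
  have "y \<in> R" "y * x \<in> R" if "y \<in> J" for y
  proof -
    have "1 * y \<in> A" "x * y \<in> A"
      unfolding A_def I_def by (intro ideal_multI two_gen_mem that)+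
    then show "y \<in> R" "y * x \<in> R" using AR[of y] AR[of "y * x"] by (simp_all add: mult.commute[of x y])
  qed
  then show ?thesis using that[of u v] uv by simp
qed

end

section \<open>The valuation property of localizations at t-maximal ideals\<close>

context frac_subring
begin

text \<open>One of \<open>p\<close> and \<open>q x\<close> lies outside \<open>M\<close> and can be
  taken as \<open>s\<close>. The conclusion is the valuation condition that \<open>x\<close> or
  \<open>1 / x\<close> belongs to the localization at \<open>M\<close>, written without
  fractions.\<close>

lemma t_Max_dichotomy:
  assumes M: "M \<in> t_Max R" and s: "p + q * x \<notin> M"
    and R: "p \<in> R" "p * x \<in> R" "q \<in> R" "q * x \<in> R"
  shows "\<exists>s\<in>R - M. \<exists>r\<in>R. s * x = r \<or> s = r * x"
proof (cases "p \<in> M")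
  case True
  then have "q * x \<notin> M" using s is_submoduleD(2)[OF t_MaxD(1)[OF M]] by blast
  then show ?thesis using R(3,4) by blast
next
  case False
  then show ?thesis using R(1,2) by blast
qed

lemma localization_iff:
  assumes M: "M \<in> t_Max R"
  shows "x \<in> localization R (R - M) \<longleftrightarrow> (\<exists>s\<in>R - M. s * x \<in> R)"
proof -
  have "0 \<in> M" by (rule is_submoduleD(1)[OF t_MaxD(1)[OF M]])
  then have nz: "s \<noteq> 0" if "s \<in> R - M" for s using that by auto
  show ?thesis
  proof
    assume "x \<in> localization R (R - M)"
    then obtain a s where "a \<in> R" "s \<in> R - M" "x = a / s" unfolding localization_def by blast
    then show "\<exists>s\<in>R - M. s * x \<in> R" using nz by (intro bexI[of _ s]) auto
  next
    assume "\<exists>s\<in>R - M. s * x \<in> R"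
    then obtain s where s: "s \<in> R - M" "s * x \<in> R" by blast
    then have "x = (s * x) / s" using nz by simp
    then show "x \<in> localization R (R - M)" unfolding localization_def using s by blast
  qed
qed

lemma t_Max_mult_notin: "M \<in> t_Max R \<Longrightarrow> s \<in> R - M \<Longrightarrow> t \<in> R - M \<Longrightarrow> s * t \<in> R - M"
  using t_Max_prime[of M s t] mult_mem[of s t] by auto

lemma field_subring_localization:
  assumes M: "M \<in> t_Max R"
  shows "field_subring (localization R (R - M))"
proof
  note iff = localization_iff[OF M]
  have R: "x \<in> localization R (R - M)" if "x \<in> R" for x
    unfolding iff using one_mem t_MaxD(3)[OF M] that by (intro bexI[of _ 1]) auto
  show "0 \<in> localization R (R - M)" "1 \<in> localization R (R - M)"
    by (intro R zero_mem one_mem)+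
  fix x assume "x \<in> localization R (R - M)"
  then obtain s where s: "s \<in> R - M" "s * x \<in> R" unfolding iff by blast
  show "- x \<in> localization R (R - M)"
    unfolding iff using s uminus_mem by (intro bexI[of _ s]) auto
  fix y assume "y \<in> localization R (R - M)"
  then obtain t where t: "t \<in> R - M" "t * y \<in> R" unfolding iff by blast
  have st: "s * t \<in> R - M" by (rule t_Max_mult_notin[OF M s(1) t(1)])
  have "(s * t) * (x + y) = t * (s * x) + s * (t * y)" by (simp add: algebra_simps)
  then have "(s * t) * (x + y) \<in> R" using s t by (simp add: add_mem mult_mem)
  with st show "x + y \<in> localization R (R - M)" unfolding iff by blast
  have "(s * x) * (t * y) \<in> R" by (intro mult_mem s t)
  then have "(s * t) * (x * y) \<in> R" by (simp add: ac_simps)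
  with st show "x * y \<in> localization R (R - M)" unfolding iff by blast
qed

text \<open>At \<open>M\<close> the w-closures disappear and the regularity of
  \<open>I = (1, x)\<close> becomes the equation \<open>I L = (I L)^2 (J L)\<close> over the
  localization \<open>L\<close>. Integral closedness makes \<open>I L\<close> invertible, that is
  \<open>u + v x = 1\<close> with \<open>u, u x, v, v x \<in> L\<close>.\<close>

lemma w_regular_imp_dichotomy:
  assumes ic: "integrally_closed R" and reg: "Clifford_w_regular R" and M: "M \<in> t_Max R"
  shows "\<exists>s\<in>R - M. \<exists>r\<in>R. s * x = r \<or> s = r * x"
proof -
  define L where "L = localization R (R - M)"
  define I where "I = two_gen R x"
  interpret L: field_subring L unfolding L_def by (rule field_subring_localization[OF M])
  have RL: "R \<subseteq> L"
    unfolding L_def localization_iff[OF M] subset_iff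
    using one_mem t_MaxD(3)[OF M] by (auto intro: bexI[of _ 1])
  obtain a b where "a \<in> R" "b \<in> R" "b \<noteq> 0" "x = a / b" using quotient by blast
  then have I: "I \<in> frac_ideals R"
    unfolding I_def by (intro frac_ideals_two_gen[of b]) auto
  note subI = frac_idealsD(1)[OF I]
  obtain J where J: "J \<in> frac_ideals R" "w_cl R I = w_cl R (ideal_mult (ideal_mult I I) J)"
    using reg I unfolding Clifford_w_regular_def w_regular_ideal_def by blast
  define P where "P = ideal_mult (ideal_mult I I) J"
  have P: "is_submodule R P" unfolding P_def by (intro is_submodule_ideal_mult subI)
  \<comment> \<open>The w-closure is an intersection over all t-maximal ideals, \<open>M\<close>
    among them, so \<open>H\<close> and its w-closure generate the same
    \<open>L\<close>-module.\<close>
  have w_sub: "w_cl R H \<subseteq> ideal_mult H L" for H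
    unfolding w_cl_def L_def using M by blast
  have LL: "ideal_mult (ideal_mult H L) L = ideal_mult H L" for H
    unfolding ideal_mult_assoc L.ideal_mult_self[OF L.is_submodule_self] ..
  have "I \<subseteq> ideal_mult P L"
    using w_cl_increasing[OF subI] w_sub[of P] J(2) unfolding P_def by simp
  then have "ideal_mult I L \<subseteq> ideal_mult P L"
    using ideal_mult_mono[of I "ideal_mult P L" L L] LL by simp
  moreover have "P \<subseteq> ideal_mult I L"
    using w_cl_increasing[OF P] w_sub[of I] J(2) unfolding P_def by simp
  then have "ideal_mult P L \<subseteq> ideal_mult I L"
    using ideal_mult_mono[of P "ideal_mult I L" L L] LL by simp
  ultimately have IP: "ideal_mult I L = ideal_mult P L" ..
  have PL: "ideal_mult P L =
      ideal_mult (ideal_mult (ideal_mult I L) (ideal_mult I L)) (ideal_mult J L)"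
    unfolding P_def using LL by (simp add: ideal_mult_ac)
  have IL: "ideal_mult I L = two_gen L x"
  proof
    have "I \<subseteq> two_gen L x" unfolding I_def two_gen_def using RL by blast
    then have "ideal_mult I L \<subseteq> ideal_mult (two_gen L x) L" by (intro ideal_mult_mono) auto
    also have "\<dots> = two_gen L x"
      by (rule L.ideal_mult_self[OF is_submodule_two_gen[OF L.is_submodule_self]])
    finally show "ideal_mult I L \<subseteq> two_gen L x" .
    show "two_gen L x \<subseteq> ideal_mult I L"
    proof
      fix z assume "z \<in> two_gen L x"
      then obtain u v where "u \<in> L" "v \<in> L" "z = 1 * u + x * v"
        by (auto elim: two_genE simp: mult.commute)
      then show "z \<in> ideal_mult I L"
        using ideal_mult_add[OF ideal_multI ideal_multI, of 1 I u L x v] two_gen_mem[of x]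
        unfolding I_def by simp
    qed
  qed
  \<comment> \<open>After denominators \<open>s\<close> and \<open>t\<close> outside
    \<open>M\<close> are cleared, \<open>s t z\<close> is integral over \<open>R\<close> itself, so
    only the integral closedness of \<open>R\<close> is called upon.\<close>
  have closed: "z \<in> L" if "z \<in> two_gen L x" "z * x \<in> two_gen L x" for z
  proof -
    have "\<exists>s\<in>R - M. s * z \<in> I" "\<exists>t\<in>R - M. t * (z * x) \<in> I"
      using that unfolding IL[symmetric] unfolding L_def mem_localization[OF M subI] .
    then obtain s t where s: "s \<in> R - M" "s * z \<in> I" and t: "t \<in> R - M" "t * (z * x) \<in> I"
      by blast
    have st: "t * (s * z) \<in> I" "s * (t * (z * x)) \<in> I"
      by (rule is_submoduleD(3)[OF subI]; use s t in blast)+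
    obtain a b where ab: "a \<in> R" "b \<in> R" "t * (s * z) = a + b * x"
      using st(1) unfolding I_def by (rule two_genE)
    obtain c d where cd: "c \<in> R" "d \<in> R" "s * (t * (z * x)) = c + d * x"
      using st(2) unfolding I_def by (rule two_genE)
    have "s * t * z \<in> R"
    proof (rule quadratic_integral[OF field_subring_axioms ic ab(1,2) cd(1,2)])
      show "s * t * z = a + b * x" using ab(3) by (simp add: ac_simps)
      show "s * t * z * x = c + d * x" using cd(3) by (simp add: ac_simps)
    qed
    then show "z \<in> L"
      unfolding L_def localization_iff[OF M] using t_Max_mult_notin[OF M s(1) t(1)] by blast
  qed
  have "two_gen L x = ideal_mult (ideal_mult (two_gen L x) (two_gen L x)) (ideal_mult J L)"
    using IP PL unfolding IL by simp
  then obtain u v where uv: "u \<in> L" "u * x \<in> L" "v \<in> L" "v * x \<in> L" "u + v * x = 1"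
    by (rule L.regular_two_gen_invertible[OF is_submodule_ideal_mult2[OF L.is_submodule_self] _ closed])
  \<comment> \<open>A common denominator outside \<open>M\<close>, to be applied to
    \<open>u, u x, v, v x\<close> at once.\<close>
  have "\<exists>s\<in>R - M. \<forall>y\<in>Y. s * y \<in> R" if "finite Y" "Y \<subseteq> L" for Y
    using that
  proof (induction Y)
    case empty
    then show ?case using one_mem t_MaxD(3)[OF M] by blast
  next
    case (insert y Y)
    then obtain s where s: "s \<in> R - M" "\<forall>y\<in>Y. s * y \<in> R" by blast
    have "y \<in> localization R (R - M)" using insert.prems unfolding L_def by simp
    then obtain t where t: "t \<in> R - M" "t * y \<in> R"
      unfolding localization_iff[OF M] by blast
    have "t * (s * z) \<in> R" if "z \<in> Y" for z using s t that by (simp add: mult_mem)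
    moreover have "s * (t * y) \<in> R" using s t by (simp add: mult_mem)
    ultimately have "\<forall>z\<in>insert y Y. s * t * z \<in> R" by (simp add: ac_simps)
    then show ?case using t_Max_mult_notin[OF M s(1) t(1)] by blast
  qed
  from this[of "{u, u * x, v, v * x}"] uv obtain s
    where s: "s \<in> R - M" "s * u \<in> R" "s * (u * x) \<in> R" "s * v \<in> R" "s * (v * x) \<in> R"
    by auto
  have "s * u + (s * v) * x = s * (u + v * x)" by (simp add: algebra_simps)
  then have "s * u + (s * v) * x \<notin> M" using s(1) uv(5) by simp
  then show ?thesis
    by (rule t_Max_dichotomy[OF M]) (use s in \<open>simp_all add: mult.assoc\<close>)
qed

end

section \<open>Extension of ideals along a ring homomorphism\<close>

locale field_hom =
  fixes \<iota> :: "'k::field \<Rightarrow> 'l::field"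
  assumes hom_add: "\<iota> (x + y) = \<iota> x + \<iota> y"
    and hom_mult: "\<iota> (x * y) = \<iota> x * \<iota> y"
    and hom_one: "\<iota> 1 = 1"
begin

lemma hom_zero: "\<iota> 0 = 0"
proof -
  have "\<iota> 0 + \<iota> 0 = \<iota> 0" unfolding hom_add[symmetric] by simp
  then show ?thesis by (rule add_cancel_right_right[THEN iffD1, OF sym])
qed

lemma hom_eq_zero_iff: "\<iota> x = 0 \<longleftrightarrow> x = 0"
proof
  assume "\<iota> x = 0"
  show "x = 0"
  proof (rule ccontr)
    assume "x \<noteq> 0"
    then have "\<iota> x * \<iota> (1 / x) = 1" using hom_mult[of x "1 / x"] hom_one by simp
    then show False using \<open>\<iota> x = 0\<close> by simp
  qed
qed (simp add: hom_zero)

lemma hom_ideal_mult: "\<iota> ` ideal_mult I J = ideal_mult (\<iota> ` I) (\<iota> ` J)"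
proof
  have "\<iota> z \<in> ideal_mult (\<iota> ` I) (\<iota> ` J)" if "z \<in> ideal_mult I J" for z
    using that
    by (induction rule: ideal_mult_induct)
       (simp_all add: hom_zero hom_add hom_mult ideal_mult_zero ideal_mult_add ideal_multI)
  then show "\<iota> ` ideal_mult I J \<subseteq> ideal_mult (\<iota> ` I) (\<iota> ` J)" by blast
  show "ideal_mult (\<iota> ` I) (\<iota> ` J) \<subseteq> \<iota> ` ideal_mult I J"
  proof
    fix z assume "z \<in> ideal_mult (\<iota> ` I) (\<iota> ` J)"
    then show "z \<in> \<iota> ` ideal_mult I J"
    proof (induction rule: ideal_mult_induct)
      case zero
      show ?case using imageI[OF ideal_mult_zero, of \<iota> I J] unfolding hom_zero .
    next
      case (add x y)
      then obtain a b where ab: "a \<in> ideal_mult I J" "b \<in> ideal_mult I J" "x = \<iota> a" "y = \<iota> b"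
        by blast
      have "\<iota> (a + b) \<in> \<iota> ` ideal_mult I J" by (intro imageI ideal_mult_add ab)
      then show ?case unfolding hom_add ab .
    next
      case (mult x y)
      then obtain a b where ab: "a \<in> I" "b \<in> J" "x = \<iota> a" "y = \<iota> b" by blast
      have "\<iota> (a * b) \<in> \<iota> ` ideal_mult I J" by (intro imageI ideal_multI ab)
      then show ?case unfolding hom_mult ab .
    qed
  qed
qed

end

lemma stable_idealI:
  assumes B: "is_submodule R B" and one: "1 \<in> ideal_mult B (colon (colon B B) B)"
  shows "stable_ideal B"
proof -
  have "e \<in> ideal_mult B (colon (colon B B) B)" if "e \<in> colon B B" for e
    using ideal_mult_colon_absorb[OF refl that one] by simp
  moreover have "ideal_mult B (colon (colon B B) B) \<subseteq> colon B B"
    by (rule ideal_mult_colon_subset[OF is_submodule_colon[OF B]])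
  ultimately show ?thesis unfolding stable_ideal_def Let_def by blast
qed

text \<open>Instantiated twice with the Nagata ring as \<open>T\<close>: for \<open>D\<close>
  through the embedding of \<open>K\<close> into \<open>K(X)\<close>, and for \<open>D[X]\<close>
  through the identity. The second assumption makes the w-closure invisible after extension.\<close>

locale ring_extension = field_hom \<iota> + R: frac_subring R + T: field_subring T
  for \<iota> :: "'k::field \<Rightarrow> 'l::field" and R :: "'k set" and T :: "'l set" +
  assumes hom_mem: "r \<in> R \<Longrightarrow> \<iota> r \<in> T"
    and GV_set_extends: "GV_set R S \<Longrightarrow> 1 \<in> ideal_mult (\<iota> ` S) T"
begin

definition ext :: "'k set \<Rightarrow> 'l set" where
  "ext I = ideal_mult (\<iota> ` I) T"

lemma is_submodule_ext: "is_submodule T (ext I)"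
  unfolding ext_def by (rule is_submodule_ideal_mult2[OF T.is_submodule_self])

lemma hom_mem_ext: "x \<in> I \<Longrightarrow> \<iota> x \<in> ext I"
  unfolding ext_def using ideal_multI[OF imageI T.one_mem, of x I \<iota>] by simp

lemma ext_minimal:
  assumes B: "is_submodule T B" and I: "\<And>x. x \<in> I \<Longrightarrow> \<iota> x \<in> B"
  shows "ext I \<subseteq> B"
  unfolding ext_def
proof (rule ideal_mult_subset[OF B])
  fix x y assume "x \<in> \<iota> ` I" and y: "y \<in> T"
  then have "x \<in> B" using I by blast
  then show "x * y \<in> B" using is_submoduleD(3)[OF B y] by (simp add: mult.commute[of x y])
qed

lemma ext_mono: "I \<subseteq> J \<Longrightarrow> ext I \<subseteq> ext J"
  by (rule ext_minimal[OF is_submodule_ext]) (use hom_mem_ext in blast)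

lemma ext_mult: "ext (ideal_mult I J) = ideal_mult (ext I) (ext J)"
proof -
  have "ideal_mult (ext I) (ext J) =
      ideal_mult (ideal_mult (\<iota> ` I) (\<iota> ` J)) (ideal_mult T T)"
    unfolding ext_def by (simp add: ideal_mult_ac)
  also have "ideal_mult T T = T" by (rule T.ideal_mult_self[OF T.is_submodule_self])
  finally show ?thesis unfolding ext_def hom_ideal_mult ..
qed

lemma frac_ideals_ext:
  assumes I: "I \<in> frac_ideals R"
  shows "ext I \<in> frac_ideals T"
proof -
  obtain x d where x: "x \<in> I" "x \<noteq> 0" and d: "d \<in> R" "d \<noteq> 0" "\<forall>x\<in>I. d * x \<in> R"
    using frac_idealsD(2,3)[OF I] by blast
  show ?thesis
  proof (rule frac_idealsI[OF is_submodule_ext])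
    show "\<iota> x \<in> ext I" by (rule hom_mem_ext[OF x(1)])
    show "\<iota> x \<noteq> 0" "\<iota> d \<noteq> 0" using x(2) d(2) by (simp_all add: hom_eq_zero_iff)
    show "\<iota> d \<in> T" by (rule hom_mem[OF d(1)])
    fix y assume "y \<in> ext I"
    moreover have "ext I \<subseteq> {y. y * \<iota> d \<in> T}"
    proof (rule ext_minimal[OF is_submodule_mult_vimage[OF T.is_submodule_self]])
      fix z assume "z \<in> I"
      then have "\<iota> (d * z) \<in> T" using d(3) by (intro hom_mem) blast
      then show "\<iota> z \<in> {y. y * \<iota> d \<in> T}" by (simp add: hom_mult mult.commute)
    qed
    ultimately show "\<iota> d * y \<in> T" by (auto simp: mult.commute)
  qed
qed

text \<open>If \<open>S x \<subseteq> I\<close> for a GV set \<open>S\<close>, then the unit ideal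
  generated by \<open>S\<close> in \<open>T\<close> multiplies the image of \<open>x\<close> into
  \<open>I T\<close>.\<close>

lemma hom_w_cl_ext:
  assumes I: "is_submodule R I" and x: "x \<in> w_cl R I"
  shows "\<iota> x \<in> ext I"
proof -
  obtain S where S: "GV_set R S" "\<forall>s\<in>S. s * x \<in> I" using x by (rule R.w_clE[OF I])
  have "ideal_mult (\<iota> ` S) T \<subseteq> {y. y * \<iota> x \<in> ext I}"
  proof (rule ideal_mult_subset[OF is_submodule_mult_vimage[OF is_submodule_ext]])
    fix y z assume "y \<in> \<iota> ` S" and z: "z \<in> T"
    then obtain s where s: "s \<in> S" "y = \<iota> s" by blast
    have "z * \<iota> (s * x) \<in> ext I"
      by (intro is_submoduleD(3)[OF is_submodule_ext] z hom_mem_ext) (use S(2) s in blast)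
    then show "y * z \<in> {y. y * \<iota> x \<in> ext I}" using s by (simp add: hom_mult ac_simps)
  qed
  then have "1 * \<iota> x \<in> ext I" using GV_set_extends[OF S(1)] by blast
  then show ?thesis by simp
qed

lemma ext_w_cl:
  assumes I: "is_submodule R I"
  shows "ext (w_cl R I) = ext I"
proof
  show "ext (w_cl R I) \<subseteq> ext I"
    by (rule ext_minimal[OF is_submodule_ext hom_w_cl_ext[OF I]])
  show "ext I \<subseteq> ext (w_cl R I)" by (rule ext_mono[OF R.w_cl_increasing[OF I]])
qed

lemma colon_extI:
  assumes "is_submodule T B" "\<And>w. w \<in> W \<Longrightarrow> z * \<iota> w \<in> B"
  shows "z \<in> colon B (ext W)"
proof -
  have "ext W \<subseteq> {y. y * z \<in> B}"
    by (rule ext_minimal[OF is_submodule_mult_vimage[OF assms(1)]])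
       (use assms(2) in \<open>simp add: mult.commute[of _ z]\<close>)
  then show ?thesis unfolding colon_def by (auto simp: mult.commute[of z])
qed

text \<open>Extension commutes with products and forgets w-closures, so
  \<open>I^w = (I^2 J)^w\<close> becomes \<open>I T = (I T)^2 (J T)\<close>.\<close>

lemma Clifford_regular_extension:
  assumes extended: "\<And>B. B \<in> frac_ideals T \<Longrightarrow> \<exists>I\<in>frac_ideals R. B = ext I"
    and R: "Clifford_w_regular R"
  shows "Clifford_regular T"
  unfolding Clifford_regular_def
proof
  fix B assume "B \<in> frac_ideals T"
  then obtain I where I: "I \<in> frac_ideals R" "B = ext I" using extended by blast
  note subI = frac_idealsD(1)[OF I(1)]
  obtain J where J: "J \<in> frac_ideals R" "w_cl R I = w_cl R (ideal_mult (ideal_mult I I) J)"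
    using R I(1) unfolding Clifford_w_regular_def w_regular_ideal_def by blast
  have "ext I = ext (ideal_mult (ideal_mult I I) J)"
    using ext_w_cl[OF subI] ext_w_cl[of "ideal_mult (ideal_mult I I) J"] J(2)
      is_submodule_ideal_mult[OF is_submodule_ideal_mult[OF subI]] by simp
  then show "vN_regular_ideal T B"
    unfolding vN_regular_ideal_def I(2) ext_mult using frac_ideals_ext[OF J(1)] by blast
qed

text \<open>Colons are compared by inclusion only: \<open>E\<close> maps into \<open>F\<close> and
  \<open>(E : W)\<close> into \<open>(F : B)\<close>. From \<open>1 \<in> (W (E : W))^w\<close> it
  follows that \<open>1 \<in> B (F : B)\<close>, and this decides stability.\<close>

lemma stable_extension:
  assumes extended: "\<And>B. B \<in> frac_ideals T \<Longrightarrow> \<exists>I\<in>frac_ideals R. B = ext I"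
    and R: "w_stable_dom R"
  shows "stable_dom T"
  unfolding stable_dom_def
proof
  fix B assume "B \<in> frac_ideals T"
  then obtain I where I: "I \<in> frac_ideals R" "B = ext I" using extended by blast
  note subI = frac_idealsD(1)[OF I(1)]
  define W where "W = w_cl R I"
  define E where "E = colon W W"
  define F where "F = colon B B"
  have subW: "is_submodule R W" unfolding W_def by (rule R.is_submodule_w_cl[OF subI])
  have BW: "B = ext W" unfolding W_def ext_w_cl[OF subI] by (rule I(2))
  have subB: "is_submodule T B" unfolding BW by (rule is_submodule_ext)
  have subF: "is_submodule T F" unfolding F_def by (rule is_submodule_colon[OF subB])
  have EF: "\<iota> e \<in> F" if e: "e \<in> E" for e
    unfolding F_def BW
  proof (rule colon_extI[OF is_submodule_ext])
    fix w assume "w \<in> W"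
    then have "e * w \<in> W" using e unfolding E_def by (intro colon_mult)
    then show "\<iota> e * \<iota> w \<in> ext W" using hom_mem_ext by (simp add: hom_mult[symmetric])
  qed
  have EWF: "\<iota> x \<in> colon F B" if x: "x \<in> colon E W" for x
    unfolding BW
  proof (rule colon_extI[OF subF])
    fix w assume "w \<in> W"
    then have "x * w \<in> E" using x by (intro colon_mult)
    then show "\<iota> x * \<iota> w \<in> F" using EF by (simp add: hom_mult[symmetric])
  qed
  let ?C = "ideal_mult W (colon E W)"
  have subC: "is_submodule R ?C" by (rule is_submodule_ideal_mult[OF subW])
  have "w_cl R ?C = E"
    using R I(1) unfolding w_stable_dom_def w_stable_ideal_def Let_def E_def W_def by blast
  moreover have "1 \<in> E" unfolding E_def colon_def by simp
  ultimately have "\<iota> 1 \<in> ext ?C" by (intro hom_w_cl_ext[OF subC]) simp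
  moreover have "ext (colon E W) \<subseteq> colon F B"
    by (rule ext_minimal[OF is_submodule_colon[OF subF] EWF])
  then have "ext ?C \<subseteq> ideal_mult B (colon F B)"
    unfolding ext_mult BW[symmetric] by (intro ideal_mult_mono) auto
  ultimately have one: "1 \<in> ideal_mult B (colon F B)" using hom_one by auto
  show "stable_ideal B"
    using one unfolding F_def by (rule stable_idealI[OF subB])
qed

section \<open>Contraction of ideals from the extension\<close>

context
  assumes extended: "\<And>B. B \<in> frac_ideals T \<Longrightarrow> \<exists>I\<in>frac_ideals R. B = ext I"
    and contracted: "\<And>I x. is_submodule R I \<Longrightarrow> \<iota> x \<in> ext I \<Longrightarrow> x \<in> w_cl R I"
begin

lemma w_cl_subset_if_ext_subset:
  assumes "is_submodule R J" "ext I \<subseteq> ext J"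
  shows "I \<subseteq> w_cl R J"
  using contracted[OF assms(1)] hom_mem_ext assms(2) by blast

text \<open>The multiplier \<open>B\<close> of \<open>I T\<close> is itself extended from some
  \<open>J\<close>. Then \<open>I\<close> and \<open>I^2 J\<close> have the same extension, hence
  the same w-closure.\<close>

lemma Clifford_w_regular_contraction:
  assumes T: "Clifford_regular T"
  shows "Clifford_w_regular R"
  unfolding Clifford_w_regular_def
proof
  fix I assume I: "I \<in> frac_ideals R"
  note subI = frac_idealsD(1)[OF I]
  obtain B where B: "B \<in> frac_ideals T" "ext I = ideal_mult (ideal_mult (ext I) (ext I)) B"
    using T frac_ideals_ext[OF I] unfolding Clifford_regular_def vN_regular_ideal_def by blast
  obtain J where J: "J \<in> frac_ideals R" "B = ext J" using extended[OF B(1)] by blast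
  let ?P = "ideal_mult (ideal_mult I I) J"
  have P: "is_submodule R ?P" by (intro is_submodule_ideal_mult subI)
  have eq: "ext ?P = ext I" using B(2) unfolding J(2) ext_mult ..
  have "w_cl R I = w_cl R ?P"
  proof
    show "w_cl R I \<subseteq> w_cl R ?P"
      by (intro R.w_cl_minimal P w_cl_subset_if_ext_subset) (simp_all add: eq)
    show "w_cl R ?P \<subseteq> w_cl R I"
      by (intro R.w_cl_minimal subI w_cl_subset_if_ext_subset) (simp_all add: eq)
  qed
  then show "w_regular_ideal R I" unfolding w_regular_ideal_def using J(1) by blast
qed

text \<open>Write \<open>(F : B) = J T\<close>. Contraction and the w-closedness of \<open>W\<close>
  give \<open>J \<subseteq> (E : W)\<close>, so \<open>1 \<in> B (F : B)\<close> contracts to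
  \<open>1 \<in> (W (E : W))^w\<close>.\<close>

lemma w_stable_contraction:
  assumes T: "stable_dom T"
  shows "w_stable_dom R"
  unfolding w_stable_dom_def
proof
  fix I assume I: "I \<in> frac_ideals R"
  note subI = frac_idealsD(1)[OF I]
  define W where "W = w_cl R I"
  define E where "E = colon W W"
  have W: "W \<in> frac_ideals R" unfolding W_def by (rule R.frac_ideals_w_cl[OF I])
  note subW = frac_idealsD(1)[OF W]
  have wW: "w_cl R W = W" unfolding W_def by (rule R.w_cl_idem[OF subI])
  define B where "B = ext W"
  define F where "F = colon B B"
  have B: "B \<in> frac_ideals T" unfolding B_def by (rule frac_ideals_ext[OF W])
  have "colon F B \<in> frac_ideals T" unfolding F_def by (intro T.frac_ideals_colon B)
  then obtain J where J: "J \<in> frac_ideals R" "colon F B = ext J" using extended by blast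
  have JE: "J \<subseteq> colon E W"
  proof
    fix x assume "x \<in> J"
    then have x: "\<iota> x \<in> colon F B" unfolding J(2) by (rule hom_mem_ext)
    have "x * w * v \<in> W" if "w \<in> W" "v \<in> W" for w v
    proof -
      have "\<iota> x * \<iota> w \<in> F" using x hom_mem_ext[OF \<open>w \<in> W\<close>, folded B_def] by (rule colon_mult)
      then have "\<iota> x * \<iota> w * \<iota> v \<in> B"
        using hom_mem_ext[OF \<open>v \<in> W\<close>, folded B_def] unfolding F_def by (rule colon_mult)
      then have "x * w * v \<in> w_cl R W"
        unfolding B_def by (intro contracted[OF subW]) (simp add: hom_mult)
      then show ?thesis unfolding wW .
    qed
    then show "x \<in> colon E W" unfolding E_def colon_def by blast
  qed
  have "ideal_mult B (colon F B) = F"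
    using T B unfolding stable_dom_def stable_ideal_def Let_def F_def by blast
  moreover have "1 \<in> F" unfolding F_def colon_def by simp
  ultimately have "1 \<in> ext (ideal_mult W J)"
    unfolding ext_mult B_def[symmetric] J(2)[symmetric] by simp
  also have "ext (ideal_mult W J) \<subseteq> ext (ideal_mult W (colon E W))"
    by (intro ext_mono ideal_mult_mono JE subset_refl)
  finally have "\<iota> 1 \<in> ext (ideal_mult W (colon E W))" unfolding hom_one .
  then have "1 \<in> w_cl R (ideal_mult W (colon E W))"
    by (rule contracted[OF is_submodule_ideal_mult[OF subW]])
  then show "w_stable_ideal R I"
    unfolding E_def W_def by (rule R.w_stable_idealI[OF I])
qed

end

end

section \<open>The Nagata ring\<close>

lemma frac_subring_range_to_fract:
  fixes d :: "'b::idom"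
  assumes d: "d \<noteq> 0" "\<not> d dvd 1"
    and quotient: "\<And>x :: 'b fract. \<exists>a\<in>range to_fract. \<exists>b\<in>range to_fract. b \<noteq> 0 \<and> x = a / b"
  shows "frac_subring (range (to_fract :: 'b \<Rightarrow> 'b fract))"
proof
  show "0 \<in> range (to_fract :: 'b \<Rightarrow> 'b fract)" by (rule range_eqI[of _ _ 0]) simp
  show "1 \<in> range (to_fract :: 'b \<Rightarrow> 'b fract)" by (rule range_eqI[of _ _ 1]) simp
  show "\<exists>d\<in>range (to_fract :: 'b \<Rightarrow> 'b fract). d \<noteq> 0 \<and> inverse d \<notin> range to_fract"
  proof (intro bexI conjI notI)
    show "to_fract d \<in> range to_fract" by (rule rangeI)
    show False if "to_fract d = 0" using that d(1) by simp
    assume "inverse (to_fract d) \<in> range to_fract"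
    then obtain e where "inverse (to_fract d) = to_fract e" by blast
    then have "to_fract d * to_fract e = 1"
      using d(1) by (metis right_inverse to_fract_eq_0_iff)
    then have "to_fract (d * e) = to_fract 1" by simp
    then have "d * e = 1" unfolding to_fract_eq_iff .
    then show False using d(2) by (metis dvd_triv_left)
  qed
next
  fix x y :: "'b fract" assume "x \<in> range to_fract" "y \<in> range to_fract"
  then obtain a b where ab: "x = to_fract a" "y = to_fract b" by blast
  show "x + y \<in> range to_fract" unfolding ab to_fract_add[symmetric] by (rule rangeI)
  show "x * y \<in> range to_fract" unfolding ab to_fract_mult[symmetric] by (rule rangeI)
next
  fix x :: "'b fract" assume "x \<in> range to_fract"
  then obtain a where a: "x = to_fract a" by blast
  show "- x \<in> range to_fract" unfolding a to_fract_uminus[symmetric] by (rule rangeI)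
qed (rule quotient)

lemma fract_quotientE:
  fixes x :: "'a::idom fract"
  obtains a b where "b \<noteq> 0" "x = to_fract a / to_fract b"
proof -
  obtain a b where "a \<in> base_dom" "b \<in> base_dom" "b \<noteq> 0" "x = a / b"
    using base_dom_quotient by blast
  then show ?thesis using that unfolding base_dom_def by auto
qed

lemma finite_range_coeff: "finite (range (coeff p))"
proof -
  have "range (coeff p) \<subseteq> insert 0 (coeff p ` {..degree p})"
    by (auto simp: image_iff) (metis atMost_iff coeff_eq_0 linorder_not_le)
  then show ?thesis by (rule finite_subset) simp
qed

lemma frac_subring_poly_dom: "frac_subring (poly_dom :: 'a::idom poly fract set)"
  unfolding poly_dom_def
proof (rule frac_subring_range_to_fract)
  show "[:0, 1:] \<noteq> (0 :: 'a poly)" by simp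
  show "\<not> [:0, 1:] dvd (1 :: 'a poly)"
  proof
    assume "[:0, 1:] dvd (1 :: 'a poly)"
    then obtain q where "(1 :: 'a poly) = [:0, 1:] * q" by (rule dvdE)
    then have "coeff (1 :: 'a poly) 0 = coeff ([:0, 1:] * q) 0" by simp
    then show False by simp
  qed
  show "\<exists>a\<in>range to_fract. \<exists>b\<in>range to_fract. b \<noteq> 0 \<and> x = a / b" for x :: "'a poly fract"
    using poly_dom_quotient unfolding poly_dom_def .
qed

section \<open>The embedding of \<open>K\<close> into \<open>K(X)\<close>\<close>

abbreviation cst :: "'a::idom \<Rightarrow> 'a poly fract" where
  "cst a \<equiv> to_fract [:a:]"

lemma cst_mult: "cst (a * b) = cst a * cst b"
  unfolding to_fract_mult[symmetric] by simp

lemma cst_add: "cst (a + b) = cst a + cst b"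
  unfolding to_fract_add[symmetric] by simp

text \<open>Fractions over a general domain have no normal form, so an arbitrary representation is
  allowed and the value is selected by choice; \<open>embed_quotient\<close> shows that it is
  unique.\<close>

definition embed :: "'a::idom fract \<Rightarrow> 'a poly fract" where
  "embed x = (SOME z. \<exists>a b. b \<noteq> 0 \<and> x = to_fract a / to_fract b \<and> z = cst a / cst b)"

lemma embed_quotient:
  assumes "b \<noteq> 0"
  shows "embed (to_fract a / to_fract b) = cst a / cst b"
  unfolding embed_def
proof (rule some_equality)
  show "\<exists>a' b'. b' \<noteq> 0 \<and> to_fract a / to_fract b = to_fract a' / to_fract b' \<and>
      cst a / cst b = cst a' / cst b'"
    using assms by blast
next
  fix z assume "\<exists>a' b'. b' \<noteq> 0 \<and> to_fract a / to_fract b = to_fract a' / to_fract b' \<and>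
      z = cst a' / cst b'"
  then obtain a' b' where b': "b' \<noteq> 0" and eq: "to_fract a / to_fract b = to_fract a' / to_fract b'"
    and z: "z = cst a' / cst b'" by blast
  have "to_fract (a * b') = to_fract (a' * b)"
    using eq assms b' by (simp add: frac_eq_eq)
  then have "a * b' = a' * b" unfolding to_fract_eq_iff .
  then have "cst a * cst b' = cst a' * cst b" unfolding cst_mult[symmetric] by simp
  then show "z = cst a / cst b" unfolding z using assms b' by (simp add: frac_eq_eq)
qed

lemma embed_to_fract: "embed (to_fract a) = cst a"
  using embed_quotient[of 1 a] by (simp add: one_pCons[symmetric])

interpretation embed: field_hom embed
proof
  fix x y :: "'a fract"
  obtain a b where ab: "b \<noteq> 0" "x = to_fract a / to_fract b" by (rule fract_quotientE)
  obtain c d where cd: "d \<noteq> 0" "y = to_fract c / to_fract d" by (rule fract_quotientE)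
  have bd: "b * d \<noteq> 0" using ab cd by simp
  have "x + y = to_fract (a * d + c * b) / to_fract (b * d)"
    using ab cd by (simp add: add_frac_eq)
  then have "embed (x + y) = cst (a * d + c * b) / cst (b * d)"
    by (simp only: embed_quotient[OF bd])
  also have "\<dots> = cst a / cst b + cst c / cst d"
    unfolding cst_add cst_mult using ab cd by (simp add: add_frac_eq)
  finally show "embed (x + y) = embed x + embed y"
    unfolding ab(2) cd(2) embed_quotient[OF ab(1)] embed_quotient[OF cd(1)] .
  have "x * y = to_fract (a * c) / to_fract (b * d)" unfolding ab(2) cd(2) by simp
  then have "embed (x * y) = cst (a * c) / cst (b * d)"
    by (simp only: embed_quotient[OF bd])
  also have "\<dots> = (cst a / cst b) * (cst c / cst d)" unfolding cst_mult by simp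
  finally show "embed (x * y) = embed x * embed y"
    unfolding ab(2) cd(2) embed_quotient[OF ab(1)] embed_quotient[OF cd(1)] .
next
  show "embed 1 = (1 :: 'a poly fract)"
    using embed_to_fract[of 1] by (simp add: one_pCons[symmetric])
qed

text \<open>Multiplied by a power of \<open>X\<close> above the degree of \<open>h\<close>, the
  polynomial \<open>q\<close> can be added without disturbing the coefficients of \<open>h\<close>
  up to its degree. The closure conditions on \<open>Q\<close> are just those that this
  uses.\<close>

lemma ex_common_coeff_poly:
  fixes Q :: "'a::comm_ring_1 poly set"
  assumes Q: "0 \<in> Q" "\<And>p q. p \<in> Q \<Longrightarrow> q \<in> Q \<Longrightarrow> p + q \<in> Q" "\<And>n q. q \<in> Q \<Longrightarrow> monom 1 n * q \<in> Q"
    and "finite S" "\<And>s. s \<in> S \<Longrightarrow> \<exists>q\<in>Q. \<exists>k. s = coeff q k"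
  shows "\<exists>h\<in>Q. S \<subseteq> range (coeff h)"
  using assms(4,5)
proof (induction S)
  case empty
  then show ?case using Q(1) by blast
next
  case (insert s S)
  then obtain h where h: "h \<in> Q" "S \<subseteq> range (coeff h)" by blast
  obtain q k where q: "q \<in> Q" "s = coeff q k" using insert.prems by blast
  let ?n = "Suc (degree h)"
  let ?h = "h + monom 1 ?n * q"
  have low: "coeff ?h i = coeff h i" if "i \<le> degree h" for i
    using that by (simp add: coeff_monom_mult)
  have high: "coeff ?h (?n + i) = coeff q i" for i
    by (simp add: coeff_monom_mult coeff_eq_0)
  \<comment> \<open>The zero coefficients of \<open>h\<close> beyond its degree get overwritten;
    zero is recovered afterwards as a coefficient of \<open>?h\<close> beyond its own
    degree.\<close>
  have "t \<in> insert 0 (range (coeff ?h))" if t: "t \<in> S" for t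
  proof -
    obtain i where i: "t = coeff h i" using h(2) t by blast
    show ?thesis
    proof (cases "i \<le> degree h")
      case True
      then show ?thesis using low[OF True] i by (metis insertI2 rangeI)
    next
      case False
      then show ?thesis using i by (simp add: coeff_eq_0)
    qed
  qed
  moreover have "0 \<in> range (coeff ?h)"
    using coeff_eq_0[of ?h "Suc (degree ?h)"] by (metis lessI rangeI)
  moreover have "s \<in> range (coeff ?h)" using high[of k] q(2) by (metis rangeI)
  ultimately have "insert s S \<subseteq> range (coeff ?h)" by auto
  moreover have "?h \<in> Q" by (intro Q h q)
  ultimately show ?case by blast
qed

locale nonfield_domain =
  fixes d :: "'a::idom"
  assumes nonzero: "d \<noteq> 0" and nonunit: "\<not> d dvd 1"
begin

sublocale D: frac_subring "base_dom :: 'a fract set"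
  unfolding base_dom_def
proof (rule frac_subring_range_to_fract[OF nonzero nonunit])
  show "\<exists>a\<in>range to_fract. \<exists>b\<in>range to_fract. b \<noteq> 0 \<and> x = a / b" for x :: "'a fract"
    using base_dom_quotient unfolding base_dom_def .
qed

sublocale PX: frac_subring "poly_dom :: 'a poly fract set"
  by (rule frac_subring_poly_dom)

lemma to_fract_base: "to_fract (a::'a) \<in> base_dom"
  unfolding base_dom_def by (rule rangeI)

lemma to_fract_poly: "to_fract (p::'a poly) \<in> poly_dom"
  unfolding poly_dom_def by (rule rangeI)

lemma poly_domE:
  assumes "z \<in> poly_dom"
  obtains p :: "'a poly" where "z = to_fract p"
  using assms unfolding poly_dom_def by blast

lemma base_domE:
  assumes "z \<in> base_dom"
  obtains a :: 'a where "z = to_fract a"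
  using assms unfolding base_dom_def by blast

section \<open>The set \<open>N(v)\<close> and the ring obtained by inverting it\<close>

definition coeff_set :: "'a poly \<Rightarrow> 'a fract set" where
  "coeff_set h = to_fract ` range (coeff h)"

lemma coeff_set: "finite (coeff_set h)" "coeff_set h \<subseteq> base_dom"
  unfolding coeff_set_def base_dom_def by (auto simp: finite_range_coeff)

text \<open>\<open>c(h)^v = D\<close> is equivalent to \<open>(D : c(h)) = D\<close>: one direction
  multiplies the colon by \<open>1 \<in> c(h)^v\<close>, the other uses
  \<open>(D : D) = D\<close>.\<close>

lemma N_v_iff_GV: "(h :: 'a poly) \<in> N_v \<longleftrightarrow> GV_set base_dom (coeff_set h)"
proof -
  let ?R = "base_dom :: 'a fract set"
  have "content_ideal h = is_submodule ?R hull coeff_set h"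
    unfolding content_ideal_def coeff_set_def by (simp add: image_image)
  then have v: "v_cl ?R (content_ideal h) = colon ?R (colon ?R (coeff_set h))"
    by (simp add: v_cl_def D.colon_hull)
  show ?thesis
  proof
    assume "h \<in> N_v"
    then have "1 \<in> colon ?R (colon ?R (coeff_set h))"
      using D.one_mem unfolding N_v_def mem_Collect_eq v by simp
    then have "y \<in> ?R" if "y \<in> colon ?R (coeff_set h)" for y
      using colon_mult[OF _ that, of 1] by simp
    then show "GV_set ?R (coeff_set h)"
      unfolding GV_set_def using coeff_set unfolding colon_def by blast
  next
    assume GV: "GV_set ?R (coeff_set h)"
    have "colon ?R (coeff_set h) = ?R"
    proof
      show "colon ?R (coeff_set h) \<subseteq> ?R"
        using GV unfolding GV_set_def colon_def by blast
      show "?R \<subseteq> colon ?R (coeff_set h)"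
        unfolding colon_def using coeff_set(2)[of h] D.mult_mem by blast
    qed
    moreover have "colon ?R ?R = ?R"
    proof
      show "colon ?R ?R \<subseteq> ?R" using colon_mult[OF _ D.one_mem] by fastforce
      show "?R \<subseteq> colon ?R ?R" unfolding colon_def using D.mult_mem by blast
    qed
    \<comment> \<open>For \<open>h = 0\<close> the GV condition on \<open>{0}\<close> would put all
      of \<open>K\<close> into \<open>D\<close>.\<close>
    moreover have "h \<noteq> 0"
    proof
      assume "h = 0"
      then have "coeff_set h = {0}" unfolding coeff_set_def by auto
      then have "\<forall>y. y \<in> ?R" using GV D.zero_mem unfolding GV_set_def by simp
      then show False using D.nonunit by blast
    qed
    ultimately show "h \<in> N_v" unfolding N_v_def mem_Collect_eq v by simp
  qed
qed

text \<open>\<open>N(v)\<close> is thus the complement of the union of the ideals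
  \<open>M[X]\<close>, which makes its multiplicativity a question of primeness.\<close>

lemma N_v_iff_t_Max:
  "(h :: 'a poly) \<in> N_v \<longleftrightarrow> (\<forall>M\<in>t_Max base_dom. \<exists>i. to_fract (coeff h i) \<notin> M)"
  unfolding N_v_iff_GV D.GV_set_iff[OF coeff_set] unfolding coeff_set_def by blast

text \<open>The argument of Gauss that \<open>M[X]\<close> is prime: with \<open>i\<close> and
  \<open>j\<close> the first indices of coefficients outside \<open>M\<close>, the coefficient of
  the product at \<open>i + j\<close> is congruent modulo \<open>M\<close> to the product of those
  two.\<close>

lemma coeff_mult_notin_t_Max:
  fixes f g :: "'a poly"
  assumes M: "M \<in> t_Max base_dom"
    and f: "\<exists>i. to_fract (coeff f i) \<notin> M" and g: "\<exists>i. to_fract (coeff g i) \<notin> M"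
  shows "\<exists>i. to_fract (coeff (f * g) i) \<notin> M"
proof -
  note sub = D.t_MaxD(1)[OF M]
  define i where "i = (LEAST i. to_fract (coeff f i) \<notin> M)"
  define j where "j = (LEAST i. to_fract (coeff g i) \<notin> M)"
  have i: "to_fract (coeff f i) \<notin> M" unfolding i_def using f by (rule LeastI_ex)
  have j: "to_fract (coeff g j) \<notin> M" unfolding j_def using g by (rule LeastI_ex)
  have fl: "to_fract (coeff f k) \<in> M" if "k < i" for k
    using not_less_Least[of k "\<lambda>i. to_fract (coeff f i) \<notin> M"] that unfolding i_def by blast
  have gl: "to_fract (coeff g k) \<in> M" if "k < j" for k
    using not_less_Least[of k "\<lambda>i. to_fract (coeff g i) \<notin> M"] that unfolding j_def by blast
  let ?t = "\<lambda>k. to_fract (coeff f k) * to_fract (coeff g (i + j - k))"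
  have "to_fract (coeff (f * g) (i + j)) = (\<Sum>k\<le>i + j. ?t k)"
    unfolding coeff_mult by simp
  also have "\<dots> = ?t i + (\<Sum>k\<in>{..i + j} - {i}. ?t k)"
    by (rule sum.remove) auto
  finally have eq: "to_fract (coeff (f * g) (i + j)) =
      to_fract (coeff f i) * to_fract (coeff g j) + (\<Sum>k\<in>{..i + j} - {i}. ?t k)" by simp
  have rest: "(\<Sum>k\<in>{..i + j} - {i}. ?t k) \<in> M"
  proof (rule is_submodule_sum[OF sub])
    fix k assume k: "k \<in> {..i + j} - {i}"
    show "?t k \<in> M"
    proof (cases "k < i")
      case True
      have "to_fract (coeff g (i + j - k)) * to_fract (coeff f k) \<in> M"
        by (rule is_submoduleD(3)[OF sub to_fract_base fl[OF True]])
      then show ?thesis by (simp only: mult.commute)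
    next
      case False
      then have "i + j - k < j" using k by auto
      then show ?thesis by (intro is_submoduleD(3)[OF sub to_fract_base gl])
    qed
  qed
  have "to_fract (coeff (f * g) (i + j)) \<notin> M"
  proof
    assume "to_fract (coeff (f * g) (i + j)) \<in> M"
    then have "to_fract (coeff (f * g) (i + j)) + - (\<Sum>k\<in>{..i + j} - {i}. ?t k) \<in> M"
      using rest by (intro is_submoduleD(2)[OF sub] D.submodule_uminus[OF sub])
    then have "to_fract (coeff f i) * to_fract (coeff g j) \<in> M" unfolding eq by simp
    then show False using D.t_Max_prime[OF M to_fract_base i to_fract_base] j by blast
  qed
  then show ?thesis by blast
qed

lemma N_v_mult: "(f :: 'a poly) \<in> N_v \<Longrightarrow> g \<in> N_v \<Longrightarrow> f * g \<in> N_v"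
  unfolding N_v_iff_t_Max by (intro ballI coeff_mult_notin_t_Max) simp_all

lemma N_v_one: "(1 :: 'a poly) \<in> N_v"
  unfolding N_v_iff_t_Max
proof
  fix M :: "'a fract set" assume "M \<in> t_Max base_dom"
  then have "to_fract (coeff 1 0) \<notin> M" using D.t_MaxD(3) by simp
  then show "\<exists>i. to_fract (coeff 1 i) \<notin> M" by (rule exI)
qed

lemma N_v_nonzero: "(h :: 'a poly) \<in> N_v \<Longrightarrow> to_fract h \<noteq> 0"
  unfolding N_v_def by simp

lemma nagata_iff: "(z :: 'a poly fract) \<in> nagata_v \<longleftrightarrow> (\<exists>h\<in>N_v. to_fract h * z \<in> poly_dom)"
proof
  assume "z \<in> nagata_v"
  then obtain a h where "a \<in> poly_dom" "h \<in> N_v" "z = a / to_fract h"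
    unfolding nagata_v_def localization_def by blast
  then show "\<exists>h\<in>N_v. to_fract h * z \<in> poly_dom"
    using N_v_nonzero[of h] by (intro bexI[of _ h]) simp_all
next
  assume "\<exists>h\<in>N_v. to_fract h * z \<in> poly_dom"
  then obtain h where h: "h \<in> N_v" "to_fract h * z \<in> poly_dom" by blast
  then have "z = (to_fract h * z) / to_fract h" using N_v_nonzero[of h] by simp
  then show "z \<in> nagata_v" unfolding nagata_v_def localization_def using h by blast
qed

lemma poly_nagata: "(poly_dom :: 'a poly fract set) \<subseteq> nagata_v"
proof
  fix z :: "'a poly fract" assume "z \<in> poly_dom"
  then show "z \<in> nagata_v" unfolding nagata_iff using N_v_one by (intro bexI[of _ 1]) simp_all
qed

lemma to_fract_nagata: "to_fract (p :: 'a poly) \<in> nagata_v"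
  by (rule subsetD[OF poly_nagata to_fract_poly])

lemma N_v_common:
  assumes "finite Y" "Y \<subseteq> (nagata_v :: 'a poly fract set)"
  shows "\<exists>h\<in>N_v. \<forall>y\<in>Y. to_fract h * y \<in> poly_dom"
  using assms
proof (induction Y)
  case empty
  then show ?case using N_v_one by blast
next
  case (insert y Y)
  then obtain g where g: "g \<in> N_v" "\<forall>y\<in>Y. to_fract g * y \<in> poly_dom" by blast
  obtain h where h: "h \<in> N_v" "to_fract h * y \<in> poly_dom"
    using insert.prems unfolding insert_subset nagata_iff by blast
  have "to_fract (g * h) * z \<in> poly_dom" if z: "z \<in> insert y Y" for z
  proof (cases "z = y")
    case True
    have "to_fract g * (to_fract h * y) \<in> poly_dom" by (rule PX.mult_mem[OF to_fract_poly h(2)])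
    then show ?thesis using True by (simp add: mult.assoc)
  next
    case False
    have "to_fract h * (to_fract g * z) \<in> poly_dom"
      by (rule PX.mult_mem[OF to_fract_poly]) (use g z False in blast)
    then show ?thesis by (simp add: ac_simps)
  qed
  then show ?case using N_v_mult[OF g(1) h(1)] by blast
qed

sublocale T: field_subring "nagata_v :: 'a poly fract set"
proof
  show "0 \<in> (nagata_v :: 'a poly fract set)" "1 \<in> (nagata_v :: 'a poly fract set)"
    using poly_nagata PX.zero_mem PX.one_mem by auto
next
  fix x y :: "'a poly fract" assume "x \<in> nagata_v" "y \<in> nagata_v"
  then obtain h where h: "h \<in> N_v" "to_fract h * x \<in> poly_dom" "to_fract h * y \<in> poly_dom"
    using N_v_common[of "{x, y}"] by auto
  have "to_fract h * (x + y) \<in> poly_dom"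
    unfolding distrib_left by (rule PX.add_mem[OF h(2,3)])
  then show "x + y \<in> nagata_v" unfolding nagata_iff using h(1) by blast
  have "(to_fract h * x) * (to_fract h * y) \<in> poly_dom" by (rule PX.mult_mem[OF h(2,3)])
  then have "to_fract (h * h) * (x * y) \<in> poly_dom" by (simp add: ac_simps)
  then show "x * y \<in> nagata_v" unfolding nagata_iff using N_v_mult[OF h(1) h(1)] by blast
next
  fix x :: "'a poly fract" assume "x \<in> nagata_v"
  then obtain h where h: "h \<in> N_v" "to_fract h * x \<in> poly_dom" unfolding nagata_iff by blast
  then have "to_fract h * - x \<in> poly_dom" using PX.uminus_mem[OF h(2)] by simp
  then show "- x \<in> nagata_v" unfolding nagata_iff using h(1) by blast
qed

lemma inverse_N_v: "(h :: 'a poly) \<in> N_v \<Longrightarrow> 1 / to_fract h \<in> nagata_v"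
  unfolding nagata_iff using PX.one_mem N_v_nonzero[of h] by (intro bexI[of _ h]) auto

text \<open>Shifting by powers of \<open>X\<close> combines finitely many polynomials into one having all their
  coefficients.\<close>

lemma one_mem_if_GV_coeffs:
  fixes B :: "'a poly fract set"
  assumes B: "is_submodule nagata_v B" and S: "GV_set base_dom S"
    and coeffs: "\<And>s. s \<in> S \<Longrightarrow> \<exists>h k. to_fract h \<in> B \<and> s = to_fract (coeff h k)"
  shows "1 \<in> B"
proof -
  let ?Q = "{h. to_fract h \<in> B}"
  let ?S = "to_fract -` S"
  have "finite ?S"
    by (rule finite_vimageI[OF GV_setD(1)[OF S]]) (simp add: inj_def)
  moreover have "\<exists>q\<in>?Q. \<exists>k. s = coeff q k" if "s \<in> ?S" for s
    using coeffs[of "to_fract s"] that by auto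
  ultimately have "\<exists>h\<in>?Q. ?S \<subseteq> range (coeff h)"
    by (intro ex_common_coeff_poly)
       (simp_all add: is_submoduleD[OF B] to_fract_nagata)
  then obtain h where h: "to_fract h \<in> B" "?S \<subseteq> range (coeff h)" by blast
  have "S \<subseteq> coeff_set h"
  proof
    fix s assume s: "s \<in> S"
    then obtain a where "s = to_fract a" using coeffs by blast
    then show "s \<in> coeff_set h" unfolding coeff_set_def using h(2) s by auto
  qed
  then have "h \<in> N_v"
    unfolding N_v_iff_GV by (rule GV_set_mono[OF S _ coeff_set])
  then have "1 / to_fract h * to_fract h \<in> B"
    by (intro is_submoduleD(3)[OF B] inverse_N_v h(1))
  then show ?thesis using N_v_nonzero[OF \<open>h \<in> N_v\<close>] by simp
qed

section \<open>GV sets of \<open>D\<close> and of \<open>D[X]\<close> generate the unit ideal of the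
  Nagata ring\<close>

lemma GV_set_base_extends:
  assumes S: "GV_set (base_dom :: 'a fract set) S"
  shows "1 \<in> ideal_mult (embed ` S) nagata_v"
proof (rule one_mem_if_GV_coeffs[OF is_submodule_ideal_mult2[OF T.is_submodule_self] S])
  fix s assume s: "s \<in> S"
  then obtain a where a: "s = to_fract a" using GV_setD(2)[OF S] base_domE by blast
  have "embed s * 1 \<in> ideal_mult (embed ` S) nagata_v"
    by (rule ideal_multI[OF imageI[OF s] T.one_mem])
  then have "cst a \<in> ideal_mult (embed ` S) nagata_v" unfolding a embed_to_fract by simp
  then show "\<exists>h k. to_fract h \<in> ideal_mult (embed ` S) nagata_v \<and> s = to_fract (coeff h k)"
    using a by (intro exI[of _ "[:a:]"] exI[of _ 0]) simp
qed

text \<open>The coefficients of a GV set \<open>S\<close> of \<open>D[X]\<close> form a GV set of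
  \<open>D\<close>: a constant \<open>y \<in> K\<close> multiplying them into \<open>D\<close>
  multiplies \<open>S\<close> into \<open>D[X]\<close>, so
  \<open>y \<in> D[X] \<inter> K = D\<close>.\<close>

lemma GV_set_poly_extends:
  assumes S: "GV_set (poly_dom :: 'a poly fract set) S"
  shows "1 \<in> ideal_mult S nagata_v"
proof -
  define F where "F = to_fract -` S"
  have SF: "S = to_fract ` F"
    unfolding F_def using GV_setD(2)[OF S] unfolding poly_dom_def by blast
  have F: "finite F"
    unfolding F_def by (rule finite_vimageI[OF GV_setD(1)[OF S]]) (simp add: inj_def)
  have "GV_set base_dom (\<Union>f\<in>F. coeff_set f)"
    unfolding GV_set_def
  proof (intro conjI allI impI)
    show "finite (\<Union>f\<in>F. coeff_set f)" using F coeff_set(1) by blast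
    show "(\<Union>f\<in>F. coeff_set f) \<subseteq> base_dom" using coeff_set(2) by blast
    fix y assume y: "\<forall>s\<in>(\<Union>f\<in>F. coeff_set f). y * s \<in> base_dom"
    obtain a b where ab: "b \<noteq> 0" "y = to_fract a / to_fract b" by (rule fract_quotientE)
    have "cst a / cst b \<in> poly_dom"
    proof (rule GV_setD(3)[OF S])
      fix s assume "s \<in> S"
      then obtain f where f: "f \<in> F" "s = to_fract f" unfolding SF by blast
      \<comment> \<open>That \<open>(a / b) f\<close> is a polynomial over \<open>D\<close> is
        tested by divisibility of coefficients, which avoids polynomials over
        \<open>K\<close>.\<close>
      have "b dvd coeff (smult a f) i" for i
      proof -
        have "y * to_fract (coeff f i) \<in> base_dom"
          using y f(1) unfolding coeff_set_def by blast
        then obtain c where "y * to_fract (coeff f i) = to_fract c" by (rule base_domE)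
        then have "to_fract (a * coeff f i) = to_fract (b * c)"
          using ab by (simp add: field_simps)
        then show ?thesis unfolding to_fract_eq_iff coeff_smult by (rule dvdI)
      qed
      then have "[:b:] dvd smult a f" unfolding const_poly_dvd_iff by blast
      then obtain g where "smult a f = [:b:] * g" by (rule dvdE)
      then have "[:a:] * f = [:b:] * g" by simp
      then have "cst a * to_fract f = cst b * to_fract g"
        unfolding to_fract_mult[symmetric] by (rule arg_cong)
      then have "cst a / cst b * s = to_fract g" using ab(1) f(2) by (simp add: field_simps)
      then show "cst a / cst b * s \<in> poly_dom" using to_fract_poly by simp
    qed
    then obtain p where "cst a / cst b = to_fract p" by (rule poly_domE)
    then have "cst a = cst b * to_fract p" using ab(1) by (simp add: field_simps)
    then have "[:a:] = [:b:] * p" unfolding to_fract_mult[symmetric] to_fract_eq_iff .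
    \<comment> \<open>Constant terms are compared to obtain
      \<open>D[X] \<inter> K = D\<close>.\<close>
    then have "coeff [:a:] 0 = coeff ([:b:] * p) 0" by simp
    then have "a = b * coeff p 0" by simp
    then have "y = to_fract (coeff p 0)" using ab by simp
    then show "y \<in> base_dom" using to_fract_base by simp
  qed
  then show ?thesis
  proof (rule one_mem_if_GV_coeffs[OF is_submodule_ideal_mult2[OF T.is_submodule_self]])
    fix s assume "s \<in> (\<Union>f\<in>F. coeff_set f)"
    then obtain f k where f: "f \<in> F" "s = to_fract (coeff f k)" unfolding coeff_set_def by blast
    have "to_fract f * 1 \<in> ideal_mult S nagata_v"
      by (rule ideal_multI[OF _ T.one_mem]) (use f(1) SF in blast)
    then show "\<exists>h k. to_fract h \<in> ideal_mult S nagata_v \<and> s = to_fract (coeff h k)"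
      using f(2) by (intro exI[of _ f] exI[of _ k]) simp
  qed
qed

sublocale PXT: ring_extension "\<lambda>x. x" "poly_dom :: 'a poly fract set" nagata_v
  by unfold_locales (use poly_nagata GV_set_poly_extends in \<open>auto simp: image_ident\<close>)

lemma embed_base_nagata:
  assumes "r \<in> (base_dom :: 'a fract set)"
  shows "embed r \<in> nagata_v"
proof -
  obtain a where a: "r = to_fract a" using assms by (rule base_domE)
  show ?thesis unfolding a embed_to_fract by (rule to_fract_nagata)
qed

sublocale DT: ring_extension embed "base_dom :: 'a fract set" nagata_v
  by unfold_locales (use embed_base_nagata GV_set_base_extends in auto)

lemma PXT_ext: "PXT.ext I = ideal_mult I nagata_v"
  unfolding PXT.ext_def by simp

text \<open>\<open>T\<close> is a localization of \<open>D[X]\<close>, so \<open>B\<close> is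
  generated by each part of it that contains an \<open>N(v)\<close>-multiple of every element.
  Cutting \<open>B\<close> down to the elements with denominator \<open>c\<close> makes this part a
  fractional ideal of \<open>D[X]\<close>.\<close>

lemma PXT_extended:
  assumes B: "B \<in> frac_ideals (nagata_v :: 'a poly fract set)"
  shows "\<exists>I\<in>frac_ideals poly_dom. B = PXT.ext I"
proof -
  obtain x e where x: "x \<in> B" "x \<noteq> 0" and e: "e \<in> nagata_v" "e \<noteq> 0" "\<forall>x\<in>B. e * x \<in> nagata_v"
    using frac_idealsD(2,3)[OF B] by blast
  note sub = frac_idealsD(1)[OF B]
  obtain h where h: "h \<in> N_v" "to_fract h * e \<in> poly_dom" using e(1) unfolding nagata_iff by blast
  define c where "c = to_fract h * e"
  have c: "c \<in> poly_dom" "c \<noteq> 0" using h e(2) N_v_nonzero[of h] unfolding c_def by auto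
  have cB: "c * b \<in> nagata_v" if b: "b \<in> B" for b
  proof -
    have "to_fract h * (e * b) \<in> nagata_v"
      by (rule T.mult_mem[OF to_fract_nagata]) (use e(3) b in blast)
    then show ?thesis unfolding c_def by (simp add: mult.assoc)
  qed
  let ?I = "{b. b * c \<in> poly_dom} \<inter> B"
  have clear: "\<exists>h\<in>N_v. to_fract h * b \<in> ?I" if b: "b \<in> B" for b
  proof -
    obtain h where h: "h \<in> N_v" "to_fract h * (c * b) \<in> poly_dom"
      using cB[OF b] unfolding nagata_iff by blast
    then have "to_fract h * b \<in> ?I"
      using is_submoduleD(3)[OF sub to_fract_nagata b] by (simp add: ac_simps)
    then show ?thesis using h(1) by blast
  qed
  have subI: "is_submodule poly_dom ?I"
  proof -
    have "is_submodule poly_dom {b. b * c \<in> poly_dom}"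
      by (rule is_submodule_mult_vimage[OF PX.is_submodule_self])
    moreover have "is_submodule poly_dom B"
      using sub poly_nagata unfolding is_submodule_def by blast
    ultimately show ?thesis unfolding is_submodule_def by simp
  qed
  obtain g where g: "g \<in> N_v" "to_fract g * x \<in> ?I" using clear[OF x(1)] by blast
  have "?I \<in> frac_ideals poly_dom"
  proof (rule frac_idealsI[OF subI g(2) _ c])
    show "to_fract g * x \<noteq> 0" using x(2) N_v_nonzero[OF g(1)] by simp
    show "c * b \<in> poly_dom" if "b \<in> ?I" for b
      using that by (simp add: mult.commute[of c b])
  qed
  moreover have "B = PXT.ext ?I"
  proof
    show "PXT.ext ?I \<subseteq> B" by (rule PXT.ext_minimal[OF sub]) blast
    show "B \<subseteq> PXT.ext ?I"
    proof
      fix b assume "b \<in> B"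
      then obtain h where h: "h \<in> N_v" "to_fract h * b \<in> ?I" using clear by blast
      have "1 / to_fract h * (to_fract h * b) \<in> PXT.ext ?I"
        by (intro is_submoduleD(3)[OF PXT.is_submodule_ext] inverse_N_v h(1) PXT.hom_mem_ext[OF h(2)])
      then show "b \<in> PXT.ext ?I" using N_v_nonzero[OF h(1)] by simp
    qed
  qed
  ultimately show ?thesis by blast
qed

lemma nagata_poly_mult: "ideal_mult poly_dom nagata_v = (nagata_v :: 'a poly fract set)"
proof -
  have "is_submodule poly_dom (nagata_v :: 'a poly fract set)"
    using T.is_submodule_self poly_nagata unfolding is_submodule_def by blast
  then show ?thesis using PX.ideal_mult_self ideal_mult_commute by metis
qed

lemma ext_denominator:
  assumes A: "is_submodule poly_dom A" and z: "z \<in> ideal_mult A nagata_v"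
  shows "\<exists>h\<in>N_v. to_fract (h :: 'a poly) * z \<in> A"
  using z
proof (induction rule: ideal_mult_induct)
  case zero
  then show ?case using N_v_one is_submoduleD(1)[OF A] by (intro bexI[of _ 1]) simp_all
next
  case (add x y)
  then obtain g h where g: "g \<in> N_v" "to_fract g * x \<in> A" and h: "h \<in> N_v" "to_fract h * y \<in> A"
    by blast
  have "to_fract h * (to_fract g * x) + to_fract g * (to_fract h * y) \<in> A"
    by (intro is_submoduleD(2,3)[OF A] to_fract_poly g h)
  then have "to_fract (g * h) * (x + y) \<in> A" by (simp add: algebra_simps)
  then show ?case using N_v_mult[OF g(1) h(1)] by blast
next
  case (mult x y)
  then obtain h where h: "h \<in> N_v" "to_fract h * y \<in> poly_dom" unfolding nagata_iff by blast
  have "(to_fract h * y) * x \<in> A" by (rule is_submoduleD(3)[OF A h(2) mult(1)])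
  then have "to_fract h * (x * y) \<in> A" by (simp add: ac_simps)
  then show ?case using h(1) by blast
qed

text \<open>The ideal \<open>I D[X]\<close> consists of polynomials with coefficients in
  \<open>I\<close>. As \<open>z\<close> is an element of \<open>K(X)\<close>, its coefficients are
  expressed as those of \<open>p\<close> over a common constant denominator
  \<open>b\<close>.\<close>

lemma poly_extension_coeffs:
  assumes I: "is_submodule base_dom (I :: 'a fract set)"
    and z: "z \<in> ideal_mult (embed ` I) poly_dom"
  shows "\<exists>b p. b \<noteq> 0 \<and> cst b * z = to_fract p \<and> (\<forall>k. to_fract (coeff p k) / to_fract b \<in> I)"
  using z
proof (induction rule: ideal_mult_induct)
  case zero
  show ?case
    by (rule exI[of _ 1], rule exI[of _ 0]) (simp add: is_submoduleD(1)[OF I])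
next
  case (add x y)
  obtain b p where b: "b \<noteq> 0" "cst b * x = to_fract p" "\<And>k. to_fract (coeff p k) / to_fract b \<in> I"
    using add(1) by blast
  obtain c q where c: "c \<noteq> 0" "cst c * y = to_fract q" "\<And>k. to_fract (coeff q k) / to_fract c \<in> I"
    using add(2) by blast
  have "to_fract ([:c:] * p + [:b:] * q) = cst c * (cst b * x) + cst b * (cst c * y)"
    unfolding b(2) c(2) to_fract_add to_fract_mult ..
  then have eq: "cst (b * c) * (x + y) = to_fract ([:c:] * p + [:b:] * q)"
    unfolding cst_mult by (simp add: algebra_simps)
  have "to_fract (coeff ([:c:] * p + [:b:] * q) k) / to_fract (b * c) =
      to_fract (coeff p k) / to_fract b + to_fract (coeff q k) / to_fract c" for k
    using b(1) c(1) by (simp add: field_simps)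
  then have "to_fract (coeff ([:c:] * p + [:b:] * q) k) / to_fract (b * c) \<in> I" for k
    using is_submoduleD(2)[OF I b(3)[of k] c(3)[of k]] by simp
  moreover have "b * c \<noteq> 0" using b(1) c(1) by simp
  ultimately show ?case using eq by blast
next
  case (mult x y)
  then obtain w where w: "w \<in> I" "x = embed w" by blast
  obtain a b where ab: "b \<noteq> 0" "w = to_fract a / to_fract b" by (rule fract_quotientE)
  obtain p where p: "y = to_fract p" using mult(2) by (rule poly_domE)
  have "cst b * (x * y) = cst a * to_fract p"
    unfolding p w(2) ab(2) embed_quotient[OF ab(1)] using ab(1) by simp
  then have "cst b * (x * y) = to_fract ([:a:] * p)" unfolding to_fract_mult .
  moreover have "to_fract (coeff ([:a:] * p) k) / to_fract b \<in> I" for k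
    using is_submoduleD(3)[OF I to_fract_base[of "coeff p k"] w(1)] unfolding ab(2) by (simp add: mult.commute)
  ultimately show ?case using ab(1) by blast
qed

text \<open>A denominator \<open>h \<in> N(v)\<close> brings \<open>x\<close> into
  \<open>I D[X]\<close>. Comparing coefficients, the coefficients of \<open>h\<close>, which form a
  GV set, multiply the constant \<open>x\<close> into \<open>I\<close>.\<close>

lemma DT_contracted:
  assumes I: "is_submodule base_dom (I :: 'a fract set)" and x: "embed x \<in> DT.ext I"
  shows "x \<in> w_cl base_dom I"
proof -
  have "embed x \<in> ideal_mult (ideal_mult (embed ` I) poly_dom) nagata_v"
    using x unfolding DT.ext_def ideal_mult_assoc nagata_poly_mult .
  then obtain h where h: "h \<in> N_v" "to_fract h * embed x \<in> ideal_mult (embed ` I) poly_dom"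
    using ext_denominator[OF is_submodule_ideal_mult2[OF PX.is_submodule_self]] by blast
  obtain c p where c: "c \<noteq> 0" "cst c * (to_fract h * embed x) = to_fract p"
    "\<And>k. to_fract (coeff p k) / to_fract c \<in> I"
    using poly_extension_coeffs[OF I h(2)] by blast
  obtain a b where ab: "b \<noteq> 0" "x = to_fract a / to_fract b" by (rule fract_quotientE)
  have "cst c * to_fract h * cst a = to_fract p * cst b"
    using c(2) ab(1) unfolding ab(2) embed_quotient[OF ab(1)] by (simp add: field_simps)
  then have "[:c:] * h * [:a:] = p * [:b:]"
    unfolding to_fract_mult[symmetric] to_fract_eq_iff .
  then have "coeff ([:c:] * h * [:a:]) k = coeff (p * [:b:]) k" for k by simp
  then have "c * coeff h k * a = coeff p k * b" for k by (simp add: ac_simps)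
  then have "to_fract (c * coeff h k * a) = to_fract (coeff p k * b)" for k by simp
  then have "to_fract (coeff h k) * x = to_fract (coeff p k) / to_fract c" for k
    unfolding ab(2) using c(1) ab(1) by (simp add: frac_eq_eq ac_simps)
  then have coeffs: "to_fract (coeff h k) * x \<in> I" for k using c(3) by simp
  show ?thesis
  proof (rule D.w_clI[OF I])
    show "GV_set base_dom (coeff_set h)" using h(1) unfolding N_v_iff_GV .
    show "s * x \<in> I" if "s \<in> coeff_set h" for s
      using that coeffs unfolding coeff_set_def by blast
  qed
qed

text \<open>The case \<open>I = D\<close> of contraction, as \<open>D\<close> is closed under its
  w-operation.\<close>

lemma embed_nagata_iff: "embed x \<in> nagata_v \<longleftrightarrow> x \<in> (base_dom :: 'a fract set)"
proof
  assume x: "embed x \<in> nagata_v"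
  have "embed x * 1 \<in> DT.ext base_dom"
    using is_submoduleD(3)[OF DT.is_submodule_ext x DT.hom_mem_ext[OF D.one_mem]]
    by (simp add: embed.hom_one)
  then have "x \<in> w_cl base_dom base_dom" by (intro DT_contracted D.is_submodule_self) simp
  then show "x \<in> base_dom" unfolding D.w_cl_self .
qed (rule embed_base_nagata)

text \<open>All localizations of \<open>D\<close> at \<open>t\<close>-maximal ideals are valuation domains.\<close>

definition locally_valuation :: bool where
  "locally_valuation \<longleftrightarrow> (\<forall>M\<in>t_Max (base_dom :: 'a fract set). \<forall>a b :: 'a.
     \<exists>s. to_fract s \<notin> M \<and> (a dvd s * b \<or> b dvd s * a))"

lemma locally_valuationI:
  assumes "\<And>M x. M \<in> t_Max (base_dom :: 'a fract set) \<Longrightarrow>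
    \<exists>s\<in>base_dom - M. \<exists>r\<in>base_dom. s * x = r \<or> s = r * x"
  shows locally_valuation
  unfolding locally_valuation_def
proof (intro ballI allI)
  fix M and a b :: 'a
  assume M: "M \<in> t_Max (base_dom :: 'a fract set)"
  show "\<exists>s. to_fract s \<notin> M \<and> (a dvd s * b \<or> b dvd s * a)"
  proof (cases "a = 0")
    case True
    have "to_fract 1 \<notin> M" using D.t_MaxD(3)[OF M] by simp
    then show ?thesis using True by (intro exI[of _ 1]) simp
  next
    case False
    obtain s' r' where s': "s' \<in> base_dom" "s' \<notin> M" and r': "r' \<in> base_dom"
      and eq': "s' * (to_fract b / to_fract a) = r' \<or> s' = r' * (to_fract b / to_fract a)"
      using assms[OF M, of "to_fract b / to_fract a"] by blast
    obtain s where s: "s' = to_fract s" using s'(1) by (rule base_domE)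
    obtain r where r: "r' = to_fract r" using r' by (rule base_domE)
    from eq' have "to_fract (s * b) = to_fract (a * r) \<or> to_fract (s * a) = to_fract (b * r)"
      unfolding s r using False by (auto simp: field_simps)
    then have "s * b = a * r \<or> s * a = b * r" unfolding to_fract_eq_iff .
    then show ?thesis using s'(2) unfolding s by (metis dvd_triv_left)
  qed
qed

text \<open>A finite nonempty set has an element of least value in the valuation domain at
  \<open>M\<close>; one \<open>s\<close> outside \<open>M\<close> clears the denominators of all
  quotients by it.\<close>

lemma ex_minimal_valuation:
  assumes val: locally_valuation and M: "M \<in> t_Max (base_dom :: 'a fract set)"
    and A: "finite A" "A \<noteq> {}"
  shows "\<exists>a\<in>A. \<exists>s. to_fract s \<notin> M \<and> (\<forall>b\<in>A. a dvd s * b)"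
  using A
proof (induction A rule: finite_ne_induct)
  case (singleton a)
  have "to_fract 1 \<notin> M" using D.t_MaxD(3)[OF M] by simp
  then show ?case by (intro bexI[of _ a] exI[of _ 1]) simp_all
next
  case (insert c A)
  then obtain a s where a: "a \<in> A" "to_fract s \<notin> M" "\<forall>b\<in>A. a dvd s * b" by blast
  obtain t where t: "to_fract t \<notin> M" "a dvd t * c \<or> c dvd t * a"
    using val M unfolding locally_valuation_def by blast
  have "to_fract t * to_fract s \<notin> M"
    using D.t_Max_prime[OF M to_fract_base t(1) to_fract_base] a(2) by blast
  then have ts: "to_fract (t * s) \<notin> M" by simp
  from t(2) show ?case
  proof
    assume "a dvd t * c"
    then have "\<forall>b\<in>insert c A. a dvd t * s * b"
      using a(3) by (metis (no_types, lifting) dvd_mult2 dvd_mult insert_iff mult.assoc mult.commute)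
    then show ?thesis using ts a(1) by blast
  next
    assume c: "c dvd t * a"
    have "c dvd t * s * b" if b: "b \<in> insert c A" for b
    proof (cases "b = c")
      case False
      then have "a dvd s * b" using a(3) b by blast
      then have "t * a dvd t * (s * b)" by (rule mult_dvd_mono[OF dvd_refl])
      then show ?thesis using dvd_trans[OF c] by (simp add: mult.assoc)
    qed simp
    then show ?thesis using ts by blast
  qed
qed

text \<open>Divided by a coefficient of minimal value, a polynomial becomes a unit of the localization of
  \<open>D[X]\<close> at \<open>M[X]\<close>; hence \<open>f\<close> and its content generate the same ideal of the Nagata ring.\<close>

lemma coeff_div_poly_nagata:
  fixes f :: "'a poly"
  assumes val: locally_valuation and f: "f \<noteq> 0"
  shows "cst (coeff f i) / to_fract f \<in> nagata_v"
proof -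
  let ?y = "cst (coeff f i) / to_fract f"
  let ?B = "{z. z * ?y \<in> nagata_v}"
  let ?C = "{to_fract (coeff h k) | h k. to_fract h \<in> ?B}"
  have B: "is_submodule nagata_v ?B" by (rule is_submodule_mult_vimage[OF T.is_submodule_self])
  have "is_submodule base_dom ?C"
    unfolding is_submodule_def
  proof (intro conjI ballI)
    have "to_fract 0 \<in> ?B" using is_submoduleD(1)[OF B] by simp
    moreover have "0 = to_fract (coeff 0 0 :: 'a)" by simp
    ultimately show "0 \<in> ?C" by blast
  next
    fix u v assume "u \<in> ?C" "v \<in> ?C"
    then obtain p k q l where p: "u = to_fract (coeff p k)" "to_fract p \<in> ?B"
      and q: "v = to_fract (coeff q l)" "to_fract q \<in> ?B" by blast
    \<comment> \<open>The shifts by \<open>l\<close> and \<open>k\<close> bring the two chosen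
      coefficients to the common index \<open>l + k\<close>.\<close>
    let ?h = "monom 1 l * p + monom 1 k * q"
    have "to_fract (monom 1 l) * to_fract p + to_fract (monom 1 k) * to_fract q \<in> ?B"
      by (intro is_submoduleD(2,3)[OF B] to_fract_nagata p q)
    then have "to_fract ?h \<in> ?B" by simp
    moreover have "u + v = to_fract (coeff ?h (l + k))"
      unfolding p q by (simp add: coeff_monom_mult)
    ultimately show "u + v \<in> ?C" by blast
  next
    fix r u :: "'a fract" assume "r \<in> base_dom" "u \<in> ?C"
    then obtain c p k where c: "r = to_fract c" and p: "u = to_fract (coeff p k)" "to_fract p \<in> ?B"
      using base_domE by blast
    have "cst c * to_fract p \<in> ?B" by (rule is_submoduleD(3)[OF B to_fract_nagata p(2)])
    then have "to_fract ([:c:] * p) \<in> ?B" unfolding to_fract_mult .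
    moreover have "r * u = to_fract (coeff ([:c:] * p) k)" unfolding c p by simp
    ultimately show "r * u \<in> ?C" by blast
  qed
  moreover have "?C \<subseteq> base_dom" using to_fract_base by blast
  moreover have "\<not> ?C \<subseteq> M" if M: "M \<in> t_Max base_dom" for M
  proof -
    have "\<exists>a\<in>range (coeff f). \<exists>s. to_fract s \<notin> M \<and> (\<forall>b\<in>range (coeff f). a dvd s * b)"
      by (rule ex_minimal_valuation[OF val M finite_range_coeff]) simp
    then obtain j s where s: "to_fract s \<notin> M" "\<And>k. coeff f j dvd s * coeff f k" by auto
    have "to_fract s \<noteq> 0" using s(1) is_submoduleD(1)[OF D.t_MaxD(1)[OF M]] by metis
    then have s0: "s \<noteq> 0" by simp
    have fj: "coeff f j \<noteq> 0"
      using s(2)[of "degree f"] s0 f by auto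
    \<comment> \<open>With \<open>f_j\<close> of least value, \<open>h = s f / f_j\<close> is a
      polynomial over \<open>D\<close> whose coefficient at \<open>j\<close> is \<open>s\<close>,
      outside \<open>M\<close>, and \<open>h ?y = s f_i / f_j\<close> is a constant in
      \<open>D\<close>. Thus \<open>h\<close> witnesses that \<open>?C\<close> is not inside
      \<open>M\<close>.\<close>
    have "[:coeff f j:] dvd smult s f" unfolding const_poly_dvd_iff using s(2) by simp
    then obtain h where h: "smult s f = [:coeff f j:] * h" by (rule dvdE)
    have "coeff (smult s f) j = coeff ([:coeff f j:] * h) j" unfolding h ..
    then have hj: "coeff h j = s" using fj by (simp add: mult.commute)
    obtain e where e: "s * coeff f i = coeff f j * e" using s(2)[of i] by (rule dvdE)
    have "[:s:] * f = [:coeff f j:] * h" using h by simp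
    then have 1: "cst s * to_fract f = cst (coeff f j) * to_fract h"
      unfolding to_fract_mult[symmetric] by (rule arg_cong)
    have 2: "cst s * cst (coeff f i) = cst (coeff f j) * cst e"
      unfolding cst_mult[symmetric] e ..
    have "cst (coeff f j) * (to_fract h * cst (coeff f i)) = cst (coeff f j) * (cst e * to_fract f)"
      using 1 2 by algebra
    then have "to_fract h * cst (coeff f i) = cst e * to_fract f" using fj by simp
    then have "to_fract h * ?y = cst e" using f by (simp add: field_simps)
    then have "to_fract h \<in> ?B" using to_fract_nagata by simp
    then have "to_fract (coeff h j) \<in> ?C" by blast
    then show ?thesis using s(1) unfolding hj by blast
  qed
  ultimately obtain S where S: "GV_set base_dom S" "S \<subseteq> ?C"
    using D.ex_GV_set_subset[of ?C] by blast
  have "1 \<in> ?B"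
    by (rule one_mem_if_GV_coeffs[OF B S(1)]) (use S(2) in blast)
  then show ?thesis by simp
qed

text \<open>Since \<open>x\<close> is a constant, the relations over \<open>T\<close> split into one
  pair of relations over \<open>D\<close> for each coefficient once a denominator from
  \<open>N(v)\<close> is cleared. The integral closedness of \<open>D\<close> then applies to each
  coefficient of \<open>h z\<close>.\<close>

lemma two_gen_nagata_closed:
  assumes ic: "integrally_closed (base_dom :: 'a fract set)"
    and z: "z \<in> two_gen nagata_v (embed x)" "z * embed x \<in> two_gen nagata_v (embed x)"
  shows "z \<in> (nagata_v :: 'a poly fract set)"
proof -
  obtain a b where ab: "b \<noteq> 0" "x = to_fract a / to_fract b" by (rule fract_quotientE)
  have ex: "embed x = cst a / cst b" unfolding ab(2) by (rule embed_quotient[OF ab(1)])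
  obtain t1 t2 where t12: "t1 \<in> nagata_v" "t2 \<in> nagata_v" "z = t1 + t2 * embed x"
    using z(1) by (rule two_genE)
  obtain t3 t4 where t34: "t3 \<in> nagata_v" "t4 \<in> nagata_v" "z * embed x = t3 + t4 * embed x"
    using z(2) by (rule two_genE)
  obtain h where h: "h \<in> N_v" "\<forall>y\<in>{t1, t2, t3, t4}. to_fract h * y \<in> poly_dom"
    using N_v_common[of "{t1, t2, t3, t4}"] t12 t34 by auto
  obtain f1 where f1: "to_fract h * t1 = to_fract f1" using h(2) poly_domE by blast
  obtain f2 where f2: "to_fract h * t2 = to_fract f2" using h(2) poly_domE by blast
  obtain f3 where f3: "to_fract h * t3 = to_fract f3" using h(2) poly_domE by blast
  obtain f4 where f4: "to_fract h * t4 = to_fract f4" using h(2) poly_domE by blast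
  define g where "g = to_fract h * z"
  have cb: "cst b \<noteq> 0" using ab(1) by simp
  have "g = to_fract h * t1 + to_fract h * t2 * embed x"
    unfolding g_def t12(3) by (simp add: algebra_simps)
  then have g1: "g * cst b = to_fract f1 * cst b + to_fract f2 * cst a"
    unfolding f1 f2 ex using cb by (simp add: field_simps)
  have "g * embed x = to_fract h * (z * embed x)" unfolding g_def by (simp add: ac_simps)
  also have "\<dots> = to_fract h * t3 + to_fract h * t4 * embed x"
    unfolding t34(3) by (simp add: algebra_simps)
  finally have g2: "g * cst a = to_fract f3 * cst b + to_fract f4 * cst a"
    unfolding f3 f4 ex using cb by (simp add: field_simps)
  \<comment> \<open>The two expressions for \<open>g\<close> and \<open>g x\<close> are played off
    against each other to eliminate \<open>g\<close>, leaving an identity between polynomials over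
    \<open>D\<close>.\<close>
  have "(to_fract f1 * cst b + to_fract f2 * cst a) * cst a =
      cst b * (to_fract f3 * cst b + to_fract f4 * cst a)"
    unfolding g1[symmetric] g2[symmetric] by (simp add: ac_simps)
  then have "(f1 * [:b:] + f2 * [:a:]) * [:a:] = [:b:] * (f3 * [:b:] + f4 * [:a:])"
    unfolding to_fract_mult[symmetric] to_fract_add[symmetric] to_fract_eq_iff .
  then have "coeff ((f1 * [:b:] + f2 * [:a:]) * [:a:]) k = coeff ([:b:] * (f3 * [:b:] + f4 * [:a:])) k" for k
    by simp
  then have coeffs: "(coeff f1 k * b + coeff f2 k * a) * a = b * (coeff f3 k * b + coeff f4 k * a)" for k
    by (simp add: ac_simps)
  let ?p = "f1 * [:b:] + f2 * [:a:]"
  have "b dvd coeff ?p k" for k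
  proof -
    let ?f = "\<lambda>q. to_fract (coeff q k)"
    have "?f f1 + ?f f2 * x \<in> base_dom"
    proof (rule quadratic_integral[OF D.field_subring_axioms ic to_fract_base to_fract_base
          to_fract_base to_fract_base refl])
      have "to_fract ((coeff f1 k * b + coeff f2 k * a) * a) = to_fract (b * (coeff f3 k * b + coeff f4 k * a))"
        unfolding coeffs ..
      then have "(?f f1 * to_fract b + ?f f2 * to_fract a) * to_fract a =
          to_fract b * (?f f3 * to_fract b + ?f f4 * to_fract a)"
        unfolding to_fract_mult to_fract_add .
      moreover have "to_fract a = x * to_fract b" "to_fract b \<noteq> 0" using ab by simp_all
      ultimately have "(?f f1 * to_fract b + ?f f2 * (x * to_fract b)) * (x * to_fract b) =
          to_fract b * (?f f3 * to_fract b + ?f f4 * (x * to_fract b))" by simp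
      then have "(to_fract b * to_fract b) * ((?f f1 + ?f f2 * x) * x) =
          (to_fract b * to_fract b) * (?f f3 + ?f f4 * x)" by (simp add: algebra_simps)
      then show "(?f f1 + ?f f2 * x) * x = ?f f3 + ?f f4 * x"
        using \<open>to_fract b \<noteq> 0\<close> by simp
    qed
    then obtain e where e: "?f f1 + ?f f2 * x = to_fract e" by (rule base_domE)
    have "to_fract (coeff f1 k * b + coeff f2 k * a) = to_fract b * (?f f1 + ?f f2 * x)"
      unfolding ab(2) using ab(1) by (simp add: field_simps)
    also have "\<dots> = to_fract (b * e)" unfolding e by simp
    finally have "coeff f1 k * b + coeff f2 k * a = b * e" unfolding to_fract_eq_iff .
    moreover have "coeff ?p k = coeff f1 k * b + coeff f2 k * a" by (simp add: ac_simps)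
    ultimately show ?thesis by simp
  qed
  then have "[:b:] dvd ?p" unfolding const_poly_dvd_iff by blast
  then obtain e where e: "?p = [:b:] * e" by (rule dvdE)
  have "g * cst b = to_fract ?p" unfolding g1 to_fract_add to_fract_mult ..
  also have "\<dots> = cst b * to_fract e" unfolding e to_fract_mult ..
  finally have "g = to_fract e" using cb by simp
  then have "to_fract h * z \<in> poly_dom" unfolding g_def using to_fract_poly by simp
  then show ?thesis unfolding nagata_iff using h(1) by blast
qed

text \<open>Regularity makes \<open>(1, x) T\<close> invertible, so \<open>u + v x = 1\<close> in
  \<open>T\<close>. After multiplication by \<open>h \<in> N(v)\<close> this is an identity of
  coefficients, and some coefficient of \<open>h\<close> lies outside the given
  \<open>M\<close>.\<close>

lemma regular_nagata_locally_valuation: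
  assumes ic: "integrally_closed (base_dom :: 'a fract set)"
    and reg: "Clifford_regular (nagata_v :: 'a poly fract set)"
  shows locally_valuation
proof (rule locally_valuationI)
  fix M :: "'a fract set" and x :: "'a fract" assume M: "M \<in> t_Max base_dom"
  obtain a b where ab: "b \<noteq> 0" "x = to_fract a / to_fract b" by (rule fract_quotientE)
  have ex: "embed x = cst a / cst b" unfolding ab(2) by (rule embed_quotient[OF ab(1)])
  let ?T = "nagata_v :: 'a poly fract set"
  have "two_gen ?T (embed x) \<in> frac_ideals ?T"
    by (rule T.frac_ideals_two_gen[of "cst b"]) (use ab(1) ex to_fract_nagata in auto)
  then obtain J where J: "J \<in> frac_ideals ?T" "two_gen ?T (embed x) =
      ideal_mult (ideal_mult (two_gen ?T (embed x)) (two_gen ?T (embed x))) J"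
    using reg unfolding Clifford_regular_def vN_regular_ideal_def by blast
  obtain u v where uv: "u \<in> ?T" "u * embed x \<in> ?T" "v \<in> ?T" "v * embed x \<in> ?T"
    "u + v * embed x = 1"
    using frac_idealsD(1)[OF J(1)] J(2) two_gen_nagata_closed[OF ic]
    by (rule T.regular_two_gen_invertible)
  obtain h where h: "h \<in> N_v"
    "\<forall>y\<in>{u, u * embed x, v, v * embed x}. to_fract h * y \<in> poly_dom"
    using N_v_common[of "{u, u * embed x, v, v * embed x}"] uv by auto
  obtain f1 where f1: "to_fract h * u = to_fract f1" using h(2) poly_domE by blast
  obtain f2 where f2: "to_fract h * (u * embed x) = to_fract f2" using h(2) poly_domE by blast
  obtain f3 where f3: "to_fract h * v = to_fract f3" using h(2) poly_domE by blast
  obtain f4 where f4: "to_fract h * (v * embed x) = to_fract f4" using h(2) poly_domE by blast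
  \<comment> \<open>Multiplication by the constant \<open>x\<close> acts separately on each
    coefficient of \<open>h w\<close>.\<close>
  have transfer: "to_fract (coeff f k) * x = to_fract (coeff g k)"
    if w: "to_fract h * w = to_fract f" "to_fract h * (w * embed x) = to_fract g" for w f g k
  proof -
    have "to_fract g = to_fract h * w * embed x" unfolding w(2)[symmetric] by (simp add: mult.assoc)
    also have "\<dots> = to_fract f * cst a / cst b" unfolding w(1) ex by simp
    finally have "to_fract g * cst b = to_fract f * cst a" using ab(1) by (simp add: field_simps)
    then have "g * [:b:] = f * [:a:]" unfolding to_fract_mult[symmetric] to_fract_eq_iff .
    then have "coeff (g * [:b:]) k = coeff (f * [:a:]) k" by simp
    then have "coeff f k * a = coeff g k * b" by (simp add: ac_simps)
    then have "to_fract (coeff f k * a) = to_fract (coeff g k * b)" by simp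
    then show ?thesis unfolding ab(2) using ab(1) by (simp add: field_simps)
  qed
  have "to_fract h = to_fract h * (u + v * embed x)" unfolding uv(5) by simp
  also have "\<dots> = to_fract f1 + to_fract f4" unfolding distrib_left f1 f4 ..
  finally have "h = f1 + f4" unfolding to_fract_add[symmetric] to_fract_eq_iff .
  obtain k where k: "to_fract (coeff h k) \<notin> M" using h(1) M unfolding N_v_iff_t_Max by blast
  have "to_fract (coeff f1 k) + to_fract (coeff f3 k) * x = to_fract (coeff h k)"
    unfolding transfer[OF f3 f4] \<open>h = f1 + f4\<close> by simp
  then have "to_fract (coeff f1 k) + to_fract (coeff f3 k) * x \<notin> M" using k by simp
  then show "\<exists>s\<in>base_dom - M. \<exists>r\<in>base_dom. s * x = r \<or> s = r * x"
    by (rule D.t_Max_dichotomy[OF M]) (simp_all add: to_fract_base transfer[OF f1 f2] transfer[OF f3 f4])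
qed

lemma w_regular_base_locally_valuation:
  assumes "integrally_closed (base_dom :: 'a fract set)"
    and "Clifford_w_regular (base_dom :: 'a fract set)"
  shows locally_valuation
  by (rule locally_valuationI) (rule D.w_regular_imp_dichotomy[OF assms])

section \<open>Ideals of the Nagata ring under the valuation property\<close>

context
  assumes valuation: locally_valuation
begin

text \<open>\<open>B\<close> is generated by \<open>B \<inter> K\<close>: the quotients
  \<open>f_k / f\<close> lie in \<open>T\<close>, so an ideal containing \<open>f\<close> contains
  each coefficient \<open>f_k\<close>, and the coefficients give \<open>f\<close> back.\<close>

lemma DT_extended:
  assumes B: "B \<in> frac_ideals (nagata_v :: 'a poly fract set)"
  shows "\<exists>I\<in>frac_ideals base_dom. B = DT.ext I"
proof -
  obtain x e where x: "x \<in> B" "x \<noteq> 0" and e: "e \<in> nagata_v" "e \<noteq> 0" "\<forall>x\<in>B. e * x \<in> nagata_v"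
    using frac_idealsD(2,3)[OF B] by blast
  note sub = frac_idealsD(1)[OF B]
  obtain g where g: "g \<in> N_v" "to_fract g * e \<in> poly_dom" using e(1) unfolding nagata_iff by blast
  obtain q where q: "to_fract g * e = to_fract q" using g(2) by (rule poly_domE)
  have q0: "q \<noteq> 0" using q e(2) N_v_nonzero[OF g(1)] by auto
  \<comment> \<open>The denominator \<open>q\<close> of \<open>B\<close> is a polynomial, but a
    fractional ideal of \<open>D\<close> needs a constant one. Any nonzero coefficient of
    \<open>q\<close> will do, being a multiple of \<open>q\<close> in \<open>T\<close>.\<close>
  define c where "c = lead_coeff q"
  have c0: "c \<noteq> 0" unfolding c_def using q0 by simp
  have cB: "cst c * b \<in> nagata_v" if b: "b \<in> B" for b
  proof -
    have "cst c / to_fract q * (to_fract g * (e * b)) \<in> nagata_v"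
      unfolding c_def
      by (intro T.mult_mem[OF coeff_div_poly_nagata[OF valuation q0]] T.mult_mem[OF to_fract_nagata])
         (use e(3) b in blast)
    also have "to_fract g * (e * b) = to_fract q * b" unfolding q[symmetric] by (simp add: mult.assoc)
    finally show ?thesis using q0 by simp
  qed
  let ?I = "{x. embed x \<in> B}"
  have subI: "is_submodule base_dom ?I"
    using is_submoduleD[OF sub] embed_base_nagata unfolding is_submodule_def
    by (simp add: embed.hom_zero embed.hom_add embed.hom_mult)
  have coeffs: "\<exists>h f. h \<in> N_v \<and> b * to_fract h * cst c = to_fract f \<and>
      (\<forall>k. to_fract (coeff f k) / to_fract c \<in> ?I)" if b: "b \<in> B" for b
  proof -
    obtain h where h: "h \<in> N_v" "to_fract h * (cst c * b) \<in> poly_dom"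
      using cB[OF b] unfolding nagata_iff by blast
    obtain f where f: "to_fract h * (cst c * b) = to_fract f" using h(2) by (rule poly_domE)
    have "cst (coeff f k) / cst c \<in> B" for k
    proof (cases "f = 0")
      case True
      then show ?thesis using is_submoduleD(1)[OF sub] by simp
    next
      case False
      have "cst (coeff f k) / to_fract f * (to_fract h * b) \<in> B"
        by (intro is_submoduleD(3)[OF sub] coeff_div_poly_nagata[OF valuation False] to_fract_nagata b)
      also have "to_fract h * b = to_fract f / cst c" unfolding f[symmetric] using c0 by simp
      finally show ?thesis using False by simp
    qed
    then have "\<forall>k. to_fract (coeff f k) / to_fract c \<in> ?I" by (simp add: embed_quotient[OF c0])
    moreover have "b * to_fract h * cst c = to_fract f" unfolding f[symmetric] by (simp add: ac_simps)
    ultimately show ?thesis using h(1) by blast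
  qed
  have "?I \<in> frac_ideals base_dom"
  proof -
    obtain h f where hf: "h \<in> N_v" "x * to_fract h * cst c = to_fract f"
      "\<forall>k. to_fract (coeff f k) / to_fract c \<in> ?I"
      using coeffs[OF x(1)] by blast
    have "to_fract f \<noteq> 0" unfolding hf(2)[symmetric] using x(2) N_v_nonzero[OF hf(1)] c0 by simp
    then have "f \<noteq> 0" by simp
    show ?thesis
    proof (rule frac_idealsI[OF subI])
      show "to_fract (lead_coeff f) / to_fract c \<in> ?I" using hf(3) by blast
      show "to_fract (lead_coeff f) / to_fract c \<noteq> 0" using \<open>f \<noteq> 0\<close> c0 by simp
      show "to_fract c \<in> base_dom" by (rule to_fract_base)
      show "to_fract c \<noteq> 0" using c0 by simp
      fix y assume "y \<in> ?I"
      then have "cst c * embed y \<in> nagata_v" using cB by blast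
      then have "embed (to_fract c * y) \<in> nagata_v" by (simp add: embed.hom_mult embed_to_fract)
      then show "to_fract c * y \<in> base_dom" unfolding embed_nagata_iff .
    qed
  qed
  moreover have "B = DT.ext ?I"
  proof
    show "DT.ext ?I \<subseteq> B" by (rule DT.ext_minimal[OF sub]) blast
    show "B \<subseteq> DT.ext ?I"
    proof
      fix b assume "b \<in> B"
      then obtain h f where hf: "h \<in> N_v" "b * to_fract h * cst c = to_fract f"
        "\<forall>k. to_fract (coeff f k) / to_fract c \<in> ?I"
        using coeffs by blast
      let ?E = "DT.ext ?I"
      note subE = DT.is_submodule_ext[of ?I]
      \<comment> \<open>The terms \<open>X^k (f_k / c)\<close> sum to \<open>f / c\<close>, which is
        \<open>b\<close> up to the unit \<open>h\<close> of \<open>T\<close>.\<close>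
      have "to_fract (monom 1 k) * embed (to_fract (coeff f k) / to_fract c) \<in> ?E" for k
        by (intro is_submoduleD(3)[OF subE] to_fract_nagata DT.hom_mem_ext) (use hf(3) in blast)
      then have "(\<Sum>k\<le>degree f. to_fract (monom 1 k) * embed (to_fract (coeff f k) / to_fract c)) \<in> ?E"
        by (intro is_submodule_sum[OF subE])
      also have "(\<Sum>k\<le>degree f. to_fract (monom 1 k) * embed (to_fract (coeff f k) / to_fract c)) =
          (\<Sum>k\<le>degree f. to_fract (monom (coeff f k) k)) / cst c"
        unfolding sum_divide_distrib
      proof (rule sum.cong[OF refl])
        fix k
        have "to_fract (monom 1 k) * cst (coeff f k) = to_fract (monom (coeff f k) k)"
          unfolding to_fract_mult[symmetric] by (simp add: smult_monom mult.commute)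
        then show "to_fract (monom 1 k) * embed (to_fract (coeff f k) / to_fract c) =
            to_fract (monom (coeff f k) k) / cst c"
          unfolding embed_quotient[OF c0] by simp
      qed
      also have "(\<Sum>k\<le>degree f. to_fract (monom (coeff f k) k)) = to_fract f"
        unfolding to_fract_sum[symmetric] poly_as_sum_of_monoms ..
      finally have "to_fract f / cst c \<in> ?E" .
      then have "1 / to_fract h * (to_fract f / cst c) \<in> ?E"
        by (rule is_submoduleD(3)[OF subE inverse_N_v[OF hf(1)]])
      then show "b \<in> ?E"
        unfolding hf(2)[symmetric] using N_v_nonzero[OF hf(1)] c0 by simp
    qed
  qed
  ultimately show ?thesis by blast
qed

text \<open>This is \<open>T \<inter> K[X] = D[X]\<close>. For \<open>z = p / k\<close> the product
  of \<open>p_i / p \<in> T\<close> with \<open>z\<close> is the constant \<open>p_i / k\<close>,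
  which lies in \<open>T \<inter> K = D\<close>.\<close>

lemma nagata_const_multiple_in_poly:
  fixes z :: "'a poly fract"
  assumes z: "z \<in> nagata_v" and k: "k \<noteq> 0" "cst k * z \<in> poly_dom"
  shows "z \<in> poly_dom"
proof -
  obtain p where p: "cst k * z = to_fract p" using k(2) by (rule poly_domE)
  then have zp: "z = to_fract p / cst k" using k(1) by (simp add: field_simps)
  have "k dvd coeff p i" for i
  proof (cases "p = 0")
    case False
    have "cst (coeff p i) / to_fract p * z \<in> nagata_v"
      by (rule T.mult_mem[OF coeff_div_poly_nagata[OF valuation False] z])
    also have "cst (coeff p i) / to_fract p * z = embed (to_fract (coeff p i) / to_fract k)"
      unfolding zp embed_quotient[OF k(1)] using False by simp
    finally have "to_fract (coeff p i) / to_fract k \<in> base_dom" unfolding embed_nagata_iff .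
    then obtain e where "to_fract (coeff p i) / to_fract k = to_fract e" by (rule base_domE)
    then have "to_fract (coeff p i) = to_fract (k * e)" using k(1) by (simp add: field_simps)
    then show ?thesis unfolding to_fract_eq_iff by (rule dvdI)
  qed simp
  then have "[:k:] dvd p" unfolding const_poly_dvd_iff by blast
  then obtain e where "p = [:k:] * e" by (rule dvdE)
  then have "to_fract p = cst k * to_fract e" unfolding to_fract_mult[symmetric] by (rule arg_cong)
  then have "z = to_fract e" unfolding zp using k(1) by simp
  then show ?thesis using to_fract_poly by simp
qed

text \<open>A nonzero constant and an element of \<open>N(v)\<close> together form a GV set of \<open>D[X]\<close>, so
  that closure in \<open>D[X]\<close> amounts to extension to the Nagata ring and to \<open>K[X]\<close>.\<close>

lemma mem_w_cl_poly:
  fixes a :: "'a poly fract"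
  assumes A: "is_submodule poly_dom A" and T: "a \<in> ideal_mult A nagata_v"
    and k: "k \<noteq> 0" "cst k * a \<in> A"
  shows "a \<in> w_cl poly_dom A"
proof -
  obtain h where h: "h \<in> N_v" "to_fract h * a \<in> A" using ext_denominator[OF A T] by blast
  have "GV_set poly_dom {cst k, to_fract h}"
    unfolding GV_set_def
  proof (intro conjI allI impI)
    fix y assume y: "\<forall>s\<in>{cst k, to_fract h}. y * s \<in> poly_dom"
    then have "to_fract h * y \<in> poly_dom" "cst k * y \<in> poly_dom"
      by (simp_all add: mult.commute[of _ y])
    moreover from this have "y \<in> nagata_v" unfolding nagata_iff using h(1) by blast
    ultimately show "y \<in> poly_dom" by (intro nagata_const_multiple_in_poly[of y k] k(1))
  qed (simp_all add: to_fract_poly)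
  then show ?thesis
    by (rule PX.w_clI[OF A]) (use h k in auto)
qed

end

text \<open>The generator is a numerator of minimal degree: pseudo-division shows that \<open>A K[X]\<close> is
  principal, without leaving \<open>D[X]\<close>.\<close>

lemma ex_generator_up_to_constants:
  assumes A: "A \<in> frac_ideals (poly_dom :: 'a poly fract set)"
  obtains g where "g \<in> A" "g \<noteq> 0"
    "\<And>f. f \<in> A \<Longrightarrow> \<exists>k q. k \<noteq> 0 \<and> cst k * f = to_fract q * g"
proof -
  note sub = frac_idealsD(1)[OF A]
  obtain x e where x: "x \<in> A" "x \<noteq> 0" and e: "e \<in> poly_dom" "e \<noteq> 0" "\<forall>x\<in>A. e * x \<in> poly_dom"
    using frac_idealsD(2,3)[OF A] by blast
  let ?P = "\<lambda>p :: 'a poly. p \<noteq> 0 \<and> to_fract p / e \<in> A"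
  have numerator: "\<exists>p. f = to_fract p / e" if f: "f \<in> A" for f
  proof -
    have "e * f \<in> poly_dom" using e(3) f by blast
    then obtain p where "e * f = to_fract p" by (rule poly_domE)
    then have "f = to_fract p / e" using e(2) by (simp add: field_simps)
    then show ?thesis by blast
  qed
  obtain p0 where "x = to_fract p0 / e" using numerator[OF x(1)] by blast
  then have "?P p0" using x by auto
  then obtain p where p: "p \<noteq> 0" "to_fract p / e \<in> A" and min: "\<And>q. ?P q \<Longrightarrow> degree p \<le> degree q"
    using ex_has_least_nat[of ?P p0 degree] by blast
  show ?thesis
  proof (rule that[OF p(2)])
    show "to_fract p / e \<noteq> 0" using p(1) e(2) by simp
    fix f assume f: "f \<in> A"
    obtain q where q: "f = to_fract q / e" using numerator[OF f] by blast
    obtain k s where ks: "k \<noteq> 0" "smult k q = p * s + pseudo_mod q p"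
      using pseudo_mod(1)[OF p(1), of q] by blast
    let ?r = "pseudo_mod q p"
    have "?r = [:k:] * q + - s * p" using ks(2) by simp
    then have r: "to_fract ?r = cst k * to_fract q + to_fract (- s) * to_fract p"
      unfolding to_fract_mult[symmetric] to_fract_add[symmetric] by simp
    have "to_fract ?r / e = cst k * f + to_fract (- s) * (to_fract p / e)"
      unfolding q r by (simp add: add_divide_distrib diff_divide_distrib)
    also have "\<dots> \<in> A" by (intro is_submoduleD(2,3)[OF sub] to_fract_poly f p(2))
    finally have "?r = 0"
      using min[of ?r] pseudo_mod(2)[OF p(1), of q] by fastforce
    then have "[:k:] * q = s * p" using ks(2) by (simp add: mult.commute)
    then have "cst k * to_fract q = to_fract s * to_fract p"
      unfolding to_fract_mult[symmetric] by simp
    then have "cst k * f = to_fract s * (to_fract p / e)" unfolding q by simp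
    then show "\<exists>k s. k \<noteq> 0 \<and> cst k * f = to_fract s * (to_fract p / e)" using ks(1) by blast
  qed
qed

end

section \<open>The polynomial ring\<close>

lemma ideal_mult_singleton:
  assumes I: "is_submodule R I"
  shows "ideal_mult {c} I = (*) c ` I"
proof
  show "ideal_mult {c} I \<subseteq> (*) c ` I"
    by (rule ideal_mult_subset[OF is_submodule_scale[OF I]]) blast
  show "(*) c ` I \<subseteq> ideal_mult {c} I"
    using ideal_multI by blast
qed

context nonfield_domain
begin

text \<open>The extension \<open>A K[X]\<close> of a \<open>D[X]\<close>-submodule \<open>A\<close>; in particular
  \<open>const_sat poly_dom\<close> is \<open>K[X]\<close>.\<close>

definition const_sat :: "'a poly fract set \<Rightarrow> 'a poly fract set" where
  "const_sat A = {z. \<exists>k. k \<noteq> 0 \<and> cst k * z \<in> A}"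

lemma const_satI: "k \<noteq> 0 \<Longrightarrow> cst k * z \<in> A \<Longrightarrow> z \<in> const_sat A"
  unfolding const_sat_def by blast

lemma const_satE:
  assumes "z \<in> const_sat A"
  obtains k where "k \<noteq> 0" "cst k * z \<in> A"
  using assms unfolding const_sat_def by blast

lemma const_sat_increasing: "A \<subseteq> const_sat A"
proof
  fix z assume "z \<in> A"
  then show "z \<in> const_sat A" by (intro const_satI[of 1]) (simp_all add: one_pCons[symmetric])
qed

lemma const_sat_mult:
  assumes A: "is_submodule poly_dom A" and a: "a \<in> const_sat A" and z: "z \<in> const_sat poly_dom"
  shows "a * z \<in> const_sat A"
proof -
  obtain k where k: "k \<noteq> 0" "cst k * a \<in> A" using a by (rule const_satE)
  obtain l where l: "l \<noteq> 0" "cst l * z \<in> poly_dom" using z by (rule const_satE)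
  show ?thesis
  proof (rule const_satI)
    show "k * l \<noteq> 0" using k(1) l(1) by simp
    have "(cst l * z) * (cst k * a) \<in> A" by (rule is_submoduleD(3)[OF A l(2) k(2)])
    then show "cst (k * l) * (a * z) \<in> A" unfolding cst_mult by (simp add: ac_simps)
  qed
qed

lemma is_submodule_const_sat:
  assumes A: "is_submodule poly_dom A"
  shows "is_submodule poly_dom (const_sat A)"
  unfolding is_submodule_def
proof (intro conjI ballI)
  show "0 \<in> const_sat A" using const_sat_increasing is_submoduleD(1)[OF A] by blast
next
  fix x y :: "'a poly fract" assume "x \<in> const_sat A" "y \<in> const_sat A"
  obtain k where k: "k \<noteq> 0" "cst k * x \<in> A" using \<open>x \<in> const_sat A\<close> by (rule const_satE)
  obtain l where l: "l \<noteq> 0" "cst l * y \<in> A" using \<open>y \<in> const_sat A\<close> by (rule const_satE)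
  show "x + y \<in> const_sat A"
  proof (rule const_satI)
    show "k * l \<noteq> 0" using k(1) l(1) by simp
    have "cst l * (cst k * x) + cst k * (cst l * y) \<in> A"
      by (intro is_submoduleD(2,3)[OF A] to_fract_poly k(2) l(2))
    then show "cst (k * l) * (x + y) \<in> A" unfolding cst_mult by (simp add: algebra_simps)
  qed
next
  fix r x :: "'a poly fract" assume "r \<in> poly_dom" "x \<in> const_sat A"
  then have "x * r \<in> const_sat A"
    using const_sat_increasing[of poly_dom] by (intro const_sat_mult[OF A]) blast+
  then show "r * x \<in> const_sat A" by (simp add: mult.commute)
qed

lemma embed_const_sat: "embed (x :: 'a fract) \<in> const_sat poly_dom"
proof -
  obtain a b where ab: "b \<noteq> 0" "x = to_fract a / to_fract b" by (rule fract_quotientE)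
  show ?thesis
    unfolding ab(2) embed_quotient[OF ab(1)]
    by (rule const_satI[OF ab(1)]) (use ab(1) to_fract_poly[of "[:a:]"] in simp)
qed

lemma generatorE:
  assumes A: "A \<in> frac_ideals (poly_dom :: 'a poly fract set)"
  obtains g where "g \<in> A" "g \<noteq> 0" "\<forall>f\<in>A. f / g \<in> const_sat poly_dom"
proof -
  obtain g where g: "g \<in> A" "g \<noteq> 0"
    "\<And>f. f \<in> A \<Longrightarrow> \<exists>k q. k \<noteq> 0 \<and> cst k * f = to_fract q * g"
    using A by (rule ex_generator_up_to_constants) blast
  have "f / g \<in> const_sat poly_dom" if f: "f \<in> A" for f
  proof -
    obtain k q where kq: "k \<noteq> 0" "cst k * f = to_fract q * g" using g(3)[OF f] by blast
    have "cst k * (f / g) = to_fract q * g / g" unfolding kq(2)[symmetric] by simp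
    then have "cst k * (f / g) = to_fract q" using g(2) by simp
    then show ?thesis using kq(1) to_fract_poly by (intro const_satI[of k]) simp_all
  qed
  then show ?thesis using that g(1,2) by blast
qed

section \<open>Multipliers for ideals of \<open>D[X]\<close>\<close>

lemma frac_ideals_poly_extension:
  assumes J: "J \<in> frac_ideals (base_dom :: 'a fract set)"
  shows "ideal_mult (embed ` J) poly_dom \<in> frac_ideals poly_dom"
proof -
  obtain x d where x: "x \<in> J" "x \<noteq> 0"
    and d: "d \<in> base_dom" "d \<noteq> 0" "\<forall>x\<in>J. d * x \<in> base_dom"
    using frac_idealsD(2,3)[OF J] by blast
  have base: "embed r \<in> poly_dom" if r: "r \<in> base_dom" for r :: "'a fract"
  proof -
    obtain a where a: "r = to_fract a" using r by (rule base_domE)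
    show ?thesis unfolding a embed_to_fract by (rule to_fract_poly)
  qed
  have sub: "ideal_mult (embed ` J) poly_dom \<subseteq> {z. z * embed d \<in> poly_dom}"
  proof (rule ideal_mult_subset[OF is_submodule_mult_vimage[OF PX.is_submodule_self]])
    fix y z :: "'a poly fract" assume "y \<in> embed ` J" and z: "z \<in> poly_dom"
    then obtain j where j: "j \<in> J" "y = embed j" by blast
    have "z * embed (d * j) \<in> poly_dom"
      by (rule PX.mult_mem[OF z base]) (use d(3) j(1) in blast)
    then show "y * z \<in> {z. z * embed d \<in> poly_dom}"
      unfolding j(2) embed.hom_mult by (simp add: ac_simps)
  qed
  show ?thesis
  proof (rule frac_idealsI[OF is_submodule_ideal_mult2[OF PX.is_submodule_self]])
    show "embed x * 1 \<in> ideal_mult (embed ` J) poly_dom"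
      by (rule ideal_multI[OF imageI[OF x(1)] PX.one_mem])
    show "embed x * 1 \<noteq> 0" "embed d \<noteq> 0" using x(2) d(2) by (simp_all add: embed.hom_eq_zero_iff)
    show "embed d \<in> poly_dom" by (rule base[OF d(1)])
    show "embed d * z \<in> poly_dom" if "z \<in> ideal_mult (embed ` J) poly_dom" for z
      using subsetD[OF sub that] by (simp add: mult.commute[of z])
  qed
qed

text \<open>The factor \<open>1 / g\<close> is split off before \<open>J\<close> is chosen, since an
  ideal extended from \<open>D\<close> is trivial over \<open>K[X]\<close> and cannot compensate
  there for the generator \<open>g\<close>.\<close>

lemma scaled_DT_extended:
  assumes val: locally_valuation
    and B: "B \<in> frac_ideals (nagata_v :: 'a poly fract set)" and g: "g \<noteq> 0"
  obtains J where "J \<in> frac_ideals base_dom" "B = ideal_mult {1 / g} (DT.ext J)"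
proof -
  obtain a b where ab: "a \<in> poly_dom" "b \<in> poly_dom" "b \<noteq> 0" "g = a / b"
    using PX.quotient by blast
  have "(*) g ` B \<in> frac_ideals nagata_v"
    by (rule T.frac_ideals_scale[OF B g _ ab(3)]) (use ab poly_nagata in auto)
  then obtain J where J: "J \<in> frac_ideals base_dom" "(*) g ` B = DT.ext J"
    using DT_extended[OF val] by blast
  have "ideal_mult {1 / g} (DT.ext J) = (*) (1 / g) ` DT.ext J"
    by (rule ideal_mult_singleton[OF DT.is_submodule_ext])
  also have "\<dots> = B" unfolding J(2)[symmetric] image_image using g by simp
  finally show ?thesis using that[OF J(1)] by simp
qed

text \<open>The multiplier \<open>B' = (1 / g) J D[X]\<close> works in both rings: in
  \<open>T\<close> it extends to \<open>B\<close>, so \<open>C T = A T\<close>, and in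
  \<open>K[X]\<close> both \<open>C\<close> and \<open>A\<close> generate \<open>g K[X]\<close>.
  Membership in both extensions gives membership in the w-closure.\<close>

lemma Clifford_w_regular_poly:
  assumes val: locally_valuation and T: "Clifford_regular (nagata_v :: 'a poly fract set)"
  shows "Clifford_w_regular (poly_dom :: 'a poly fract set)"
  unfolding Clifford_w_regular_def
proof
  fix A :: "'a poly fract set" assume A: "A \<in> frac_ideals poly_dom"
  note sub = frac_idealsD(1)[OF A]
  obtain g where g: "g \<in> A" "g \<noteq> 0" "\<forall>f\<in>A. f / g \<in> const_sat poly_dom"
    using A by (rule generatorE)
  obtain B where B: "B \<in> frac_ideals nagata_v"
    "PXT.ext A = ideal_mult (ideal_mult (PXT.ext A) (PXT.ext A)) B"
    using T PXT.frac_ideals_ext[OF A] unfolding Clifford_regular_def vN_regular_ideal_def by blast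
  obtain J where J: "J \<in> frac_ideals base_dom" "B = ideal_mult {1 / g} (DT.ext J)"
    using val B(1) g(2) by (rule scaled_DT_extended)
  define H where "H = ideal_mult (embed ` J) poly_dom"
  have H: "H \<in> frac_ideals poly_dom" unfolding H_def by (rule frac_ideals_poly_extension[OF J(1)])
  note subH = frac_idealsD(1)[OF H]
  define B' where "B' = ideal_mult {1 / g} H"
  have B': "B' \<in> frac_ideals poly_dom"
  proof -
    obtain a b where ab: "a \<in> poly_dom" "b \<in> poly_dom" "b \<noteq> 0" "1 / g = a / b"
      using PX.quotient by blast
    show ?thesis
      unfolding B'_def ideal_mult_singleton[OF subH]
      by (rule PX.frac_ideals_scale[OF H _ ab(2,3)]) (use g(2) ab in auto)
  qed
  define C where "C = ideal_mult (ideal_mult A A) B'"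
  have subC: "is_submodule poly_dom C"
    unfolding C_def by (intro is_submodule_ideal_mult sub)
  have "PXT.ext B' = ideal_mult {1 / g} (ideal_mult (embed ` J) (ideal_mult poly_dom nagata_v))"
    unfolding PXT_ext B'_def H_def by (simp only: ideal_mult_assoc)
  then have "PXT.ext B' = B" unfolding nagata_poly_mult J(2) DT.ext_def .
  then have ext: "PXT.ext C = PXT.ext A"
    using B(2) unfolding C_def PXT.ext_mult by simp
  obtain j where j: "j \<in> J" "j \<noteq> 0" using frac_idealsD(2)[OF J(1)] by blast
  have embedH: "embed i \<in> H" if "i \<in> J" for i
    using ideal_multI[OF imageI[OF that] PX.one_mem] unfolding H_def by simp
  have "w_cl poly_dom A \<subseteq> w_cl poly_dom C"
  proof (rule PX.w_cl_minimal[OF subC], rule subsetI)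
    fix f assume f: "f \<in> A"
    \<comment> \<open>This product is \<open>g j\<close>, and \<open>j\<close> is a unit of
      \<open>K[X]\<close>; so the generator \<open>g\<close> of \<open>A K[X]\<close> lies in
      \<open>C K[X]\<close>.\<close>
    have "g * g * (1 / g * embed j) \<in> C"
      unfolding C_def B'_def by (intro ideal_multI g(1) singletonI embedH j(1))
    then have "g * embed j \<in> const_sat C" using const_sat_increasing g(2) by auto
    then have "g * embed j * embed (1 / j) \<in> const_sat C"
      by (rule const_sat_mult[OF subC _ embed_const_sat])
    moreover have "embed j * embed (1 / j) = 1"
      unfolding embed.hom_mult[symmetric] using j(2) by (simp add: embed.hom_one)
    ultimately have "g \<in> const_sat C" by (simp add: mult.assoc)
    then have "g * (f / g) \<in> const_sat C"
      by (rule const_sat_mult[OF subC]) (use g(3) f in blast)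
    then have "f \<in> const_sat C" using g(2) by simp
    then obtain k where k: "k \<noteq> 0" "cst k * f \<in> C" by (rule const_satE)
    have "f \<in> ideal_mult C nagata_v"
      unfolding PXT_ext[symmetric] ext by (rule PXT.hom_mem_ext[OF f])
    then show "f \<in> w_cl poly_dom C" using k by (rule mem_w_cl_poly[OF val subC])
  qed
  moreover have "w_cl poly_dom C \<subseteq> w_cl poly_dom A"
  proof (rule PX.w_cl_minimal[OF sub], rule subsetI)
    fix y assume y: "y \<in> C"
    have satA: "is_submodule poly_dom (const_sat A)" by (rule is_submodule_const_sat[OF sub])
    have satK: "is_submodule poly_dom (const_sat poly_dom)"
      by (rule is_submodule_const_sat[OF PX.is_submodule_self])
    have HK: "H \<subseteq> const_sat poly_dom"
      unfolding H_def
    proof (rule ideal_mult_subset[OF satK])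
      fix u v :: "'a poly fract" assume "u \<in> embed ` J" "v \<in> poly_dom"
      then show "u * v \<in> const_sat poly_dom"
        using const_sat_increasing[of poly_dom] embed_const_sat
        by (intro const_sat_mult[OF PX.is_submodule_self]) auto
    qed
    \<comment> \<open>Both \<open>A / g\<close> and \<open>J D[X]\<close> lie in
      \<open>K[X]\<close>; hence \<open>C = A (A B')\<close> lies in \<open>A K[X]\<close>.\<close>
    have "ideal_mult A B' \<subseteq> const_sat poly_dom"
      unfolding B'_def ideal_mult_singleton[OF subH]
    proof (rule ideal_mult_subset[OF satK])
      fix u v :: "'a poly fract" assume u: "u \<in> A" and "v \<in> (*) (1 / g) ` H"
      then obtain z where z: "z \<in> H" "v = 1 / g * z" by blast
      have "u / g * z \<in> const_sat poly_dom"
        using g(3) u HK z(1) by (intro const_sat_mult[OF PX.is_submodule_self]) auto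
      then show "u * v \<in> const_sat poly_dom" unfolding z(2) by simp
    qed
    moreover have "C = ideal_mult A (ideal_mult A B')" unfolding C_def by (rule ideal_mult_assoc)
    moreover have "ideal_mult A (const_sat poly_dom) \<subseteq> const_sat A"
      by (rule ideal_mult_subset[OF satA])
         (use const_sat_increasing[of A] const_sat_mult[OF sub] in blast)
    ultimately have "C \<subseteq> const_sat A"
      using ideal_mult_mono[of A A "ideal_mult A B'" "const_sat poly_dom"] by auto
    then obtain k where k: "k \<noteq> 0" "cst k * y \<in> A" using y const_satE by blast
    have "y \<in> ideal_mult A nagata_v"
      unfolding PXT_ext[symmetric] ext[symmetric] by (rule PXT.hom_mem_ext[OF y])
    then show "y \<in> w_cl poly_dom A" using k by (rule mem_w_cl_poly[OF val sub])
  qed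
  ultimately have "w_cl poly_dom A = w_cl poly_dom C" ..
  then show "w_regular_ideal poly_dom A"
    unfolding w_regular_ideal_def C_def using B' by blast
qed

text \<open>The candidate inverse is \<open>(1 / g) J\<close>, generating \<open>(F : B)\<close>
  over \<open>T\<close>. It must first be shown to lie in \<open>(E : W)\<close>, and then to yield
  \<open>1\<close> both in \<open>C T\<close> and in \<open>C K[X]\<close>.\<close>

lemma w_stable_poly:
  assumes val: locally_valuation and T: "stable_dom (nagata_v :: 'a poly fract set)"
  shows "w_stable_dom (poly_dom :: 'a poly fract set)"
  unfolding w_stable_dom_def
proof
  fix A :: "'a poly fract set" assume A: "A \<in> frac_ideals poly_dom"
  define W where "W = w_cl poly_dom A"
  define E where "E = colon W W"
  have W: "W \<in> frac_ideals poly_dom" unfolding W_def by (rule PX.frac_ideals_w_cl[OF A])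
  note subW = frac_idealsD(1)[OF W]
  have wW: "w_cl poly_dom W = W"
    unfolding W_def by (rule PX.w_cl_idem[OF frac_idealsD(1)[OF A]])
  obtain g where g: "g \<in> W" "g \<noteq> 0" "\<forall>f\<in>W. f / g \<in> const_sat poly_dom"
    using W by (rule generatorE)
  define B where "B = PXT.ext W"
  define F where "F = colon B B"
  have B: "B \<in> frac_ideals nagata_v" unfolding B_def by (rule PXT.frac_ideals_ext[OF W])
  have WB: "w \<in> B" if "w \<in> W" for w unfolding B_def by (rule PXT.hom_mem_ext[OF that])
  have "colon F B \<in> frac_ideals nagata_v" unfolding F_def by (intro T.frac_ideals_colon B)
  with val obtain J where J: "J \<in> frac_ideals base_dom" "colon F B = ideal_mult {1 / g} (DT.ext J)"
    using g(2) by (rule scaled_DT_extended)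
  have JE: "1 / g * embed j \<in> colon E W" if j: "j \<in> J" for j
  proof -
    have jF: "1 / g * embed j \<in> colon F B"
      unfolding J(2) by (rule ideal_multI[OF singletonI DT.hom_mem_ext[OF j]])
    have "1 / g * embed j * w * v \<in> W" if w: "w \<in> W" and v: "v \<in> W" for w v
    proof -
      have "1 / g * embed j * w \<in> F" by (rule colon_mult[OF jF WB[OF w]])
      then have T: "1 / g * embed j * w * v \<in> ideal_mult W nagata_v"
        using WB[OF v] unfolding F_def B_def PXT_ext by (rule colon_mult)
      \<comment> \<open>Over \<open>K[X]\<close> the product \<open>(1 / g) j w v\<close> is
        \<open>v\<close> times the constant \<open>j\<close> times
        \<open>w / g \<in> K[X]\<close>.\<close>
      have "v * (embed j) \<in> const_sat W"
        by (rule const_sat_mult[OF subW _ embed_const_sat]) (use const_sat_increasing v in blast)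
      then have "v * embed j * (w / g) \<in> const_sat W"
        by (rule const_sat_mult[OF subW]) (use g(3) w in blast)
      then have "1 / g * embed j * w * v \<in> const_sat W" by (simp add: ac_simps)
      then obtain k where "k \<noteq> 0" "cst k * (1 / g * embed j * w * v) \<in> W" by (rule const_satE)
      then have "1 / g * embed j * w * v \<in> w_cl poly_dom W" by (rule mem_w_cl_poly[OF val subW T])
      then show ?thesis unfolding wW .
    qed
    then show ?thesis unfolding E_def colon_def by blast
  qed
  define C where "C = ideal_mult W (colon E W)"
  have subC: "is_submodule poly_dom C" unfolding C_def by (rule is_submodule_ideal_mult[OF subW])
  have "ideal_mult B (colon F B) = F"
    using T B unfolding stable_dom_def stable_ideal_def Let_def F_def by blast
  moreover have "1 \<in> F" unfolding F_def colon_def by simp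
  ultimately have "1 \<in> ideal_mult B (colon F B)" by simp
  also have "ideal_mult B (colon F B) =
      ideal_mult (ideal_mult W (ideal_mult {1 / g} (embed ` J))) (ideal_mult nagata_v nagata_v)"
    unfolding J(2) unfolding B_def PXT_ext DT.ext_def by (simp add: ideal_mult_ac)
  also have "ideal_mult nagata_v nagata_v = (nagata_v :: 'a poly fract set)"
    by (rule T.ideal_mult_self[OF T.is_submodule_self])
  finally have "1 \<in> ideal_mult (ideal_mult W (ideal_mult {1 / g} (embed ` J))) nagata_v" .
  moreover have "ideal_mult {1 / g} (embed ` J) \<subseteq> colon E W"
    by (rule ideal_mult_subset[OF is_submodule_colon, of poly_dom])
       (use JE is_submodule_colon[OF subW] E_def in auto)
  then have "ideal_mult (ideal_mult W (ideal_mult {1 / g} (embed ` J))) nagata_v \<subseteq>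
      ideal_mult C nagata_v"
    unfolding C_def by (intro ideal_mult_mono subset_refl)
  ultimately have one_T: "1 \<in> ideal_mult C nagata_v" by blast
  obtain j where j: "j \<in> J" "j \<noteq> 0" using frac_idealsD(2)[OF J(1)] by blast
  \<comment> \<open>Over \<open>K[X]\<close> the ideal \<open>C\<close> contains the nonzero
    constant \<open>j\<close>, hence \<open>1\<close>.\<close>
  have "g * (1 / g * embed j) \<in> C" unfolding C_def by (rule ideal_multI[OF g(1) JE[OF j(1)]])
  then have "embed j \<in> const_sat C" using const_sat_increasing g(2) by auto
  then have "embed j * embed (1 / j) \<in> const_sat C"
    by (rule const_sat_mult[OF subC _ embed_const_sat])
  then have "1 \<in> const_sat C"
    unfolding embed.hom_mult[symmetric] using j(2) by (simp add: embed.hom_one)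
  then obtain k where k: "k \<noteq> 0" "cst k * 1 \<in> C" by (rule const_satE)
  have "1 \<in> w_cl poly_dom C" by (rule mem_w_cl_poly[OF val subC one_T k])
  then show "w_stable_ideal poly_dom A"
    unfolding C_def E_def W_def by (rule PX.w_stable_idealI[OF A])
qed

end

theorem theorem4p1:
  assumes integrally_closed: "integrally_closed (base_dom :: 'a::idom fract set)"
    and not_field: "\<not> (\<forall>x::'a. x \<noteq> 0 \<longrightarrow> x dvd 1)"
  shows "((Clifford_w_regular (base_dom :: 'a fract set) \<longleftrightarrow>
             Clifford_w_regular (poly_dom :: 'a poly fract set)) \<and>
          (Clifford_w_regular (poly_dom :: 'a poly fract set) \<longleftrightarrow>
             Clifford_regular (nagata_v :: 'a poly fract set))) \<and>
         ((w_stable_dom (base_dom :: 'a fract set) \<longleftrightarrow>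
             w_stable_dom (poly_dom :: 'a poly fract set)) \<and>
          (w_stable_dom (poly_dom :: 'a poly fract set) \<longleftrightarrow>
             stable_dom (nagata_v :: 'a poly fract set)))"
proof -
  obtain d :: 'a where "d \<noteq> 0" "\<not> d dvd 1" using not_field by blast
  then interpret nonfield_domain d by unfold_locales
  let ?D = "base_dom :: 'a fract set"
  let ?P = "poly_dom :: 'a poly fract set"
  let ?T = "nagata_v :: 'a poly fract set"
  have "Clifford_regular ?T" if "Clifford_w_regular ?D"
    using DT_extended[OF w_regular_base_locally_valuation[OF integrally_closed that]] that
    by (rule DT.Clifford_regular_extension)
  \<comment> \<open>This direction precedes any valuation property: \<open>T\<close> is a
    localization of \<open>D[X]\<close>, so its ideals are extended from there in any case.\<close>
  moreover have "Clifford_regular ?T" if "Clifford_w_regular ?P"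
    using PXT_extended that by (rule PXT.Clifford_regular_extension)
  moreover have "Clifford_w_regular ?D \<and> Clifford_w_regular ?P" if T: "Clifford_regular ?T"
  proof
    have val: locally_valuation
      by (rule regular_nagata_locally_valuation[OF integrally_closed T])
    show "Clifford_w_regular ?D"
      using DT_extended[OF val] DT_contracted T by (rule DT.Clifford_w_regular_contraction)
    show "Clifford_w_regular ?P" by (rule Clifford_w_regular_poly[OF val T])
  qed
  moreover have "stable_dom ?T" if "w_stable_dom ?D"
    using DT_extended[OF w_regular_base_locally_valuation[OF integrally_closed
      D.w_stable_imp_Clifford_w_regular[OF that]]] that
    by (rule DT.stable_extension)
  moreover have "stable_dom ?T" if "w_stable_dom ?P"
    using PXT_extended that by (rule PXT.stable_extension)
  moreover have "w_stable_dom ?D \<and> w_stable_dom ?P" if T: "stable_dom ?T"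
  proof
    have val: locally_valuation
      by (rule regular_nagata_locally_valuation[OF integrally_closed
            T.stable_imp_Clifford_regular[OF T]])
    show "w_stable_dom ?D"
      using DT_extended[OF val] DT_contracted T by (rule DT.w_stable_contraction)
    show "w_stable_dom ?P" by (rule w_stable_poly[OF val T])
  qed
  ultimately show ?thesis by blast
qed

end
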